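(* Let $(M,\omega)$ be a connected symplectic 6-manifold and let $\varphi$ be a smooth $\omega$-primitive 3-form on $M$ which lies pointwise in the orbit $\mathcal{O}_0^+$ and satisfies $d\varphi=0$ and $dF(\varphi)=0$. Let $K=K(\varphi)$, let $\mathcal{L}=\ker K=\mathrm{Im}\,K$ be the associated Lagrangian foliation, let $D$ be the partial connection $D_XY=K[X,K^{-1}Y]$, and let $g_L$ be the metric on each leaf $L$ given by $g_L(X,Y)=\omega(K^{-1}X,Y)$. Then the Bott connection $\nabla^B$ of $\mathcal{L}$ is dual to $D$ in the sense of Hessian structures, namely $\nabla^B=D'$, where $D'$ is defined on each leaf by $D+D'=2\nabla$ with $\nabla$ the Levi-Civita connection of $g_L$. In particular, with respect to the affine structure determined by $\nabla^B$, the metric $g_L$ on each leaf is Hessian, and its local potential functions all solve a real Monge-Ampère equation with constant right hand side (that is, the determinant of the Hessian of the potential in $\nabla^B$-affine coordinates is constant).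
   Context: A 3-form $\varphi$ on a symplectic 6-manifold $(M,\omega)$ is primitive if $\omega\wedge\varphi=0$. For a primitive 3-form $\varphi$, the endomorphism $K=K(\varphi)$ of $TM$ is defined by $\iota_{KX}\frac{\omega^3}{3!}=-\iota_X\varphi\wedge\varphi$, and the 3-form $F(\varphi)$ is defined by $F(\varphi)(X,Y,Z)=-2\varphi(KX,Y,Z)$. The form $\varphi$ lies in $\mathcal{O}_0^+$ at a point $p$ if there is a basis $e^1,\dots,e^6$ of $T_p^*M$ with $\omega=e^{12}+e^{34}+e^{56}$ and $\varphi=e^{146}+e^{236}+e^{245}$, where $e^{ij}=e^i\wedge e^j$ and $e^{ijk}=e^i\wedge e^j\wedge e^k$. For such $\varphi$ with $d\varphi=dF(\varphi)=0$, $\ker K=\mathrm{Im}\,K=\ker F(\varphi)=:\mathcal{L}$ is an integrable Lagrangian distribution; its leaves are its maximal integral immersed submanifolds. For a section $X$ of $\mathcal{L}$, $K^{-1}X$ denotes any local vector field with $K(K^{-1}X)=X$, determined up to sections of $\mathcal{L}$; $D$ and $g_L$ do not depend on this choice, $g_L$ is a Riemannian metric on each leaf, and $D$ restricts on each leaf $L$ to a torsion-free flat connection on $TL$ for which $g_L$ is Hessian (locally, in $D$-affine coordinates, the matrix of second derivatives of a potential function). The Bott (partial) connection $\nabla^B$ on the Lagrangian foliation $\mathcal{L}$ is characterized by $\omega(\nabla^B_XY,Z)=X\omega(Y,Z)+\omega([X,Z],Y)$ for $X,Y$ tangent to $\mathcal{L}$ and $Z$ an arbitrary vector field; it is torsion-free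 and flat on each leaf. Affine coordinates for a flat torsion-free connection are coordinates whose coordinate vector fields are parallel. *)

theory Defs
  imports "HOL-Analysis.Analysis"
begin

section \<open>Smooth maps and smooth manifolds\<close>

text \<open>All notions of smoothness and all derivatives below are used on open subsets of
  Euclidean spaces only.\<close>

primrec C_k_on :: "nat \<Rightarrow> 'v::real_normed_vector set \<Rightarrow> ('v \<Rightarrow> 'w::real_normed_vector) \<Rightarrow> bool" where
  "C_k_on 0 S f \<longleftrightarrow> continuous_on S f"
| "C_k_on (Suc k) S f \<longleftrightarrow>
     (\<forall>x\<in>S. f differentiable (at x)) \<and>
     (\<forall>v. C_k_on k S (\<lambda>x. frechet_derivative f (at x) v))"

definition smooth_on :: "'v::real_normed_vector set \<Rightarrow> ('v \<Rightarrow> 'w::real_normed_vector) \<Rightarrow> bool" where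
  "smooth_on S f \<longleftrightarrow> (\<forall>k. C_k_on k S f)"

text \<open>A chart is a pair of its domain and its coordinate map (whose values outside the domain
  are irrelevant). The dimension of the manifold is the cardinality of the index type.\<close>

type_synonym ('a, 'n) chart = "'a set \<times> ('a \<Rightarrow> real ^ 'n)"

definition img :: "('a, 'n) chart \<Rightarrow> (real ^ 'n) set" where
  "img c = snd c ` fst c"

text \<open>The map \<open>c' \<circ> c\<inverse>\<close>. The two charts may belong to manifolds of different dimensions: the
  same expression is the coordinate representation of the inclusion of an immersed submanifold.\<close>

definition trans_map :: "('a, 'm) chart \<Rightarrow> ('a, 'n) chart \<Rightarrow> real ^ 'm \<Rightarrow> real ^ 'n" where
  "trans_map c c' = (\<lambda>x. snd c' (inv_into (fst c) (snd c) x))"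

definition is_chart :: "'a topology \<Rightarrow> ('a, 'n::finite) chart \<Rightarrow> bool" where
  "is_chart T c \<longleftrightarrow> openin T (fst c) \<and> open (img c) \<and>
     homeomorphic_map (subtopology T (fst c)) (top_of_set (img c)) (snd c)"

definition compatible :: "('a, 'n::finite) chart \<Rightarrow> ('a, 'n) chart \<Rightarrow> bool" where
  "compatible c c' \<longleftrightarrow>
     smooth_on (snd c ` (fst c \<inter> fst c')) (trans_map c c') \<and>
     smooth_on (snd c' ` (fst c \<inter> fst c')) (trans_map c' c)"

text \<open>A smooth manifold with its maximal atlas.\<close>

definition smooth_manifold :: "'a topology \<Rightarrow> ('a, 'n::finite) chart set \<Rightarrow> bool" where
  "smooth_manifold T A \<longleftrightarrow>
     Hausdorff_space T \<and> second_countable T \<and>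
     (\<forall>c\<in>A. is_chart T c) \<and> (\<Union>c\<in>A. fst c) = topspace T \<and>
     (\<forall>c\<in>A. \<forall>c'\<in>A. compatible c c') \<and>
     (\<forall>c. is_chart T c \<and> (\<forall>c'\<in>A. compatible c c') \<longrightarrow> c \<in> A)"

section \<open>Tensor fields\<close>

text \<open>Tensor fields are given by their components in every chart of the atlas, subject to the
  usual transformation law. Only the values on the images of the charts matter.\<close>

type_synonym ('a, 'n) vfield = "('a, 'n) chart \<Rightarrow> real ^ 'n \<Rightarrow> real ^ 'n"

text \<open>The last argument of a \<open>k\<close>-form is the list of the \<open>k\<close> tangent vectors it is evaluated on.\<close>

type_synonym ('a, 'n) form = "('a, 'n) chart \<Rightarrow> real ^ 'n \<Rightarrow> (real ^ 'n) list \<Rightarrow> real"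

definition vector_field :: "('a, 'n::finite) chart set \<Rightarrow> 'a set \<Rightarrow> ('a, 'n) vfield \<Rightarrow> bool" where
  "vector_field A W X \<longleftrightarrow>
     (\<forall>c\<in>A. smooth_on (snd c ` (fst c \<inter> W)) (X c)) \<and>
     (\<forall>c\<in>A. \<forall>c'\<in>A. \<forall>p\<in>fst c \<inter> fst c' \<inter> W.
        X c' (snd c' p) = frechet_derivative (trans_map c c') (at (snd c p)) (X c (snd c p)))"

definition lie_bracket :: "('a, 'n::finite) vfield \<Rightarrow> ('a, 'n) vfield \<Rightarrow> ('a, 'n) vfield" where
  "lie_bracket X Y = (\<lambda>c x. frechet_derivative (Y c) (at x) (X c x)
                          - frechet_derivative (X c) (at x) (Y c x))"

definition alternating :: "nat \<Rightarrow> ('v::real_vector list \<Rightarrow> real) \<Rightarrow> bool" where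
  "alternating k \<alpha> \<longleftrightarrow>
     (\<forall>vs. length vs = k \<longrightarrow>
        (\<forall>i<k. linear (\<lambda>v. \<alpha> (vs[i := v]))) \<and>
        (\<forall>i<k. \<forall>j<k. i \<noteq> j \<and> vs ! i = vs ! j \<longrightarrow> \<alpha> vs = 0))"

definition diff_form :: "('a, 'n::finite) chart set \<Rightarrow> nat \<Rightarrow> ('a, 'n) form \<Rightarrow> bool" where
  "diff_form A k \<alpha> \<longleftrightarrow>
     (\<forall>c\<in>A. \<forall>x\<in>img c. alternating k (\<alpha> c x)) \<and>
     (\<forall>c\<in>A. \<forall>vs. length vs = k \<longrightarrow> smooth_on (img c) (\<lambda>x. \<alpha> c x vs)) \<and>
     (\<forall>c\<in>A. \<forall>c'\<in>A. \<forall>p\<in>fst c \<inter> fst c'. \<forall>vs. length vs = k \<longrightarrow>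
        \<alpha> c (snd c p) vs =
        \<alpha> c' (snd c' p) (map (frechet_derivative (trans_map c c') (at (snd c p))) vs))"

text \<open>The wedge product of a \<open>k\<close>-form with another form, as the sum over all shuffles: \<open>S\<close> is the
  set of positions of the arguments passed to the first factor, and the exponent of \<open>-1\<close> counts
  the inversions of the shuffle. In particular \<open>e\<^sup>1 \<and> \<dots> \<and> e\<^sup>k\<close> evaluated on \<open>v\<^sub>1, \<dots>, v\<^sub>k\<close> is the
  determinant of the matrix \<open>(e\<^sup>i v\<^sub>j)\<close>.\<close>

definition wedge :: "nat \<Rightarrow> ('v list \<Rightarrow> real) \<Rightarrow> ('v list \<Rightarrow> real) \<Rightarrow> 'v list \<Rightarrow> real" where
  "wedge k \<alpha> \<beta> vs =
     (\<Sum>S | S \<subseteq> {..<length vs} \<and> card S = k.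
        (-1) ^ card {(i, j). i \<in> S \<and> j \<in> {..<length vs} - S \<and> j < i}
        * \<alpha> (nths vs S) * \<beta> (nths vs (- S)))"

definition interior_product :: "'v \<Rightarrow> ('v list \<Rightarrow> real) \<Rightarrow> 'v list \<Rightarrow> real" where
  "interior_product v \<alpha> = (\<lambda>vs. \<alpha> (v # vs))"

text \<open>The exterior derivative: the arguments are regarded as constant vector fields in the chart,
  so that no bracket terms occur.\<close>

definition ext_deriv :: "('a, 'n::finite) form \<Rightarrow> ('a, 'n) form" where
  "ext_deriv \<alpha> = (\<lambda>c x vs. \<Sum>i<length vs.
     (-1) ^ i * frechet_derivative (\<lambda>y. \<alpha> c y (nths vs (- {i}))) (at x) (vs ! i))"

definition closed_form :: "('a, 'n::finite) chart set \<Rightarrow> nat \<Rightarrow> ('a, 'n) form \<Rightarrow> bool" where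
  "closed_form A k \<alpha> \<longleftrightarrow>
     (\<forall>c\<in>A. \<forall>x\<in>img c. \<forall>vs. length vs = Suc k \<longrightarrow> ext_deriv \<alpha> c x vs = 0)"

definition symplectic_form :: "('a, 'n::finite) chart set \<Rightarrow> ('a, 'n) form \<Rightarrow> bool" where
  "symplectic_form A \<omega> \<longleftrightarrow> diff_form A 2 \<omega> \<and> closed_form A 2 \<omega> \<and>
     (\<forall>c\<in>A. \<forall>x\<in>img c. \<forall>u. u \<noteq> 0 \<longrightarrow> (\<exists>v. \<omega> c x [u, v] \<noteq> 0))"

section \<open>Primitive 3-forms on symplectic 6-manifolds\<close>

definition primitive :: "('a, 6) chart set \<Rightarrow> ('a, 6) form \<Rightarrow> ('a, 6) form \<Rightarrow> bool" where
  "primitive A \<omega> \<phi> \<longleftrightarrow>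
     (\<forall>c\<in>A. \<forall>x\<in>img c. \<forall>vs. length vs = 5 \<longrightarrow> wedge 2 (\<omega> c x) (\<phi> c x) vs = 0)"

definition K_end :: "('a, 6) form \<Rightarrow> ('a, 6) form \<Rightarrow> ('a, 6) chart \<Rightarrow> real ^ 6 \<Rightarrow> real ^ 6 \<Rightarrow> real ^ 6" where
  "K_end \<omega> \<phi> c x u = (THE w. \<forall>vs. length vs = 5 \<longrightarrow>
     interior_product w (\<lambda>us. wedge 2 (\<omega> c x) (wedge 2 (\<omega> c x) (\<omega> c x)) us / fact 3) vs
     = - wedge 2 (interior_product u (\<phi> c x)) (\<phi> c x) vs)"

definition F_form :: "('a, 6) form \<Rightarrow> ('a, 6) form \<Rightarrow> ('a, 6) form" where
  "F_form \<omega> \<phi> = (\<lambda>c x vs. - 2 * \<phi> c x (K_end \<omega> \<phi> c x (hd vs) # tl vs))"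

text \<open>Cotangent vectors are bounded linear functionals, regarded as 1-forms.\<close>

definition covec :: "('v::real_normed_vector \<Rightarrow>\<^sub>L real) \<Rightarrow> 'v list \<Rightarrow> real" where
  "covec e = (\<lambda>vs. blinfun_apply e (hd vs))"

definition e2 :: "(nat \<Rightarrow> 'v::real_normed_vector \<Rightarrow>\<^sub>L real) \<Rightarrow> nat \<Rightarrow> nat \<Rightarrow> 'v list \<Rightarrow> real" where
  "e2 e i j = wedge 1 (covec (e i)) (covec (e j))"

definition e3 :: "(nat \<Rightarrow> 'v::real_normed_vector \<Rightarrow>\<^sub>L real) \<Rightarrow> nat \<Rightarrow> nat \<Rightarrow> nat \<Rightarrow> 'v list \<Rightarrow> real" where
  "e3 e i j k = wedge 1 (covec (e i)) (wedge 1 (covec (e j)) (covec (e k)))"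

definition in_O0_plus :: "('v::real_normed_vector list \<Rightarrow> real) \<Rightarrow> ('v list \<Rightarrow> real) \<Rightarrow> bool" where
  "in_O0_plus \<omega> \<phi> \<longleftrightarrow> (\<exists>e :: nat \<Rightarrow> 'v \<Rightarrow>\<^sub>L real.
     inj_on e {1..6} \<and> independent (e ` {1..6}) \<and> span (e ` {1..6}) = UNIV \<and>
     (\<forall>vs. length vs = 2 \<longrightarrow> \<omega> vs = e2 e 1 2 vs + e2 e 3 4 vs + e2 e 5 6 vs) \<and>
     (\<forall>vs. length vs = 3 \<longrightarrow> \<phi> vs = e3 e 1 4 6 vs + e3 e 2 3 6 vs + e3 e 2 4 5 vs))"

text \<open>Vector fields tangent to the distribution \<open>\<L> = ker K\<close>.\<close>

definition L_section :: "'a topology \<Rightarrow> ('a, 6) chart set \<Rightarrow> ('a, 6) form \<Rightarrow> ('a, 6) form \<Rightarrow>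
    'a set \<Rightarrow> ('a, 6) vfield \<Rightarrow> bool" where
  "L_section T A \<omega> \<phi> W X \<longleftrightarrow> openin T W \<and> vector_field A W X \<and>
     (\<forall>c\<in>A. \<forall>p\<in>fst c \<inter> W. K_end \<omega> \<phi> c (snd c p) (X c (snd c p)) = 0)"

text \<open>The partial connections on \<open>\<L>\<close> are given by their graphs: \<open>Z\<close> is the covariant derivative
  of \<open>Y\<close> along \<open>X\<close>, over the open set \<open>W\<close>. In the first one, \<open>V\<close> is a choice of \<open>K\<inverse> Y\<close>.\<close>

definition D_graph :: "'a topology \<Rightarrow> ('a, 6) chart set \<Rightarrow> ('a, 6) form \<Rightarrow> ('a, 6) form \<Rightarrow>
    'a set \<Rightarrow> ('a, 6) vfield \<Rightarrow> ('a, 6) vfield \<Rightarrow> ('a, 6) vfield \<Rightarrow> bool" where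
  "D_graph T A \<omega> \<phi> W X Y Z \<longleftrightarrow>
     L_section T A \<omega> \<phi> W X \<and> L_section T A \<omega> \<phi> W Y \<and>
     (\<exists>V. vector_field A W V \<and>
        (\<forall>c\<in>A. \<forall>p\<in>fst c \<inter> W.
           K_end \<omega> \<phi> c (snd c p) (V c (snd c p)) = Y c (snd c p) \<and>
           Z c (snd c p) = K_end \<omega> \<phi> c (snd c p) (lie_bracket X V c (snd c p))))"

definition Bott_graph :: "'a topology \<Rightarrow> ('a, 6) chart set \<Rightarrow> ('a, 6) form \<Rightarrow> ('a, 6) form \<Rightarrow>
    'a set \<Rightarrow> ('a, 6) vfield \<Rightarrow> ('a, 6) vfield \<Rightarrow> ('a, 6) vfield \<Rightarrow> bool" where
  "Bott_graph T A \<omega> \<phi> W X Y Z \<longleftrightarrow>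
     L_section T A \<omega> \<phi> W X \<and> L_section T A \<omega> \<phi> W Y \<and> L_section T A \<omega> \<phi> W Z \<and>
     (\<forall>V. vector_field A W V \<longrightarrow>
        (\<forall>c\<in>A. \<forall>x\<in>snd c ` (fst c \<inter> W).
           \<omega> c x [Z c x, V c x] =
             frechet_derivative (\<lambda>y. \<omega> c y [Y c y, V c y]) (at x) (X c x)
             + \<omega> c x [lie_bracket X V c x, Y c x]))"

section \<open>Leaves\<close>

text \<open>An immersed submanifold is a manifold structure \<open>(TL, AL)\<close> on a subset of \<open>M\<close> whose
  inclusion into \<open>M\<close> is a smooth immersion. Here the image of its differential is required to be
  \<open>ker K\<close> at every point.\<close>

definition integral_submanifold :: "'a topology \<Rightarrow> ('a, 6) chart set \<Rightarrow> ('a, 6) form \<Rightarrow> ('a, 6) form \<Rightarrow>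
    'a topology \<Rightarrow> ('a, 3) chart set \<Rightarrow> bool" where
  "integral_submanifold T A \<omega> \<phi> TL AL \<longleftrightarrow>
     smooth_manifold TL AL \<and> connected_space TL \<and> topspace TL \<noteq> {} \<and>
     continuous_map TL T id \<and>
     (\<forall>b\<in>AL. \<forall>c\<in>A.
        smooth_on (snd b ` (fst b \<inter> fst c)) (trans_map b c) \<and>
        (\<forall>p\<in>fst b \<inter> fst c.
           inj (frechet_derivative (trans_map b c) (at (snd b p))) \<and>
           range (frechet_derivative (trans_map b c) (at (snd b p)))
             = {w. K_end \<omega> \<phi> c (snd c p) w = 0}))"

definition leaf :: "'a topology \<Rightarrow> ('a, 6) chart set \<Rightarrow> ('a, 6) form \<Rightarrow> ('a, 6) form \<Rightarrow>
    'a topology \<Rightarrow> ('a, 3) chart set \<Rightarrow> bool" where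
  "leaf T A \<omega> \<phi> TL AL \<longleftrightarrow> integral_submanifold T A \<omega> \<phi> TL AL \<and>
     (\<forall>TL' AL'. integral_submanifold T A \<omega> \<phi> TL' AL' \<and> topspace TL \<subseteq> topspace TL' \<longrightarrow>
        topspace TL' = topspace TL)"

text \<open>The symmetric bilinear form \<open>g\<^sub>L(u, v) = \<omega>(K\<inverse> u, v)\<close> on the leaf. It is computed in some
  chart of the ambient manifold around the point; \<open>inv\<close> picks some preimage under \<open>K\<close>.\<close>

definition leaf_metric :: "('a, 6) chart set \<Rightarrow> ('a, 6) form \<Rightarrow> ('a, 6) form \<Rightarrow>
    ('a, 3) chart \<Rightarrow> real ^ 3 \<Rightarrow> real ^ 3 \<Rightarrow> real ^ 3 \<Rightarrow> real" where
  "leaf_metric A \<omega> \<phi> b y u v =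
     (let p = inv_into (fst b) (snd b) y;
          c = (SOME c. c \<in> A \<and> p \<in> fst c);
          \<iota> = frechet_derivative (trans_map b c) (at y)
      in \<omega> c (snd c p) [inv (K_end \<omega> \<phi> c (snd c p)) (\<iota> u), \<iota> v])"

section \<open>Affine connections\<close>

text \<open>An affine connection is given by its Christoffel symbols \<open>\<Gamma>\<close> in every chart.\<close>

type_synonym ('a, 'n) christoffel = "('a, 'n) chart \<Rightarrow> real ^ 'n \<Rightarrow> real ^ 'n \<Rightarrow> real ^ 'n \<Rightarrow> real ^ 'n"

definition cov_deriv :: "('a, 'n::finite) christoffel \<Rightarrow> ('a, 'n) vfield \<Rightarrow> ('a, 'n) vfield \<Rightarrow> ('a, 'n) vfield" where
  "cov_deriv \<Gamma> X Y = (\<lambda>c x. frechet_derivative (Y c) (at x) (X c x) + \<Gamma> c x (X c x) (Y c x))"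

definition affine_connection :: "'a topology \<Rightarrow> ('a, 'n::finite) chart set \<Rightarrow> ('a, 'n) christoffel \<Rightarrow> bool" where
  "affine_connection T A \<Gamma> \<longleftrightarrow>
     (\<forall>c\<in>A. \<forall>x\<in>img c. bilinear (\<Gamma> c x)) \<and>
     (\<forall>c\<in>A. \<forall>u v. smooth_on (img c) (\<lambda>x. \<Gamma> c x u v)) \<and>
     (\<forall>W X Y. openin T W \<and> vector_field A W X \<and> vector_field A W Y \<longrightarrow>
        vector_field A W (cov_deriv \<Gamma> X Y))"

definition torsion_free :: "('a, 'n::finite) chart set \<Rightarrow> ('a, 'n) christoffel \<Rightarrow> bool" where
  "torsion_free A \<Gamma> \<longleftrightarrow> (\<forall>c\<in>A. \<forall>x\<in>img c. \<forall>u v. \<Gamma> c x u v = \<Gamma> c x v u)"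

definition flat :: "('a, 'n::finite) chart set \<Rightarrow> ('a, 'n) christoffel \<Rightarrow> bool" where
  "flat A \<Gamma> \<longleftrightarrow> (\<forall>c\<in>A. \<forall>x\<in>img c. \<forall>u v w.
     frechet_derivative (\<lambda>y. \<Gamma> c y v w) (at x) u - frechet_derivative (\<lambda>y. \<Gamma> c y u w) (at x) v
     + \<Gamma> c x u (\<Gamma> c x v w) - \<Gamma> c x v (\<Gamma> c x u w) = 0)"

definition levi_civita :: "'a topology \<Rightarrow> ('a, 'n::finite) chart set \<Rightarrow>
    (('a, 'n) chart \<Rightarrow> real ^ 'n \<Rightarrow> real ^ 'n \<Rightarrow> real ^ 'n \<Rightarrow> real) \<Rightarrow> ('a, 'n) christoffel \<Rightarrow> bool" where
  "levi_civita T A g \<Gamma> \<longleftrightarrow> affine_connection T A \<Gamma> \<and> torsion_free A \<Gamma> \<and>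
     (\<forall>c\<in>A. \<forall>x\<in>img c. \<forall>u v w.
        frechet_derivative (\<lambda>y. g c y v w) (at x) u = g c x (\<Gamma> c x u v) w + g c x v (\<Gamma> c x u w))"

text \<open>The vector field \<open>X'\<close> on the part of a submanifold inside \<open>W\<close> is the restriction of
  the vector field \<open>X\<close> on \<open>W\<close>.\<close>

definition restriction_of :: "('a, 6) chart set \<Rightarrow> ('a, 3) chart set \<Rightarrow> 'a set \<Rightarrow>
    ('a, 6) vfield \<Rightarrow> ('a, 3) vfield \<Rightarrow> bool" where
  "restriction_of A AL W X X' \<longleftrightarrow>
     (\<forall>b\<in>AL. \<forall>c\<in>A. \<forall>p\<in>fst b \<inter> fst c \<inter> W.
        frechet_derivative (trans_map b c) (at (snd b p)) (X' b (snd b p)) = X c (snd c p))"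

text \<open>The connection \<open>\<Gamma>\<close> on the leaf is the restriction of the partial connection with graph
  \<open>G\<close>.\<close>

definition restricted_connection :: "('a, 6) chart set \<Rightarrow>
    ('a set \<Rightarrow> ('a, 6) vfield \<Rightarrow> ('a, 6) vfield \<Rightarrow> ('a, 6) vfield \<Rightarrow> bool) \<Rightarrow>
    'a topology \<Rightarrow> ('a, 3) chart set \<Rightarrow> ('a, 3) christoffel \<Rightarrow> bool" where
  "restricted_connection A G TL AL \<Gamma> \<longleftrightarrow> affine_connection TL AL \<Gamma> \<and>
     (\<forall>W X Y Z X' Y'. G W X Y Z \<and>
        vector_field AL (W \<inter> topspace TL) X' \<and> vector_field AL (W \<inter> topspace TL) Y' \<and>
        restriction_of A AL W X X' \<and> restriction_of A AL W Y Y' \<longrightarrow>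
        restriction_of A AL W Z (cov_deriv \<Gamma> X' Y'))"

section \<open>Hessian structures\<close>

text \<open>The connection \<open>D'\<close> with \<open>D + D' = 2 N\<close>, where \<open>N\<close> is the Levi-Civita connection in the application.\<close>

definition dual_connection :: "('a, 'n::finite) christoffel \<Rightarrow> ('a, 'n) christoffel \<Rightarrow> ('a, 'n) christoffel" where
  "dual_connection N D = (\<lambda>c x u v. 2 *\<^sub>R N c x u v - D c x u v)"

text \<open>The coordinate vector field \<open>\<partial>\<^sub>i\<close> has the constant components \<open>axis i 1\<close> in its own chart,
  so its covariant derivative along \<open>\<partial>\<^sub>j\<close> is given by the Christoffel symbols alone. Since
  atlases are maximal, every affine coordinate system is a member of the atlas.\<close>

definition affine_chart :: "('a, 'n::finite) chart set \<Rightarrow> ('a, 'n) christoffel \<Rightarrow> ('a, 'n) chart \<Rightarrow> bool" where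
  "affine_chart A \<Gamma> b \<longleftrightarrow> b \<in> A \<and> (\<forall>y\<in>img b. \<forall>i j. \<Gamma> b y (axis j 1) (axis i 1) = 0)"

definition hessian_matrix :: "(real ^ 'n::finite \<Rightarrow> real) \<Rightarrow> real ^ 'n \<Rightarrow> real ^ 'n ^ 'n" where
  "hessian_matrix f y =
     (\<chi> i j. frechet_derivative (\<lambda>z. frechet_derivative f (at z) (axis j 1)) (at y) (axis i 1))"

text \<open>\<open>f\<close> is a potential of \<open>g\<close> on the part \<open>S\<close> of the image of the affine chart \<open>b\<close>.\<close>

definition local_potential :: "(('a, 'n::finite) chart \<Rightarrow> real ^ 'n \<Rightarrow> real ^ 'n \<Rightarrow> real ^ 'n \<Rightarrow> real) \<Rightarrow>
    ('a, 'n) chart \<Rightarrow> (real ^ 'n) set \<Rightarrow> (real ^ 'n \<Rightarrow> real) \<Rightarrow> bool" where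
  "local_potential g b S f \<longleftrightarrow> open S \<and> S \<subseteq> img b \<and> smooth_on S f \<and>
     (\<forall>y\<in>S. \<forall>i j. hessian_matrix f y $ i $ j = g b y (axis i 1) (axis j 1))"

definition hessian_metric :: "('a, 'n::finite) chart set \<Rightarrow> ('a, 'n) christoffel \<Rightarrow>
    (('a, 'n) chart \<Rightarrow> real ^ 'n \<Rightarrow> real ^ 'n \<Rightarrow> real ^ 'n \<Rightarrow> real) \<Rightarrow> bool" where
  "hessian_metric A \<Gamma> g \<longleftrightarrow> torsion_free A \<Gamma> \<and> flat A \<Gamma> \<and>
     (\<forall>b. affine_chart A \<Gamma> b \<longrightarrow> (\<forall>y\<in>img b. \<exists>S f. y \<in> S \<and> local_potential g b S f))"

end

theory Submission
  imports Defs
begin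

text \<open>In an adapted coframe \<open>K\<close> maps \<open>e\<^sub>2, e\<^sub>4, e\<^sub>6\<close> to \<open>-2e\<^sub>1, -2e\<^sub>3, -2e\<^sub>5\<close> and kills \<open>e\<^sub>1, e\<^sub>3, e\<^sub>5\<close>, and
  \<open>F(\<phi>) = 4 e\<^sup>2\<^sup>4\<^sup>6\<close>. The equations \<open>d\<phi> = dF(\<phi>) = 0\<close> imply that the Nijenhuis tensor of \<open>K\<close> vanishes and that
  \<open>F(\<phi>)\<close> is invariant under the sections of the distribution. The definitions of \<open>D\<close>, of \<open>g\<close> and of the Bott connection \<open>B\<close>
  give at once \<open>X g(Y, Z) = g(D\<^sub>X Y, Z) + g(Y, B\<^sub>X Z)\<close>. Now \<open>D\<close> is torsion-free because the Nijenhuis tensor is zero, and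
  \<open>B\<close> is torsion-free because \<open>\<omega>\<close> is closed. So \<open>(D + B) / 2\<close> is torsion-free and metric, that is, it is the
  Levi-Civita connection. In \<open>B\<close>-affine coordinates the duality formula reads \<open>\<partial>\<^sub>u g(v, w) = g(D\<^sub>u v, w)\<close>, which is
  symmetric in \<open>u\<close> and \<open>v\<close>; the Poincare lemma, applied twice, then yields a potential. Finally, \<open>F(\<phi>)\<close> induces through \<open>K\<close>
  a \<open>D\<close>-parallel volume form on the leaf, which is a constant multiple of the Riemannian one; since the latter
  is parallel for the Levi-Civita connection, it is parallel for \<open>B\<close> as well, so \<open>det g\<close> is locally constant.\<close>

section \<open>Calculus of smooth maps\<close>

text \<open>The data are implicit: \<open>K_end\<close> is a definite description, preimages under
  it are choices, and the partial connections are graphs quantifying over all vector fields and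
  charts. The adapted coframe exists only point by point, so it yields algebra but no smoothness.
  Hence \<open>K\<close>, the chosen preimages, the Bott derivatives and the restrictions of fields
  to a leaf are each recovered as the unique solution of a linear system with smooth coefficients.
  The connections are made explicit on test fields \<open>K a\<close> with \<open>a\<close> constant
  in an ambient chart. Such fields span the distribution, \<open>a\<close> is a preimage of
  \<open>K a\<close>, and the bracket of \<open>K a\<close> with a constant field \<open>d\<close>
  is minus the derivative of \<open>K\<close> in direction \<open>d\<close>, applied to
  \<open>a\<close>. Torsion, duality and curvature thereby become identities between the components
  of \<omega>, \<phi>, \<open>K\<close> and their derivatives. A Hessian structure also needs the
  Bott connection to be flat. This uses the Nijenhuis identity of \<open>K\<close> once more, now
  differentiated in an arbitrary, possibly transverse direction.\<close>

abbreviation fderiv :: "('v::real_normed_vector \<Rightarrow> 'w::real_normed_vector) \<Rightarrow> 'v \<Rightarrow> 'v \<Rightarrow> 'w" where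
  "fderiv f x \<equiv> frechet_derivative f (at x)"

lemma fderiv_eqI: "(f has_derivative f') (at x) \<Longrightarrow> fderiv f x = f'"
  by (metis frechet_derivative_at)

text \<open>Differentiability is not assumed: both functions have the same derivatives in the sense
  of \<open>has_derivative\<close>, so the choice made by \<open>frechet_derivative\<close> is the
  same.\<close>

lemma fderiv_cong_open:
  assumes "open S" "x \<in> S" "\<And>y. y \<in> S \<Longrightarrow> f y = g y"
  shows "fderiv f x = fderiv g x"
proof -
  have "(f has_derivative h) (at x) \<longleftrightarrow> (g has_derivative h) (at x)" for h
    using assms has_derivative_transform_within_open[of f h x UNIV S g]
      has_derivative_transform_within_open[of g h x UNIV S f] by auto
  then show ?thesis by (simp add: frechet_derivative_def)
qed

lemma has_derivative_fderiv: "f differentiable (at x) \<Longrightarrow> (f has_derivative fderiv f x) (at x)"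
  by (simp add: frechet_derivative_works)

section \<open>Closure properties of C^k maps on open sets\<close>

lemma C_k_on_cong_imp:
  assumes "open S" "\<And>x. x \<in> S \<Longrightarrow> f x = g x" "C_k_on k S f"
  shows "C_k_on k S g"
  using assms(2,3)
proof (induction k arbitrary: f g)
  case 0
  then show ?case by (simp cong: continuous_on_cong)
next
  case (Suc k)
  have "g differentiable (at x)" if "x \<in> S" for x
  proof -
    have "(f has_derivative fderiv f x) (at x)"
      using Suc.prems that by (auto intro: has_derivative_fderiv)
    then have "(g has_derivative fderiv f x) (at x)"
      using has_derivative_transform_within_open[of f _ x UNIV S g] assms(1) that Suc.prems(1) by auto
    then show ?thesis by (auto simp: differentiable_def)
  qed
  moreover have "C_k_on k S (\<lambda>x. fderiv g x v)" for v
  proof (rule Suc.IH)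
    show "fderiv f x v = fderiv g x v" if "x \<in> S" for x
      using fderiv_cong_open[OF assms(1) that, of f g] Suc.prems(1) by simp
    show "C_k_on k S (\<lambda>x. fderiv f x v)"
      using Suc.prems by simp
  qed
  ultimately show ?case by simp
qed

lemma C_k_on_cong:
  assumes "open S" "\<And>x. x \<in> S \<Longrightarrow> f x = g x"
  shows "C_k_on k S f \<longleftrightarrow> C_k_on k S g"
  using C_k_on_cong_imp[OF assms(1)] assms(2) by metis

lemma C_k_on_SucD: "C_k_on (Suc k) S f \<Longrightarrow> C_k_on k S f"
proof (induction k arbitrary: f)
  case 0
  then show ?case
    by (auto intro!: continuous_at_imp_continuous_on differentiable_imp_continuous_within)
next
  case (Suc k)
  then show ?case by (auto simp del: C_k_on.simps(2) simp: C_k_on.simps(2)[of "Suc k"] C_k_on.simps(2)[of k])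
qed

lemma C_k_on_subset: "C_k_on k S f \<Longrightarrow> S' \<subseteq> S \<Longrightarrow> C_k_on k S' f"
  by (induction k arbitrary: f) (auto intro: continuous_on_subset)

lemma C_k_on_const: "C_k_on k S (\<lambda>x. c)"
  by (induction k arbitrary: c) auto

text \<open>Replaces the chosen derivative by an explicit formula; the closure lemmas below supply
  it by the sum, product or chain rule and treat its terms by induction on \<open>k\<close>.\<close>

lemma C_k_on_Suc_has_derivativeI:
  assumes "open S" "\<And>x. x \<in> S \<Longrightarrow> (f has_derivative f' x) (at x)"
    and "\<And>v. C_k_on k S (\<lambda>x. f' x v)"
  shows "C_k_on (Suc k) S f"
proof -
  have "C_k_on k S (\<lambda>x. fderiv f x v)" for v
    by (rule C_k_on_cong_imp[OF assms(1) _ assms(3)]) (simp add: fderiv_eqI[OF assms(2)])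
  then show ?thesis
    using assms(2) by (auto simp: differentiable_def)
qed

lemma C_k_on_add:
  assumes "open S" "C_k_on k S f" "C_k_on k S g"
  shows "C_k_on k S (\<lambda>x. f x + g x)"
  using assms(2,3)
proof (induction k arbitrary: f g)
  case 0
  then show ?case by (simp add: continuous_on_add)
next
  case (Suc k)
  show ?case
  proof (rule C_k_on_Suc_has_derivativeI[OF assms(1)])
    fix x assume "x \<in> S"
    then show "((\<lambda>x. f x + g x) has_derivative (\<lambda>v. fderiv f x v + fderiv g x v)) (at x)"
      using Suc.prems by (intro has_derivative_add has_derivative_fderiv) auto
  next
    show "C_k_on k S (\<lambda>x. fderiv f x v + fderiv g x v)" for v
      using Suc by auto
  qed
qed

lemma C_k_on_bilinear:
  assumes "bounded_bilinear bop" "open S" "C_k_on k S f" "C_k_on k S g"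
  shows "C_k_on k S (\<lambda>x. bop (f x) (g x))"
  using assms(3,4)
proof (induction k arbitrary: f g)
  case 0
  then show ?case
    using bounded_bilinear.continuous_on[OF assms(1)] by simp
next
  case (Suc k)
  show ?case
  proof (rule C_k_on_Suc_has_derivativeI[OF assms(2)])
    fix x assume "x \<in> S"
    then show "((\<lambda>x. bop (f x) (g x)) has_derivative
        (\<lambda>v. bop (f x) (fderiv g x v) + bop (fderiv f x v) (g x))) (at x)"
      using Suc.prems by (intro bounded_bilinear.FDERIV[OF assms(1)] has_derivative_fderiv) auto
  next
    show "C_k_on k S (\<lambda>x. bop (f x) (fderiv g x v) + bop (fderiv f x v) (g x))" for v
      using Suc C_k_on_SucD[OF Suc.prems(1)] C_k_on_SucD[OF Suc.prems(2)]
      by (intro C_k_on_add[OF assms(2)] Suc.IH) auto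
  qed
qed

lemma C_k_on_bounded_linear:
  assumes "bounded_linear L" "open S" "C_k_on k S f"
  shows "C_k_on k S (\<lambda>x. L (f x))"
  using assms(3)
proof (induction k arbitrary: f)
  case 0
  then show ?case
    using bounded_linear.continuous_on[OF assms(1)] by simp
next
  case (Suc k)
  show ?case
  proof (rule C_k_on_Suc_has_derivativeI[OF assms(2)])
    fix x assume "x \<in> S"
    then show "((\<lambda>x. L (f x)) has_derivative (\<lambda>v. L (fderiv f x v))) (at x)"
      using Suc.prems by (intro bounded_linear.has_derivative[OF assms(1)] has_derivative_fderiv) auto
  qed (use Suc in auto)
qed

lemma C_k_on_inverse:
  fixes f :: "'v::real_normed_vector \<Rightarrow> real"
  assumes "open S" "C_k_on k S f" "\<And>x. x \<in> S \<Longrightarrow> f x \<noteq> 0"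
  shows "C_k_on k S (\<lambda>x. inverse (f x))"
  using assms(2)
proof (induction k)
  case 0
  then show ?case using assms(3) by (auto intro: continuous_on_inverse)
next
  case (Suc k)
  show ?case
  proof (rule C_k_on_Suc_has_derivativeI[OF assms(1)])
    fix x assume "x \<in> S"
    then show "((\<lambda>x. inverse (f x)) has_derivative
        (\<lambda>v. - (inverse (f x) * fderiv f x v * inverse (f x)))) (at x)"
      using Suc.prems assms(3) by (intro Deriv.has_derivative_inverse has_derivative_fderiv) auto
  next
    have "C_k_on k S (\<lambda>x. (- inverse (f x)) * (fderiv f x v * inverse (f x)))" for v
      using Suc C_k_on_SucD[OF Suc.prems]
      by (intro C_k_on_bilinear[OF bounded_bilinear_mult assms(1)]
          C_k_on_bounded_linear[OF bounded_linear_minus[OF bounded_linear_ident] assms(1)]) auto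
    then show "C_k_on k S (\<lambda>x. - (inverse (f x) * fderiv f x v * inverse (f x)))" for v
      by (simp add: mult.assoc)
  qed
qed

lemma C_k_on_sum:
  assumes "open S" "\<And>i. i \<in> I \<Longrightarrow> C_k_on k S (f i)"
  shows "C_k_on k S (\<lambda>x. \<Sum>i\<in>I. f i x)"
  using assms(2)
  by (induction I rule: infinite_finite_induct) (auto intro: C_k_on_const C_k_on_add[OF assms(1)])

lemma linear_expand_Basis:
  fixes f :: "'v::euclidean_space \<Rightarrow> 'w::real_vector"
  assumes "linear f" shows "f v = (\<Sum>i\<in>Basis. (v \<bullet> i) *\<^sub>R f i)"
proof -
  have "f v = f (\<Sum>i\<in>Basis. (v \<bullet> i) *\<^sub>R i)" by (simp add: euclidean_representation)
  then show ?thesis by (simp add: linear_sum[OF assms] linear_cmul[OF assms])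
qed

text \<open>The chain rule evaluates the derivative of \<open>f\<close> on the moving vector
  \<open>fderiv g x v\<close>, while the definition only controls fixed directions. Expanding that
  vector in a basis of the middle space reduces to fixed directions.\<close>

lemma C_k_on_compose:
  fixes g :: "'u::real_normed_vector \<Rightarrow> 'v::euclidean_space"
  assumes "open S" "open S'" "g ` S \<subseteq> S'" "C_k_on k S g" "C_k_on k S' f"
  shows "C_k_on k S (\<lambda>x. f (g x))"
  using assms(4,5)
proof (induction k arbitrary: f)
  case 0
  then show ?case
    using assms(3) by (auto intro: continuous_on_compose2)
next
  case (Suc k)
  have df: "(f has_derivative fderiv f (g x)) (at (g x))" if "x \<in> S" for x
    using Suc.prems assms(3) that by (intro has_derivative_fderiv) auto
  have dg: "(g has_derivative fderiv g x) (at x)" if "x \<in> S" for x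
    using Suc.prems that by (intro has_derivative_fderiv) auto
  show ?case
  proof (rule C_k_on_Suc_has_derivativeI[OF assms(1)])
    fix x assume x: "x \<in> S"
    have "((\<lambda>x. f (g x)) has_derivative (\<lambda>v. fderiv f (g x) (fderiv g x v))) (at x)"
      using diff_chain_at[OF dg[OF x] df[OF x]] by (simp add: o_def)
    also have "(\<lambda>v. fderiv f (g x) (fderiv g x v)) =
        (\<lambda>v. \<Sum>i\<in>Basis. (fderiv g x v \<bullet> i) *\<^sub>R fderiv f (g x) i)"
      using linear_expand_Basis[OF has_derivative_linear[OF df[OF x]]] by blast
    finally show "((\<lambda>x. f (g x)) has_derivative
        (\<lambda>v. \<Sum>i\<in>Basis. (fderiv g x v \<bullet> i) *\<^sub>R fderiv f (g x) i)) (at x)" .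
  next
    show "C_k_on k S (\<lambda>x. \<Sum>i\<in>Basis. (fderiv g x v \<bullet> i) *\<^sub>R fderiv f (g x) i)" for v
      using Suc.prems Suc.IH[OF C_k_on_SucD[OF Suc.prems(1)], of "\<lambda>y. fderiv f y i" for i]
      by (intro C_k_on_sum[OF assms(1)] C_k_on_bilinear[OF bounded_bilinear_scaleR assms(1)]
          C_k_on_bounded_linear[OF bounded_linear_inner_left assms(1)]) auto
  qed
qed

lemma smooth_on_C_k: "smooth_on S f \<Longrightarrow> C_k_on k S f"
  by (simp add: smooth_on_def)

lemma smooth_on_differentiable: "smooth_on S f \<Longrightarrow> x \<in> S \<Longrightarrow> f differentiable (at x)"
  using smooth_on_C_k[of S f "Suc 0"] by simp

lemma smooth_on_has_derivative: "smooth_on S f \<Longrightarrow> x \<in> S \<Longrightarrow> (f has_derivative fderiv f x) (at x)"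
  by (simp add: smooth_on_differentiable has_derivative_fderiv)

lemma smooth_on_linear_fderiv: "smooth_on S f \<Longrightarrow> x \<in> S \<Longrightarrow> linear (fderiv f x)"
  by (simp add: smooth_on_differentiable linear_frechet_derivative)

lemma smooth_on_fderiv: "smooth_on S f \<Longrightarrow> smooth_on S (\<lambda>x. fderiv f x v)"
  unfolding smooth_on_def by (metis C_k_on.simps(2))

lemma smooth_on_fderivI:
  assumes "open S" "\<And>x. x \<in> S \<Longrightarrow> (f has_derivative f' x) (at x)" "\<And>v. smooth_on S (\<lambda>x. f' x v)"
  shows "smooth_on S f"
  unfolding smooth_on_def
proof
  fix k
  have "C_k_on (Suc k) S f"
    using assms by (intro C_k_on_Suc_has_derivativeI) (auto simp: smooth_on_def)
  then show "C_k_on k S f" by (rule C_k_on_SucD)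
qed

lemma smooth_on_continuous_on: "smooth_on S f \<Longrightarrow> continuous_on S f"
  using smooth_on_C_k[of S f 0] by simp

lemma smooth_on_cong: "open S \<Longrightarrow> (\<And>x. x \<in> S \<Longrightarrow> f x = g x) \<Longrightarrow> smooth_on S f \<longleftrightarrow> smooth_on S g"
  unfolding smooth_on_def using C_k_on_cong by metis

lemma smooth_on_subset: "smooth_on S f \<Longrightarrow> S' \<subseteq> S \<Longrightarrow> smooth_on S' f"
  unfolding smooth_on_def using C_k_on_subset by blast

lemma smooth_on_const: "smooth_on S (\<lambda>x. c)"
  by (simp add: smooth_on_def C_k_on_const)

lemma smooth_on_add: "open S \<Longrightarrow> smooth_on S f \<Longrightarrow> smooth_on S g \<Longrightarrow> smooth_on S (\<lambda>x. f x + g x)"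
  by (simp add: smooth_on_def C_k_on_add)

lemma smooth_on_bounded_linear:
  "bounded_linear L \<Longrightarrow> open S \<Longrightarrow> smooth_on S f \<Longrightarrow> smooth_on S (\<lambda>x. L (f x))"
  by (simp add: smooth_on_def C_k_on_bounded_linear)

lemma smooth_on_bilinear:
  "bounded_bilinear bop \<Longrightarrow> open S \<Longrightarrow> smooth_on S f \<Longrightarrow> smooth_on S g \<Longrightarrow> smooth_on S (\<lambda>x. bop (f x) (g x))"
  by (simp add: smooth_on_def C_k_on_bilinear)

lemma smooth_on_minus: "open S \<Longrightarrow> smooth_on S f \<Longrightarrow> smooth_on S (\<lambda>x. - f x)"
  by (intro smooth_on_bounded_linear[OF bounded_linear_minus[OF bounded_linear_ident]])

lemma smooth_on_mult:
  fixes f g :: "_ \<Rightarrow> real"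
  shows "open S \<Longrightarrow> smooth_on S f \<Longrightarrow> smooth_on S g \<Longrightarrow> smooth_on S (\<lambda>x. f x * g x)"
  by (intro smooth_on_bilinear[OF bounded_bilinear_mult])

lemma smooth_on_divide:
  fixes f g :: "_ \<Rightarrow> real"
  shows "open S \<Longrightarrow> smooth_on S f \<Longrightarrow> smooth_on S g \<Longrightarrow> (\<And>x. x \<in> S \<Longrightarrow> g x \<noteq> 0) \<Longrightarrow>
    smooth_on S (\<lambda>x. f x / g x)"
  unfolding divide_inverse
  by (intro smooth_on_mult) (auto simp: smooth_on_def intro: C_k_on_inverse)

lemma smooth_on_sum:
  "open S \<Longrightarrow> (\<And>i. i \<in> I \<Longrightarrow> smooth_on S (f i)) \<Longrightarrow> smooth_on S (\<lambda>x. \<Sum>i\<in>I. f i x)"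
  by (simp add: smooth_on_def C_k_on_sum)

lemma smooth_on_prod:
  fixes f :: "'i \<Rightarrow> _ \<Rightarrow> real"
  assumes "open S" "\<And>i. i \<in> I \<Longrightarrow> smooth_on S (f i)"
  shows "smooth_on S (\<lambda>x. \<Prod>i\<in>I. f i x)"
  using assms(2)
  by (induction I rule: infinite_finite_induct) (auto intro: smooth_on_const smooth_on_mult[OF assms(1)])

lemma smooth_on_compose:
  fixes g :: "'u::real_normed_vector \<Rightarrow> 'v::euclidean_space"
  assumes "open S" "open S'" "g ` S \<subseteq> S'" "smooth_on S g" "smooth_on S' f"
  shows "smooth_on S (\<lambda>x. f (g x))"
  using assms by (simp add: smooth_on_def C_k_on_compose)

lemma smooth_on_component:
  fixes f :: "_ \<Rightarrow> real ^ 'n"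
  assumes "open S" shows "smooth_on S f \<longleftrightarrow> (\<forall>i. smooth_on S (\<lambda>x. f x $ i))"
proof
  assume "smooth_on S f"
  then show "\<forall>i. smooth_on S (\<lambda>x. f x $ i)"
    by (intro allI smooth_on_bounded_linear[OF bounded_linear_vec_nth assms])
next
  assume *: "\<forall>i. smooth_on S (\<lambda>x. f x $ i)"
  have "smooth_on S (\<lambda>x. \<Sum>i\<in>UNIV. f x $ i *\<^sub>R (axis i 1 :: real ^ 'n))"
    using * by (intro smooth_on_sum[OF assms] smooth_on_bilinear[OF bounded_bilinear_scaleR assms]
        smooth_on_const) auto
  moreover have "(\<Sum>i\<in>UNIV. f x $ i *\<^sub>R axis i 1) = f x" for x
    using basis_expansion[of "f x"] by (simp add: scalar_mult_eq_scaleR)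
  ultimately show "smooth_on S f" by (simp only:)
qed

text \<open>A product rule for \<open>f y (a y)\<close> when \<open>f\<close> is known to be
  differentiable only for each fixed argument. In finite dimension, linearity reduces it to finitely
  many products; linearity of \<open>f' h\<close> follows from uniqueness of derivatives.\<close>

lemma has_derivative_linear_arg:
  fixes a :: "'u::real_normed_vector \<Rightarrow> 'v::euclidean_space" and f :: "'u \<Rightarrow> 'v \<Rightarrow> 'w::real_normed_vector"
  assumes "open S" "x \<in> S" and lin: "\<And>y. y \<in> S \<Longrightarrow> linear (f y)"
    and df: "\<And>v. ((\<lambda>y. f y v) has_derivative (\<lambda>h. f' h v)) (at x)"
    and da: "(a has_derivative a') (at x)"
  shows "((\<lambda>y. f y (a y)) has_derivative (\<lambda>h. f' h (a x) + f x (a' h))) (at x)"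
    and "linear (f' h)"
proof -
  have lin': "linear (f' h)" for h
  proof (rule linearI)
    show "f' h (u + v) = f' h u + f' h v" for u v
    proof -
      have "((\<lambda>y. f y u + f y v) has_derivative (\<lambda>h. f' h u + f' h v)) (at x)"
        by (intro has_derivative_add df)
      then have "((\<lambda>y. f y (u + v)) has_derivative (\<lambda>h. f' h u + f' h v)) (at x)"
        by (rule has_derivative_transform_within_open[OF _ assms(1,2)]) (simp add: linear_add[OF lin])
      from has_derivative_unique[OF this df] show ?thesis by metis
    qed
    show "f' h (c *\<^sub>R v) = c *\<^sub>R f' h v" for c v
    proof -
      have "((\<lambda>y. c *\<^sub>R f y v) has_derivative (\<lambda>h. c *\<^sub>R f' h v)) (at x)"
        by (intro has_derivative_scaleR_right df)
      then have "((\<lambda>y. f y (c *\<^sub>R v)) has_derivative (\<lambda>h. c *\<^sub>R f' h v)) (at x)"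
        by (rule has_derivative_transform_within_open[OF _ assms(1,2)]) (simp add: linear_cmul[OF lin])
      from has_derivative_unique[OF this df] show ?thesis by metis
    qed
  qed
  then show "linear (f' h)" .
  have "((\<lambda>y. \<Sum>i\<in>Basis. (a y \<bullet> i) *\<^sub>R f y i) has_derivative
      (\<lambda>h. \<Sum>i\<in>Basis. (a x \<bullet> i) *\<^sub>R f' h i + (a' h \<bullet> i) *\<^sub>R f x i)) (at x)"
    by (intro has_derivative_sum has_derivative_scaleR df has_derivative_inner_left da)
  moreover have "(\<Sum>i\<in>Basis. (a x \<bullet> i) *\<^sub>R f' h i + (a' h \<bullet> i) *\<^sub>R f x i) = f' h (a x) + f x (a' h)" for h
    by (simp add: sum.distrib linear_expand_Basis[OF lin', of _ "a x"]
        linear_expand_Basis[OF lin[OF assms(2)], of "a' h"])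
  ultimately have "((\<lambda>y. \<Sum>i\<in>Basis. (a y \<bullet> i) *\<^sub>R f y i) has_derivative
      (\<lambda>h. f' h (a x) + f x (a' h))) (at x)" by simp
  then show "((\<lambda>y. f y (a y)) has_derivative (\<lambda>h. f' h (a x) + f x (a' h))) (at x)"
    by (rule has_derivative_transform_within_open[OF _ assms(1,2)])
      (metis linear_expand_Basis[OF lin])
qed

lemma smooth_on_linear_arg:
  fixes a :: "'u::real_normed_vector \<Rightarrow> 'v::euclidean_space" and f :: "'u \<Rightarrow> 'v \<Rightarrow> 'w::real_normed_vector"
  assumes "open S" and lin: "\<And>y. y \<in> S \<Longrightarrow> linear (f y)"
    and "\<And>v. smooth_on S (\<lambda>y. f y v)" and "smooth_on S a"
  shows "smooth_on S (\<lambda>y. f y (a y))"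
proof -
  have "smooth_on S (\<lambda>y. \<Sum>i\<in>Basis. (a y \<bullet> i) *\<^sub>R f y i)"
    using assms by (intro smooth_on_sum smooth_on_bilinear[OF bounded_bilinear_scaleR]
        smooth_on_bounded_linear[OF bounded_linear_inner_left]) auto
  then show ?thesis
    by (subst smooth_on_cong[OF assms(1)]) (auto intro: linear_expand_Basis[OF lin])
qed

lemma smooth_on_det:
  fixes M :: "_ \<Rightarrow> real ^ 'n ^ 'n"
  assumes "open S" "\<And>i j. smooth_on S (\<lambda>x. M x $ i $ j)"
  shows "smooth_on S (\<lambda>x. det (M x))"
  unfolding det_def
  using assms by (intro smooth_on_sum smooth_on_mult smooth_on_prod smooth_on_const) auto

text \<open>The solution of an overdetermined linear system is obtained from the normal equations by
  Cramer's rule, hence depends smoothly on the coefficients.\<close>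

lemma smooth_on_linear_solution:
  fixes z :: "'u::real_normed_vector \<Rightarrow> real ^ 'n" and r :: "'i \<Rightarrow> 'u \<Rightarrow> real ^ 'n \<Rightarrow> real"
  assumes S: "open S" and "finite I"
    and lin: "\<And>i x. i \<in> I \<Longrightarrow> x \<in> S \<Longrightarrow> linear (r i x)"
    and smooth: "\<And>i v. i \<in> I \<Longrightarrow> smooth_on S (\<lambda>x. r i x v)"
    and inj: "\<And>x v. x \<in> S \<Longrightarrow> (\<And>i. i \<in> I \<Longrightarrow> r i x v = 0) \<Longrightarrow> v = 0"
    and rz: "\<And>i. i \<in> I \<Longrightarrow> smooth_on S (\<lambda>x. r i x (z x))"
  shows "smooth_on S z"
proof -
  define M where "M = (\<lambda>x. \<chi> j k. \<Sum>i\<in>I. r i x (axis j 1) * r i x (axis k 1))"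
  define b where "b = (\<lambda>x. \<chi> j. \<Sum>i\<in>I. r i x (axis j 1) * r i x (z x))"
  have expand: "r i x v = (\<Sum>k\<in>UNIV. v $ k * r i x (axis k 1))" if "i \<in> I" "x \<in> S" for i x v
  proof -
    have "r i x v = r i x (\<Sum>k\<in>UNIV. v $ k *\<^sub>R axis k 1)"
      using basis_expansion[of v] by (simp add: scalar_mult_eq_scaleR)
    then show ?thesis by (simp add: linear_sum[OF lin[OF that]] linear_cmul[OF lin[OF that]])
  qed
  have Mv: "(M x *v v) $ j = (\<Sum>i\<in>I. r i x (axis j 1) * r i x v)" if "x \<in> S" for x v j
  proof -
    have "(M x *v v) $ j = (\<Sum>k\<in>UNIV. \<Sum>i\<in>I. r i x (axis j 1) * (v $ k * r i x (axis k 1)))"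
      by (simp add: matrix_vector_mult_def M_def sum_distrib_right sum_distrib_left mult_ac)
    also have "\<dots> = (\<Sum>i\<in>I. r i x (axis j 1) * (\<Sum>k\<in>UNIV. v $ k * r i x (axis k 1)))"
      by (subst sum.swap) (simp add: sum_distrib_left)
    finally show ?thesis using expand that by simp
  qed
  have d0: "det (M x) \<noteq> 0" if x: "x \<in> S" for x
  proof -
    have "v = 0" if "M x *v v = 0" for v
    proof (rule inj[OF x])
      \<comment> \<open>\<open>M x\<close> is the Gram matrix of the equations: its quadratic form
        is the sum of the squares of the \<open>r i x v\<close>, so its kernel is their common
        kernel.\<close>
      have "0 = (\<Sum>j\<in>UNIV. v $ j * (M x *v v) $ j)" using that by simp
      also have "\<dots> = (\<Sum>i\<in>I. (\<Sum>j\<in>UNIV. v $ j * r i x (axis j 1)) * r i x v)"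
        using x by (simp add: Mv sum_distrib_left sum_distrib_right mult_ac)
          (subst sum.swap, simp add: mult_ac)
      also have "\<dots> = (\<Sum>i\<in>I. r i x v * r i x v)" using expand x by simp
      finally have "\<forall>i\<in>I. r i x v * r i x v = 0"
        using sum_nonneg_eq_0_iff[OF \<open>finite I\<close>, of "\<lambda>i. r i x v * r i x v"] by simp
      then show "r i x v = 0" if "i \<in> I" for i using that by simp
    qed
    then show ?thesis
      using invertible_det_nz[of "M x"] matrix_left_invertible_ker[of "M x"]
      by (metis invertible_left_inverse)
  qed
  have "M x *v z x = b x" if "x \<in> S" for x
    using Mv[OF that, of "z x"] by (simp add: vec_eq_iff b_def)
  then have z: "z x $ k = det (\<chi> i j. if j = k then b x $ i else M x $ i $ j) / det (M x)"
    if "x \<in> S" for x k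
    using cramer[OF d0[OF that], of "z x" "b x"] that by (simp add: vec_eq_iff)
  have smM: "smooth_on S (\<lambda>x. M x $ i $ j)" for i j
    unfolding M_def using S smooth by (auto intro!: smooth_on_sum smooth_on_mult)
  have smb: "smooth_on S (\<lambda>x. b x $ i)" for i
    unfolding b_def using S smooth rz by (auto intro!: smooth_on_sum smooth_on_mult)
  have "smooth_on S (\<lambda>x. z x $ k)" for k
  proof (rule iffD2[OF smooth_on_cong[OF S z]], assumption,
      intro smooth_on_divide smooth_on_det S smM d0)
    show "smooth_on S (\<lambda>x. (\<chi> i j. if j = k then b x $ i else M x $ i $ j) $ i $ j)" for i j
      using smM smb by (cases "j = k") auto
  qed
  then show ?thesis by (simp add: smooth_on_component[OF S])
qed

section \<open>Symmetry of second derivatives and closed 1-forms\<close>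

lemma mvt_segment:
  fixes f :: "'v::real_normed_vector \<Rightarrow> real"
  assumes "0 < t" "\<And>s. 0 \<le> s \<Longrightarrow> s \<le> t \<Longrightarrow> f differentiable (at (a + s *\<^sub>R u))"
  obtains s where "0 < s" "s < t" "f (a + t *\<^sub>R u) - f a = t * fderiv f (a + s *\<^sub>R u) u"
proof -
  have "\<exists>s\<in>{0<..<t}. f (a + t *\<^sub>R u) - f (a + 0 *\<^sub>R u) = (\<lambda>h. fderiv f (a + s *\<^sub>R u) (h *\<^sub>R u)) (t - 0)"
  proof (rule mvt_simple[OF assms(1)])
    fix s assume "0 \<le> s" "s \<le> t"
    then have "(f has_derivative fderiv f (a + s *\<^sub>R u)) (at (a + s *\<^sub>R u))"
      by (intro has_derivative_fderiv assms)
    moreover have "((\<lambda>s. a + s *\<^sub>R u) has_derivative (\<lambda>h. h *\<^sub>R u)) (at s within {0..t})"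
      by (auto intro!: derivative_eq_intros)
    ultimately have "((f \<circ> (\<lambda>s. a + s *\<^sub>R u)) has_derivative
        (fderiv f (a + s *\<^sub>R u) \<circ> (\<lambda>h. h *\<^sub>R u))) (at s within {0..t})"
      by (intro diff_chain_within) (auto intro: has_derivative_at_withinI)
    then show "((\<lambda>s. f (a + s *\<^sub>R u)) has_derivative
        (\<lambda>h. fderiv f (a + s *\<^sub>R u) (h *\<^sub>R u))) (at s within {0..t})"
      by (simp add: o_def)
  qed
  then obtain s where s: "0 < s" "s < t"
    "f (a + t *\<^sub>R u) - f a = fderiv f (a + s *\<^sub>R u) (t *\<^sub>R u)" by auto
  moreover have "linear (fderiv f (a + s *\<^sub>R u))"
    using s by (intro linear_frechet_derivative assms) auto
  ultimately show ?thesis using that by (simp add: linear_cmul)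
qed

text \<open>The mean value theorem is applied along \<open>u\<close> to the first difference
  \<open>G\<close> in direction \<open>v\<close>, and afterwards along \<open>v\<close> to the
  derivative in direction \<open>u\<close>.\<close>

lemma second_difference_mvt:
  fixes f :: "'v::real_normed_vector \<Rightarrow> real"
  assumes "smooth_on S f" "0 < t"
    and S: "\<And>r s. 0 \<le> r \<Longrightarrow> r \<le> t \<Longrightarrow> 0 \<le> s \<Longrightarrow> s \<le> t \<Longrightarrow> x + r *\<^sub>R u + s *\<^sub>R v \<in> S"
  obtains r s where "0 < r" "r < t" "0 < s" "s < t"
    "f (x + t *\<^sub>R u + t *\<^sub>R v) - f (x + t *\<^sub>R u) - (f (x + t *\<^sub>R v) - f x)
      = t * (t * fderiv (\<lambda>y. fderiv f y u) (x + r *\<^sub>R u + s *\<^sub>R v) v)"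
proof -
  define G where "G = (\<lambda>y. f (y + t *\<^sub>R v) - f y)"
  have G: "(G has_derivative (\<lambda>h. fderiv f (x + r *\<^sub>R u + t *\<^sub>R v) h - fderiv f (x + r *\<^sub>R u) h)) (at (x + r *\<^sub>R u))"
    if "0 \<le> r" "r \<le> t" for r
  proof -
    have "(f has_derivative fderiv f (x + r *\<^sub>R u + t *\<^sub>R v)) (at (x + r *\<^sub>R u + t *\<^sub>R v))"
      using that assms by (intro smooth_on_has_derivative) auto
    then have 1: "((f \<circ> (\<lambda>y. y + t *\<^sub>R v)) has_derivative
        (fderiv f (x + r *\<^sub>R u + t *\<^sub>R v) \<circ> (\<lambda>h. h))) (at (x + r *\<^sub>R u))"
      by (intro diff_chain_at) (auto intro!: derivative_eq_intros)
    have 2: "(f has_derivative fderiv f (x + r *\<^sub>R u)) (at (x + r *\<^sub>R u))"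
      using that assms(1,2) S[of r 0] by (intro smooth_on_has_derivative) auto
    show ?thesis
      unfolding G_def using has_derivative_diff[OF 1 2] by (simp add: o_def)
  qed
  have "G differentiable (at (x + r *\<^sub>R u))" if "0 \<le> r" "r \<le> t" for r
    using G[OF that] by (auto simp: differentiable_def)
  from mvt_segment[OF assms(2) this] obtain r where r: "0 < r" "r < t"
    "G (x + t *\<^sub>R u) - G x = t * fderiv G (x + r *\<^sub>R u) u" by blast
  have "(\<lambda>y. fderiv f y u) differentiable (at ((x + r *\<^sub>R u) + s *\<^sub>R v))" if "0 \<le> s" "s \<le> t" for s
    using that r S[of r s] by (intro smooth_on_differentiable[OF smooth_on_fderiv[OF assms(1)]]) auto
  from mvt_segment[OF assms(2) this] obtain s where s: "0 < s" "s < t"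
    "fderiv f (x + r *\<^sub>R u + t *\<^sub>R v) u - fderiv f (x + r *\<^sub>R u) u
      = t * fderiv (\<lambda>y. fderiv f y u) (x + r *\<^sub>R u + s *\<^sub>R v) v" by blast
  show ?thesis
  proof (rule that[OF r(1,2) s(1,2)])
    show "f (x + t *\<^sub>R u + t *\<^sub>R v) - f (x + t *\<^sub>R u) - (f (x + t *\<^sub>R v) - f x)
      = t * (t * fderiv (\<lambda>y. fderiv f y u) (x + r *\<^sub>R u + s *\<^sub>R v) v)"
      using r(3) s(3) fderiv_eqI[OF G[of r]] r(1,2) by (simp add: G_def)
  qed
qed

text \<open>The second difference over a small parallelogram is symmetric in \<open>u\<close> and
  \<open>v\<close>, and it equals t^2 times either mixed derivative at some point nearby. By
  continuity the two cannot differ at \<open>x\<close>.\<close>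

lemma fderiv_commute_real:
  fixes f :: "'v::real_normed_vector \<Rightarrow> real"
  assumes "open S" "x \<in> S" "smooth_on S f"
  shows "fderiv (\<lambda>y. fderiv f y u) x v = fderiv (\<lambda>y. fderiv f y v) x u"
proof (rule ccontr)
  define A where "A = (\<lambda>y. fderiv (\<lambda>y. fderiv f y u) y v)"
  define B where "B = (\<lambda>y. fderiv (\<lambda>y. fderiv f y v) y u)"
  define e where "e = \<bar>A x - B x\<bar> / 2"
  assume "\<not> ?thesis"
  then have e: "e > 0" by (simp add: e_def A_def B_def)
  have cont: "continuous_on S A" "continuous_on S B"
    unfolding A_def B_def by (intro smooth_on_continuous_on smooth_on_fderiv assms(3))+
  then have "isCont A x" "isCont B x"
    using assms by (simp_all add: continuous_on_eq_continuous_at)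
  then obtain d1 d2 where d: "d1 > 0" "\<And>y. dist y x < d1 \<Longrightarrow> dist (A y) (A x) < e"
    "d2 > 0" "\<And>y. dist y x < d2 \<Longrightarrow> dist (B y) (B x) < e"
    unfolding continuous_at_eps_delta using e by metis
  obtain d3 where d3: "d3 > 0" "ball x d3 \<subseteq> S"
    using assms(1,2) open_contains_ball by blast
  define d where "d = min d1 (min d2 d3)"
  \<comment> \<open>Keeps the whole parallelogram within \<open>d / 2\<close> of \<open>x\<close>;
    the summand 1 keeps the divisor positive when both vectors are zero.\<close>
  define t where "t = d / (2 * (norm u + norm v + 1))"
  have dpos: "d > 0" using d(1,3) d3 by (simp add: d_def)
  have np: "norm u + norm v + 1 > 0" by (smt (verit) norm_ge_zero)
  then have t: "t > 0" using dpos by (simp add: t_def)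
  have near: "dist (x + r *\<^sub>R u + s *\<^sub>R v) x < d" if "0 \<le> r" "r \<le> t" "0 \<le> s" "s \<le> t" for r s
  proof -
    have "dist (x + r *\<^sub>R u + s *\<^sub>R v) x = norm (r *\<^sub>R u + s *\<^sub>R v)" by (simp add: dist_norm)
    also have "\<dots> \<le> norm (r *\<^sub>R u) + norm (s *\<^sub>R v)" by (rule norm_triangle_ineq)
    also have "\<dots> \<le> t * norm u + t * norm v"
      using that by (intro add_mono) (auto intro: mult_right_mono)
    also have "\<dots> \<le> t * (norm u + norm v + 1)" using t by (simp add: algebra_simps)
    also have "\<dots> = d / 2"
      unfolding t_def using np by (metis (no_types) divide_divide_eq_left less_irrefl nonzero_eq_divide_eq mult.commute)
    finally show ?thesis using dpos by simp
  qed
  have inS: "x + r *\<^sub>R u + s *\<^sub>R v \<in> S" if "0 \<le> r" "r \<le> t" "0 \<le> s" "s \<le> t" for r s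
    using near[OF that] d3 by (auto simp: d_def dist_commute subset_iff)
  obtain r s where rs: "0 < r" "r < t" "0 < s" "s < t"
    "f (x + t *\<^sub>R u + t *\<^sub>R v) - f (x + t *\<^sub>R u) - (f (x + t *\<^sub>R v) - f x)
      = t * (t * A (x + r *\<^sub>R u + s *\<^sub>R v))"
    unfolding A_def by (rule second_difference_mvt[OF assms(3) t inS])
  have inS': "x + r *\<^sub>R v + s *\<^sub>R u \<in> S" if "0 \<le> r" "r \<le> t" "0 \<le> s" "s \<le> t" for r s
    using inS[of s r] that by (simp add: ac_simps)
  obtain r' s' where rs': "0 < r'" "r' < t" "0 < s'" "s' < t"
    "f (x + t *\<^sub>R v + t *\<^sub>R u) - f (x + t *\<^sub>R v) - (f (x + t *\<^sub>R u) - f x)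
      = t * (t * B (x + r' *\<^sub>R v + s' *\<^sub>R u))"
    unfolding B_def by (rule second_difference_mvt[OF assms(3) t inS'])
  have "t * (t * A (x + r *\<^sub>R u + s *\<^sub>R v)) = t * (t * B (x + r' *\<^sub>R v + s' *\<^sub>R u))"
  proof -
    have "f (x + t *\<^sub>R u + t *\<^sub>R v) = f (x + t *\<^sub>R v + t *\<^sub>R u)" by (simp add: ac_simps)
    then show ?thesis unfolding rs(5)[symmetric] rs'(5)[symmetric] by linarith
  qed
  then have "A (x + r *\<^sub>R u + s *\<^sub>R v) = B (x + s' *\<^sub>R u + r' *\<^sub>R v)"
    using t by (simp add: ac_simps)
  moreover have "dist (A (x + r *\<^sub>R u + s *\<^sub>R v)) (A x) < e"
    using near[of r s] rs by (intro d) (auto simp: d_def)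
  moreover have "dist (B (x + s' *\<^sub>R u + r' *\<^sub>R v)) (B x) < e"
    using near[of s' r'] rs' by (intro d) (auto simp: d_def)
  ultimately show False
    unfolding e_def dist_real_def by (smt (verit) field_sum_of_halves)
qed

lemma fderiv_inner_left:
  "f differentiable (at x) \<Longrightarrow> fderiv (\<lambda>y. f y \<bullet> b) x v = fderiv f x v \<bullet> b"
  by (metis fderiv_eqI has_derivative_fderiv has_derivative_inner_left)

lemma fderiv_commute:
  fixes f :: "'v::real_normed_vector \<Rightarrow> 'w::euclidean_space"
  assumes "open S" "x \<in> S" "smooth_on S f"
  shows "fderiv (\<lambda>y. fderiv f y u) x v = fderiv (\<lambda>y. fderiv f y v) x u"
proof (rule euclidean_eqI)
  fix b :: 'w
  have "fderiv (\<lambda>y. fderiv f y u) x v \<bullet> b = fderiv (\<lambda>y. fderiv (\<lambda>y. f y \<bullet> b) y u) x v" for u v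
  proof -
    have "fderiv (\<lambda>y. fderiv f y u) x v \<bullet> b = fderiv (\<lambda>y. fderiv f y u \<bullet> b) x v"
      by (rule fderiv_inner_left[symmetric], rule smooth_on_differentiable[OF smooth_on_fderiv])
        (use assms in auto)
    also have "\<dots> = fderiv (\<lambda>y. fderiv (\<lambda>y. f y \<bullet> b) y u) x v"
      using fderiv_cong_open[OF assms(1,2), of "\<lambda>y. fderiv f y u \<bullet> b" "\<lambda>y. fderiv (\<lambda>y. f y \<bullet> b) y u"]
        fderiv_inner_left[OF smooth_on_differentiable[OF assms(3)]] by simp
    finally show ?thesis .
  qed
  then show "fderiv (\<lambda>y. fderiv f y u) x v \<bullet> b = fderiv (\<lambda>y. fderiv f y v) x u \<bullet> b"
    using fderiv_commute_real[OF assms(1,2) smooth_on_bounded_linear[OF bounded_linear_inner_left assms(1,3)]]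
    by simp
qed

text \<open>The primitive is the integral of the form along the segment \<open>P x\<close> from
  \<open>x0\<close> to \<open>x\<close>. \<open>L x t\<close> is the derivative of the integrand in
  \<open>x\<close>; it is wrapped as a \<open>Blinfun\<close> because differentiation under the
  integral needs continuity in operator norm.\<close>

lemma closed_one_form_primitive:
  fixes a :: "'v::euclidean_space \<Rightarrow> 'v \<Rightarrow> real"
  assumes S: "open S" "convex S" "x0 \<in> S"
    and lin: "\<And>y. y \<in> S \<Longrightarrow> linear (a y)"
    and smooth: "\<And>v. smooth_on S (\<lambda>y. a y v)"
    and closed: "\<And>y u v. y \<in> S \<Longrightarrow> fderiv (\<lambda>y. a y u) y v = fderiv (\<lambda>y. a y v) y u"
  obtains f where "\<And>y. y \<in> S \<Longrightarrow> (f has_derivative a y) (at y)"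
proof
  define P where "P = (\<lambda>x t. x0 + t *\<^sub>R (x - x0))"
  define L where "L = (\<lambda>x t h. t * fderiv (\<lambda>y. a y (x - x0)) (P x t) h + a (P x t) h)"
  define f where "f = (\<lambda>x. integral (cbox 0 1) (\<lambda>t. a (P x t) (x - x0)))"
  have PS: "P x t \<in> S" if "x \<in> S" "t \<in> cbox 0 1" for x t
  proof -
    have "P x t = (1 - t) *\<^sub>R x0 + t *\<^sub>R x" by (simp add: P_def algebra_simps)
    then show ?thesis using convexD[OF S(2,3) that(1), of "1 - t" t] that(2) by simp
  qed
  have da: "((\<lambda>y. a y v) has_derivative (\<lambda>h. fderiv (\<lambda>y. a y v) y h)) (at y)" if "y \<in> S" for y v
    by (intro smooth_on_has_derivative[OF smooth that])
  have lin_fd: "linear (\<lambda>v. fderiv (\<lambda>y. a y v) y h)" if "y \<in> S" for y h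
    by (rule has_derivative_linear_arg(2)[OF S(1) that lin da[OF that], of "\<lambda>y. y" "\<lambda>h. h" h]) auto
  have linL: "linear (L x t)" if "x \<in> S" "t \<in> cbox 0 1" for x t
    unfolding L_def
    using linear_compose_add[OF linear_compose_scale_right[OF has_derivative_linear[OF da[OF PS[OF that]]], of t]
        lin[OF PS[OF that]], of "x - x0"]
    by simp
  have contP: "continuous_on (S \<times> cbox 0 1) (\<lambda>z. P (fst z) (snd z))"
    unfolding P_def by (intro continuous_intros)
  have P_img: "(\<lambda>z. P (fst z) (snd z)) ` (S \<times> cbox 0 1) \<subseteq> S" using PS by auto
  have cont: "continuous_on (S \<times> cbox 0 1) (\<lambda>z. L (fst z) (snd z) h)" for h
  proof -
    have "continuous_on (S \<times> cbox 0 1) (\<lambda>z. snd z *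
        (\<Sum>i\<in>Basis. ((fst z - x0) \<bullet> i) * fderiv (\<lambda>y. a y i) (P (fst z) (snd z)) h) + a (P (fst z) (snd z)) h)"
      by (intro continuous_intros continuous_on_compose2[OF smooth_on_continuous_on[OF smooth] contP P_img]
          continuous_on_compose2[OF smooth_on_continuous_on[OF smooth_on_fderiv[OF smooth]] contP P_img])
    then show ?thesis
      by (rule continuous_on_eq)
        (auto simp: L_def linear_expand_Basis[OF lin_fd[OF PS], of _ _ "_ - x0"])
  qed
  fix y assume y: "y \<in> S"
  have "(f has_derivative blinfun_apply (integral (cbox 0 1) (\<lambda>t. Blinfun (L y t)))) (at y within S)"
    unfolding f_def
  proof (rule leibniz_rule[where fx = "\<lambda>x t. Blinfun (L x t)"])
    fix x t assume xt: "x \<in> S" "t \<in> cbox (0::real) 1"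
    have "((\<lambda>x. P x t) has_derivative (\<lambda>h. t *\<^sub>R h)) (at x)"
      unfolding P_def by (auto intro!: derivative_eq_intros)
    moreover define V where "V = (\<lambda>x. P x t) -` S"
    moreover have "open V"
      unfolding V_def P_def by (intro open_vimage S continuous_intros)
    moreover have "x \<in> V" using PS[OF xt] by (simp add: V_def)
    moreover have "((\<lambda>x. a (P x t) v) has_derivative (\<lambda>h. fderiv (\<lambda>y. a y v) (P x t) (t *\<^sub>R h))) (at x)" for v
      using diff_chain_at[OF calculation(1) da[OF PS[OF xt]], of v] by (simp add: o_def)
    moreover have "((\<lambda>x. x - x0) has_derivative (\<lambda>h. h)) (at x)"
      by (auto intro!: derivative_eq_intros)
    ultimately have "((\<lambda>x. a (P x t) (x - x0)) has_derivative
        (\<lambda>h. fderiv (\<lambda>y. a y (x - x0)) (P x t) (t *\<^sub>R h) + a (P x t) h)) (at x)"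
      by (intro has_derivative_linear_arg(1)[where S = V and f = "\<lambda>x. a (P x t)"
            and f' = "\<lambda>h v. fderiv (\<lambda>y. a y v) (P x t) (t *\<^sub>R h)"]) (auto intro: lin)
    moreover have "(\<lambda>h. fderiv (\<lambda>y. a y (x - x0)) (P x t) (t *\<^sub>R h) + a (P x t) h) = L x t"
      using has_derivative_linear[OF da[OF PS[OF xt]], of "x - x0"]
      by (auto simp: L_def linear_cmul)
    ultimately show "((\<lambda>x. a (P x t) (x - x0)) has_derivative blinfun_apply (Blinfun (L x t))) (at x within S)"
      using linL[OF xt]
      by (simp add: bounded_linear_Blinfun_apply linear_conv_bounded_linear has_derivative_at_withinI)
  next
    fix x assume x: "x \<in> S"
    have "continuous_on (cbox 0 1) (\<lambda>t. \<Sum>i\<in>Basis. ((x - x0) \<bullet> i) * a (P x t) i)"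
      by (intro continuous_intros continuous_on_compose2[OF smooth_on_continuous_on[OF smooth], of _ "P x"])
        (use PS[OF x] in \<open>auto simp: P_def intro!: continuous_intros\<close>)
    then have "continuous_on (cbox 0 1) (\<lambda>t. a (P x t) (x - x0))"
      by (rule continuous_on_eq) (simp add: linear_expand_Basis[OF lin[OF PS[OF x]], of _ "x - x0"])
    then show "(\<lambda>t. a (P x t) (x - x0)) integrable_on cbox 0 1"
      by (rule integrable_continuous)
  next
    show "continuous_on (S \<times> cbox 0 1) (\<lambda>(x, t). Blinfun (L x t))"
    proof (rule continuous_on_blinfun_componentwise)
      fix i :: 'v
      show "continuous_on (S \<times> cbox 0 1) (\<lambda>z. blinfun_apply (case z of (x, t) \<Rightarrow> Blinfun (L x t)) i)"
        by (rule continuous_on_eq[OF cont[of i]])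
          (auto simp: bounded_linear_Blinfun_apply linL linear_conv_bounded_linear[symmetric])
    qed
  qed (use S y in auto)
  moreover have "blinfun_apply (integral (cbox 0 1) (\<lambda>t. Blinfun (L y t))) h = a y h" for h
  proof -
    have "continuous_on (cbox 0 1) (\<lambda>t. Blinfun (L y t))"
    proof (rule continuous_on_blinfun_componentwise)
      fix i :: 'v
      have "continuous_on (cbox 0 1) (\<lambda>t. L y t i)"
        using continuous_on_compose2[OF cont[of i], of "cbox 0 1" "\<lambda>t. (y, t)"] y
        by (simp add: continuous_on_Pair image_subset_iff)
      then show "continuous_on (cbox 0 1) (\<lambda>t. blinfun_apply (Blinfun (L y t)) i)"
        by (rule continuous_on_eq)
          (use linL[OF y] in \<open>simp add: bounded_linear_Blinfun_apply linear_conv_bounded_linear\<close>)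
    qed
    then have "blinfun_apply (integral (cbox 0 1) (\<lambda>t. Blinfun (L y t))) h
        = integral (cbox 0 1) (\<lambda>t. blinfun_apply (Blinfun (L y t)) h)"
      by (intro blinfun_apply_integral integrable_continuous)
    also have "\<dots> = integral (cbox 0 1) (\<lambda>t. L y t h)"
      by (rule integral_cong)
        (use linL[OF y] in \<open>simp add: bounded_linear_Blinfun_apply linear_conv_bounded_linear\<close>)
    \<comment> \<open>Closedness exchanges the directions \<open>h\<close> and
      \<open>y - x0\<close>, which turns the integrand into the \<open>t\<close>-derivative of
      \<open>t * a (P y t) h\<close>.\<close>
    also have "\<dots> = integral {0..1} (\<lambda>t. t * fderiv (\<lambda>y. a y h) (P y t) (y - x0) + a (P y t) h)"
      unfolding L_def using closed[OF PS[OF y], of _ "y - x0" h] by (auto intro: integral_cong)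
    also have "\<dots> = 1 * a (P y 1) h - 0 * a (P y 0) h"
    proof (rule integral_unique, rule fundamental_theorem_of_calculus)
      fix t :: real assume t: "t \<in> {0..1}"
      have "((\<lambda>t. P y t) has_derivative (\<lambda>r. r *\<^sub>R (y - x0))) (at t)"
        unfolding P_def by (auto intro!: derivative_eq_intros)
      from diff_chain_at[OF this da[OF PS[OF y]], of h] t
      have "((\<lambda>t. a (P y t) h) has_derivative (\<lambda>r. fderiv (\<lambda>y. a y h) (P y t) (r *\<^sub>R (y - x0)))) (at t)"
        by (simp add: o_def)
      then have "((\<lambda>t. t * a (P y t) h) has_derivative
          (\<lambda>r. t * fderiv (\<lambda>y. a y h) (P y t) (r *\<^sub>R (y - x0)) + r * a (P y t) h)) (at t)"
        by (auto intro!: derivative_eq_intros)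
      moreover have "(\<lambda>r. t * fderiv (\<lambda>y. a y h) (P y t) (r *\<^sub>R (y - x0)) + r * a (P y t) h)
          = (\<lambda>r. r *\<^sub>R (t * fderiv (\<lambda>y. a y h) (P y t) (y - x0) + a (P y t) h))"
        using has_derivative_linear[OF da[OF PS[OF y]], of t h] t by (simp add: fun_eq_iff linear_cmul distrib_left mult.left_commute)
      ultimately show "((\<lambda>t. t * a (P y t) h) has_vector_derivative
          (t * fderiv (\<lambda>y. a y h) (P y t) (y - x0) + a (P y t) h)) (at t within {0..1})"
        by (simp add: has_vector_derivative_def has_derivative_at_withinI)
    qed auto
    also have "\<dots> = a y h" by (simp add: P_def)
    finally show ?thesis .
  qed
  then have "blinfun_apply (integral (cbox 0 1) (\<lambda>t. Blinfun (L y t))) = a y" by (rule ext)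
  ultimately show "(f has_derivative a y) (at y)"
    using at_within_open[OF y S(1)] by simp
qed

section \<open>Alternating forms and the wedge product\<close>

lemma wedge_0: "wedge 0 \<alpha> \<beta> vs = \<alpha> [] * \<beta> vs"
proof -
  have "{S. S \<subseteq> {..<length vs} \<and> card S = 0} = {{}}"
    by (auto dest: finite_subset)
  moreover have "nths vs UNIV = vs" by (simp add: nths_all)
  ultimately show ?thesis unfolding wedge_def by simp
qed

lemma subsets_Suc_card:
  "{S. S \<subseteq> {..<Suc n} \<and> card S = Suc k} =
    (\<lambda>S. insert 0 (Suc ` S)) ` {S. S \<subseteq> {..<n} \<and> card S = k} \<union>
    (\<lambda>S. Suc ` S) ` {S. S \<subseteq> {..<n} \<and> card S = Suc k}" (is "?L = ?R")
proof
  show "?L \<subseteq> ?R"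
  proof
    fix S assume S: "S \<in> ?L"
    define S' where "S' = {i. Suc i \<in> S}"
    have fin: "finite S" using S finite_subset by auto
    have S': "S - {0} = Suc ` S'"
    proof (rule set_eqI)
      show "x \<in> S - {0} \<longleftrightarrow> x \<in> Suc ` S'" for x by (cases x) (auto simp: S'_def)
    qed
    have sub: "S' \<subseteq> {..<n}" using S by (auto simp: S'_def)
    have card: "card (Suc ` S') = card S'" by (simp add: card_image)
    show "S \<in> ?R"
    proof (cases "0 \<in> S")
      case True
      then have "card S' = k" using S S' card card_Diff_singleton[OF True] by simp
      moreover have "S = insert 0 (Suc ` S')" using True S' by blast
      ultimately show ?thesis using sub by blast
    next
      case False
      then have "S = Suc ` S'" using S' by simp
      then show ?thesis using S card sub by auto
    qed
  qed
  show "?R \<subseteq> ?L"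
  proof
    fix S assume "S \<in> ?R"
    then consider T where "S = insert 0 (Suc ` T)" "T \<subseteq> {..<n}" "card T = k"
      | T where "S = Suc ` T" "T \<subseteq> {..<n}" "card T = Suc k" by blast
    then show "S \<in> ?L"
    proof cases
      case 1
      have "finite T" using 1(2) finite_subset by blast
      then have "card S = Suc k" using 1 by (simp add: card_image card_insert_if)
      then show ?thesis using 1 by auto
    next
      case 2
      then have "card S = Suc k" by (simp add: card_image)
      then show ?thesis using 2 by auto
    qed
  qed
qed

text \<open>The shuffles are split by whether position 0 goes to the first factor. If it does not,
  it forms an inversion with each of the \<open>Suc k\<close> positions in \<open>S\<close>, whence
  the sign.\<close>

lemma wedge_Cons:
  "wedge (Suc k) \<alpha> \<beta> (v # vs) = wedge k (interior_product v \<alpha>) \<beta> vs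
    + (-1) ^ Suc k * wedge (Suc k) \<alpha> (interior_product v \<beta>) vs"
proof -
  define n where "n = length vs"
  define ivs where "ivs = (\<lambda>n S. {(i, j). i \<in> S \<and> j \<in> {..<n} - S \<and> j < i} :: (nat \<times> nat) set)"
  define trm where "trm = (\<lambda>S. (-1::real) ^ card (ivs (Suc n) S) * \<alpha> (nths (v # vs) S) * \<beta> (nths (v # vs) (- S)))"
  have inj2: "inj_on (map_prod Suc Suc) X" for X by (auto simp: inj_on_def)
  have fin: "finite {S. S \<subseteq> {..<n} \<and> card S = k}" for n k :: nat by simp
  have fin_inv: "finite (ivs n S)" if "S \<subseteq> {..<n}" for n S
    by (rule finite_subset[of _ "{..<n} \<times> {..<n}"]) (use that in \<open>auto simp: ivs_def\<close>)
  have "wedge (Suc k) \<alpha> \<beta> (v # vs) = sum trm {S. S \<subseteq> {..<Suc n} \<and> card S = Suc k}"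
    by (simp add: wedge_def trm_def ivs_def n_def)
  also have "\<dots> = sum trm ((\<lambda>S. insert 0 (Suc ` S)) ` {S. S \<subseteq> {..<n} \<and> card S = k})
     + sum trm ((\<lambda>S. Suc ` S) ` {S. S \<subseteq> {..<n} \<and> card S = Suc k})"
    unfolding subsets_Suc_card by (rule sum.union_disjoint) (use fin in auto)
  also have "sum trm ((\<lambda>S. insert 0 (Suc ` S)) ` {S. S \<subseteq> {..<n} \<and> card S = k})
    = wedge k (interior_product v \<alpha>) \<beta> vs"
  proof (subst sum.reindex)
    show "inj_on (\<lambda>S. insert 0 (Suc ` S)) {S. S \<subseteq> {..<n} \<and> card S = k}"
    proof (rule inj_onI)
      fix S T assume "insert 0 (Suc ` S) = insert 0 (Suc ` T)"
      then have "Suc ` S = Suc ` T" by (metis insert_ident image_iff nat.distinct(1))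
      then show "S = T" by (simp add: inj_image_eq_iff)
    qed
    have "trm (insert 0 (Suc ` S)) = (-1) ^ card (ivs n S) * interior_product v \<alpha> (nths vs S) * \<beta> (nths vs (- S))"
      for S
    proof -
      have "ivs (Suc n) (insert 0 (Suc ` S)) = map_prod Suc Suc ` ivs n S"
      proof (rule set_eqI)
        show "p \<in> ivs (Suc n) (insert 0 (Suc ` S)) \<longleftrightarrow> p \<in> map_prod Suc Suc ` ivs n S" for p
          by (cases p; cases "fst p"; cases "snd p") (auto simp: ivs_def map_prod_def image_def)
      qed
      then have "card (ivs (Suc n) (insert 0 (Suc ` S))) = card (ivs n S)"
        by (simp add: card_image inj2)
      moreover have "{j. Suc j \<in> insert 0 (Suc ` S)} = S" "{j. Suc j \<in> - insert 0 (Suc ` S)} = - S"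
        by auto
      ultimately show ?thesis
        by (simp add: trm_def nths_Cons interior_product_def)
    qed
    then show "sum (trm \<circ> (\<lambda>S. insert 0 (Suc ` S))) {S. S \<subseteq> {..<n} \<and> card S = k}
        = wedge k (interior_product v \<alpha>) \<beta> vs"
      by (simp add: wedge_def ivs_def n_def)
  qed
  also have "sum trm ((\<lambda>S. Suc ` S) ` {S. S \<subseteq> {..<n} \<and> card S = Suc k})
    = (-1) ^ Suc k * wedge (Suc k) \<alpha> (interior_product v \<beta>) vs"
  proof (subst sum.reindex)
    show "inj_on ((`) Suc) {S. S \<subseteq> {..<n} \<and> card S = Suc k}"
      by (simp add: inj_on_def inj_image_eq_iff)
    have "trm (Suc ` S) = (-1) ^ Suc k * ((-1) ^ card (ivs n S) * \<alpha> (nths vs S) * interior_product v \<beta> (nths vs (- S)))"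
      if S: "S \<subseteq> {..<n}" "card S = Suc k" for S
    proof -
      have "ivs (Suc n) (Suc ` S) = (\<lambda>i. (Suc i, 0)) ` S \<union> map_prod Suc Suc ` ivs n S"
      proof (rule set_eqI)
        show "p \<in> ivs (Suc n) (Suc ` S) \<longleftrightarrow> p \<in> (\<lambda>i. (Suc i, 0)) ` S \<union> map_prod Suc Suc ` ivs n S" for p
          by (cases p; cases "fst p"; cases "snd p") (auto simp: ivs_def map_prod_def image_def)
      qed
      moreover have "(\<lambda>i. (Suc i, 0)) ` S \<inter> map_prod Suc Suc ` ivs n S = {}" by auto
      ultimately have "card (ivs (Suc n) (Suc ` S)) = card ((\<lambda>i. (Suc i, 0::nat)) ` S) + card (map_prod Suc Suc ` ivs n S)"
        using finite_subset[OF S(1)] fin_inv[OF S(1)] by (simp add: card_Un_disjoint)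
      also have "\<dots> = Suc k + card (ivs n S)"
        using S(2) card_image[of "\<lambda>i. (Suc i, 0::nat)" S] by (simp add: card_image[OF inj2] inj_on_def)
      finally have "card (ivs (Suc n) (Suc ` S)) = Suc k + card (ivs n S)" .
      moreover have "{j. Suc j \<in> Suc ` S} = S" "{j. Suc j \<in> - Suc ` S} = - S"
        by auto
      ultimately show ?thesis
        by (simp add: trm_def nths_Cons interior_product_def power_add image_iff)
    qed
    then show "sum (trm \<circ> (`) Suc) {S. S \<subseteq> {..<n} \<and> card S = Suc k}
        = (-1) ^ Suc k * wedge (Suc k) \<alpha> (interior_product v \<beta>) vs"
      unfolding wedge_def sum_distrib_left by (intro sum.cong) (auto simp: ivs_def n_def)
  qed
  finally show ?thesis .
qed

lemma wedge_short:
  assumes "length vs < k" shows "wedge k \<alpha> \<beta> vs = 0"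
proof -
  have "card S < k" if "S \<subseteq> {..<length vs}" for S
    using card_mono[OF _ that] assms by simp
  then have "{S. S \<subseteq> {..<length vs} \<and> card S = k} = {}" by blast
  then show ?thesis by (simp only: wedge_def sum.empty)
qed

lemma length_nths_subset: "S \<subseteq> {..<length vs} \<Longrightarrow> length (nths vs S) = card S"
proof -
  assume "S \<subseteq> {..<length vs}"
  then have "{i. i < length vs \<and> i \<in> S} = S" by auto
  then show ?thesis by (simp add: length_nths)
qed

lemma length_nths_Compl: "S \<subseteq> {..<length vs} \<Longrightarrow> length (nths vs (- S)) = length vs - card S"
proof -
  assume S: "S \<subseteq> {..<length vs}"
  have "{i. i < length vs \<and> i \<in> - S} = {..<length vs} - S" by auto
  then show ?thesis
    using card_Diff_subset[OF finite_subset[OF S] S] by (simp add: length_nths)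
qed

lemma wedge_cong:
  assumes "\<And>us. length us = k \<Longrightarrow> \<alpha> us = \<alpha>' us" "\<And>us. k + length us = length vs \<Longrightarrow> \<beta> us = \<beta>' us"
  shows "wedge k \<alpha> \<beta> vs = wedge k \<alpha>' \<beta>' vs"
  unfolding wedge_def
proof (rule sum.cong[OF refl])
  fix S assume S: "S \<in> {S. S \<subseteq> {..<length vs} \<and> card S = k}"
  then have "card S \<le> length vs" using card_mono[of "{..<length vs}" S] by simp
  with S have "length (nths vs S) = k" "k + length (nths vs (- S)) = length vs"
    using length_nths_subset[of S vs] length_nths_Compl[of S vs] by auto
  from assms(1)[OF this(1)] assms(2)[OF this(2)]
  show "(-1) ^ card {(i, j). i \<in> S \<and> j \<in> {..<length vs} - S \<and> j < i} * \<alpha> (nths vs S) * \<beta> (nths vs (- S)) =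
    (-1) ^ card {(i, j). i \<in> S \<and> j \<in> {..<length vs} - S \<and> j < i} * \<alpha>' (nths vs S) * \<beta>' (nths vs (- S))"
    by (simp only:)
qed

lemma wedge_map:
  "wedge k \<alpha> \<beta> (map f vs) = wedge k (\<lambda>us. \<alpha> (map f us)) (\<lambda>us. \<beta> (map f us)) vs"
  by (simp add: wedge_def nths_map)

text \<open>Multilinear alternating forms of degree \<open>k\<close>, where alternation is only required for adjacent
  arguments. This recursive form is preserved by the wedge product thanks to the
  antiderivation rule \<open>wedge_Cons\<close>.\<close>

primrec mform :: "nat \<Rightarrow> ('v::real_vector list \<Rightarrow> real) \<Rightarrow> bool" where
  "mform 0 \<alpha> \<longleftrightarrow> True"
| "mform (Suc n) \<alpha> \<longleftrightarrow> (\<forall>vs. length vs = n \<longrightarrow> linear (\<lambda>v. \<alpha> (v # vs))) \<and>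
     (\<forall>v vs. Suc (length vs) = n \<longrightarrow> \<alpha> (v # v # vs) = 0) \<and> (\<forall>v. mform n (interior_product v \<alpha>))"

lemma mform_cong:
  "mform n \<alpha> \<Longrightarrow> (\<And>vs. length vs = n \<Longrightarrow> \<alpha> vs = \<beta> vs) \<Longrightarrow> mform n \<beta>"
proof (induction n arbitrary: \<alpha> \<beta>)
  case (Suc n)
  have *: "\<beta> (v # vs) = \<alpha> (v # vs)" if "length vs = n" for v vs
    using Suc.prems(2)[of "v # vs"] that by simp
  have "linear (\<lambda>v. \<beta> (v # vs))" if "length vs = n" for vs
    unfolding *[OF that] using Suc.prems(1) that by simp
  moreover have "\<beta> (v # v # vs) = 0" if "Suc (length vs) = n" for v vs
    using Suc.prems(1) *[of "v # vs" v] that by simp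
  moreover have "mform n (interior_product v \<beta>)" for v
  proof (rule Suc.IH)
    show "mform n (interior_product v \<alpha>)" using Suc.prems(1) by simp
    show "interior_product v \<alpha> vs = interior_product v \<beta> vs" if "length vs = n" for vs
      using *[OF that] by (simp add: interior_product_def)
  qed
  ultimately show ?case by simp
qed simp

lemma mform_linear_combination:
  "mform n \<alpha> \<Longrightarrow> mform n \<beta> \<Longrightarrow> mform n (\<lambda>vs. a * \<alpha> vs + b * \<beta> vs)"
proof (induction n arbitrary: \<alpha> \<beta>)
  case (Suc n)
  have "linear (\<lambda>v. a * \<alpha> (v # vs) + b * \<beta> (v # vs))" if "length vs = n" for vs
    using Suc.prems that
      linear_compose_add[OF linear_compose_scale_right[of "\<lambda>v. \<alpha> (v # vs)" a]
        linear_compose_scale_right[of "\<lambda>v. \<beta> (v # vs)" b]] by simp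
  moreover have "mform n (interior_product v (\<lambda>vs. a * \<alpha> vs + b * \<beta> vs))" for v
    using Suc.IH[of "interior_product v \<alpha>" "interior_product v \<beta>"] Suc.prems
    by (simp add: interior_product_def)
  ultimately show ?case using Suc.prems by simp
qed simp

lemma linear_wedge_left:
  assumes "\<And>us. length us = k \<Longrightarrow> linear (\<lambda>v. \<alpha> v us)"
  shows "linear (\<lambda>v. wedge k (\<alpha> v) \<beta> vs)"
  unfolding wedge_def
proof (rule linear_compose_sum, rule ballI)
  fix S assume S: "S \<in> {S. S \<subseteq> {..<length vs} \<and> card S = k}"
  define c where "c = (-1::real) ^ card {(i, j). i \<in> S \<and> j \<in> {..<length vs} - S \<and> j < i} * \<beta> (nths vs (- S))"
  have "linear (\<lambda>v. c *\<^sub>R \<alpha> v (nths vs S))"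
    using S by (intro linear_compose_scale_right assms) (auto simp: length_nths_subset)
  then show "linear (\<lambda>v. (-1) ^ card {(i, j). i \<in> S \<and> j \<in> {..<length vs} - S \<and> j < i}
      * \<alpha> v (nths vs S) * \<beta> (nths vs (- S)))"
    by (simp add: c_def mult_ac)
qed

lemma linear_wedge_right:
  assumes "\<And>us. k + length us = length vs \<Longrightarrow> linear (\<lambda>v. \<beta> v us)"
  shows "linear (\<lambda>v. wedge k \<alpha> (\<beta> v) vs)"
  unfolding wedge_def
proof (rule linear_compose_sum, rule ballI)
  fix S assume S: "S \<in> {S. S \<subseteq> {..<length vs} \<and> card S = k}"
  define c where "c = (-1::real) ^ card {(i, j). i \<in> S \<and> j \<in> {..<length vs} - S \<and> j < i} * \<alpha> (nths vs S)"
  have "card S \<le> length vs" using S card_mono[of "{..<length vs}" S] by simp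
  then have "linear (\<lambda>v. c *\<^sub>R \<beta> v (nths vs (- S)))"
    using S by (intro linear_compose_scale_right assms) (auto simp: length_nths_Compl)
  then show "linear (\<lambda>v. (-1) ^ card {(i, j). i \<in> S \<and> j \<in> {..<length vs} - S \<and> j < i}
      * \<alpha> (nths vs S) * \<beta> v (nths vs (- S)))"
    by (simp add: c_def mult_ac)
qed

lemma wedge_right_zero:
  assumes "\<And>us. k + length us = length vs \<Longrightarrow> \<beta> us = 0" shows "wedge k \<alpha> \<beta> vs = 0"
proof -
  have "wedge k \<alpha> \<beta> vs = wedge k \<alpha> (\<lambda>_. 0) vs" by (rule wedge_cong) (use assms in auto)
  then show ?thesis by (simp add: wedge_def)
qed

lemma wedge_left_zero:
  assumes "\<And>us. length us = k \<Longrightarrow> \<alpha> us = 0" shows "wedge k \<alpha> \<beta> vs = 0"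
proof -
  have "wedge k \<alpha> \<beta> vs = wedge k (\<lambda>_. 0) \<beta> vs" by (rule wedge_cong) (use assms in auto)
  then show ?thesis by (simp add: wedge_def)
qed

lemma mform_imp_alternating_pair:
  "mform l \<beta> \<Longrightarrow> Suc (Suc (length us)) = l \<Longrightarrow> \<beta> (v # v # us) = 0"
  by (cases l) auto

lemma mform_imp_linear: "mform l \<beta> \<Longrightarrow> Suc (length us) = l \<Longrightarrow> linear (\<lambda>v. \<beta> (v # us))"
  by (cases l) auto

text \<open>Two applications of the antiderivation rule leave two terms with a doubly contracted
  factor, which vanish, and two mixed terms of opposite sign.\<close>

lemma wedge_alternating_pair:
  assumes "mform k \<alpha>" "mform l \<beta>" "Suc (Suc (length vs)) = k + l"
  shows "wedge k \<alpha> \<beta> (v # v # vs) = 0"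
proof -
  have right: "wedge k \<alpha> (interior_product v (interior_product v \<beta>)) vs = 0"
    using assms by (intro wedge_right_zero) (auto simp: interior_product_def intro: mform_imp_alternating_pair)
  consider "k = 0" | "k = Suc 0" | k' where "k = Suc (Suc k')"
    by (metis not0_implies_Suc)
  then show ?thesis
  proof cases
    case 1
    then show ?thesis using assms by (simp add: wedge_0 mform_imp_alternating_pair)
  next
    case 2
    then show ?thesis using right by (simp add: wedge_Cons wedge_0) (simp add: interior_product_def)
  next
    case 3
    have "wedge k' (interior_product v (interior_product v \<alpha>)) \<beta> vs = 0"
      using assms(1) 3 by (intro wedge_left_zero) (auto simp: interior_product_def)
    then show ?thesis using 3 right by (simp add: wedge_Cons)
  qed
qed

lemma mform_wedge: "mform k \<alpha> \<Longrightarrow> mform l \<beta> \<Longrightarrow> n = k + l \<Longrightarrow> mform n (wedge k \<alpha> \<beta>)"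
proof (induction n arbitrary: k l \<alpha> \<beta>)
  case (Suc n)
  have lin_r: "linear (\<lambda>v. wedge k \<alpha> (interior_product v \<beta>) vs)" if "length vs = n" for vs
  proof (rule linear_wedge_right)
    show "linear (\<lambda>v. interior_product v \<beta> us)" if "k + length us = length vs" for us
      using that \<open>length vs = n\<close> Suc.prems unfolding interior_product_def
      by (intro mform_imp_linear[OF Suc.prems(2)]) simp
  qed
  have m_r: "mform n (wedge k \<alpha> (interior_product v \<beta>))" for v
  proof (cases l)
    \<comment> \<open>Here \<open>n\<close> is one less than \<open>k\<close>, so the wedge product
      has too few arguments and is an empty sum.\<close>
    case 0
    have "mform n (\<lambda>vs. 0)" for n
      by (induction n) (auto simp: interior_product_def linear_zero)
    then show ?thesis
      by (rule mform_cong) (use 0 Suc.prems in \<open>simp add: wedge_short\<close>)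
  next
    case (Suc l')
    then show ?thesis using Suc.prems \<open>mform l \<beta>\<close> by (intro Suc.IH[of k _ l']) auto
  qed
  have "linear (\<lambda>v. wedge k \<alpha> \<beta> (v # vs))" if "length vs = n" for vs
  proof (cases k)
    case 0
    then show ?thesis using lin_r[OF that] by (simp add: wedge_0 interior_product_def)
  next
    case (Suc k')
    have "linear (\<lambda>v. wedge k' (interior_product v \<alpha>) \<beta> vs)"
      using Suc.prems(1) Suc by (intro linear_wedge_left) (auto simp: interior_product_def)
    from linear_compose_add[OF this linear_compose_scale_right[OF lin_r[OF that], of "(-1) ^ k"]]
    show ?thesis using Suc by (simp add: wedge_Cons)
  qed
  moreover have "mform n (interior_product v (wedge k \<alpha> \<beta>))" for v
  proof (cases k)
    case 0
    then show ?thesis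
      using m_r[of v] by (auto elim!: mform_cong simp: wedge_0 interior_product_def)
  next
    case (Suc k')
    have "mform n (wedge k' (interior_product v \<alpha>) \<beta>)"
      using Suc Suc.prems by (intro Suc.IH[of _ _ l]) auto
    from mform_linear_combination[OF this m_r[of v], of 1 "(-1) ^ k"]
    show ?thesis
      by (rule mform_cong) (simp add: Suc wedge_Cons interior_product_def)
  qed
  moreover have "wedge k \<alpha> \<beta> (v # v # vs) = 0" if "Suc (length vs) = n" for v vs
    using that Suc.prems(3) by (intro wedge_alternating_pair[OF Suc.prems(1,2)]) simp
  ultimately show ?case by simp
qed simp

lemma mform_alternating: "alternating n \<alpha> \<Longrightarrow> mform n \<alpha>"
proof (induction n arbitrary: \<alpha>)
  case (Suc n)
  have lin: "linear (\<lambda>v. \<alpha> (vs[i := v]))" if "length vs = Suc n" "i < Suc n" for vs i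
    using Suc.prems that unfolding alternating_def by blast
  have alt: "\<alpha> vs = 0" if "length vs = Suc n" "i < Suc n" "j < Suc n" "i \<noteq> j" "vs ! i = vs ! j" for vs i j
    using Suc.prems that unfolding alternating_def by blast
  have "linear (\<lambda>v. \<alpha> (v # vs))" if "length vs = n" for vs
    using lin[of "0 # vs" 0] that by simp
  moreover have "\<alpha> (v # v # vs) = 0" if "Suc (length vs) = n" for v vs
    using alt[of "v # v # vs" 0 1] that by simp
  moreover have "mform n (interior_product v \<alpha>)" for v
  proof (rule Suc.IH, unfold alternating_def, intro allI impI conjI)
    fix vs :: "'a list" and i assume "length vs = n" "i < n"
    then show "linear (\<lambda>w. interior_product v \<alpha> (vs[i := w]))"
      using lin[of "v # vs" "Suc i"] by (simp add: interior_product_def)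
  next
    fix vs :: "'a list" and i j assume "length vs = n" "i < n" "j < n" "i \<noteq> j \<and> vs ! i = vs ! j"
    then show "interior_product v \<alpha> vs = 0"
      using alt[of "v # vs" "Suc i" "Suc j"] by (simp add: interior_product_def)
  qed
  ultimately show ?case by simp
qed simp

section \<open>Vanishing of alternating forms, tested on increasing lists of basis vectors\<close>

lemma mform_zero_on_basis:
  assumes "\<And>v. v = (\<Sum>i\<in>I. c i v *\<^sub>R E i)"
  shows "mform n \<gamma> \<Longrightarrow> (\<And>l. length l = n \<Longrightarrow> set l \<subseteq> I \<Longrightarrow> \<gamma> (map E l) = 0) \<Longrightarrow> length vs = n \<Longrightarrow> \<gamma> vs = 0"
proof (induction n arbitrary: \<gamma> vs)
  case 0
  then show ?case using "0.prems"(2)[of "[]"] by simp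
next
  case (Suc n)
  obtain w ws where vs: "vs = w # ws" "length ws = n" using Suc.prems(3) by (cases vs) auto
  have lin: "linear (\<lambda>v. \<gamma> (v # ws))" using Suc.prems(1) vs by simp
  have "interior_product (E i) \<gamma> ws = 0" if "i \<in> I" for i
  proof (rule Suc.IH[OF _ _ vs(2)])
    show "mform n (interior_product (E i) \<gamma>)" using Suc.prems(1) by simp
    show "interior_product (E i) \<gamma> (map E l) = 0" if "length l = n" "set l \<subseteq> I" for l
      using Suc.prems(2)[of "i # l"] that \<open>i \<in> I\<close> by (simp add: interior_product_def)
  qed
  then have "\<gamma> ((\<Sum>i\<in>I. c i w *\<^sub>R E i) # ws) = 0"
    by (simp add: linear_sum[OF lin] linear_cmul[OF lin] interior_product_def)
  then show ?case using assms[of w] vs by simp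
qed

lemma mform_swap:
  assumes "mform (Suc (Suc n)) \<gamma>" "length vs = n" shows "\<gamma> (a # b # vs) = - \<gamma> (b # a # vs)"
proof -
  have l1: "linear (\<lambda>v. \<gamma> (v # w # vs))" for w using assms by simp
  have l2: "linear (\<lambda>v. \<gamma> (w # v # vs))" for w
    using assms(1) assms(2) by (auto simp: interior_product_def)
  have alt: "\<gamma> (v # v # vs) = 0" for v using assms by simp
  have "\<gamma> ((a + b) # (a + b) # vs) =
      \<gamma> (a # a # vs) + \<gamma> (b # a # vs) + (\<gamma> (a # b # vs) + \<gamma> (b # b # vs))"
    by (simp add: linear_add[OF l1] linear_add[OF l2])
  then show ?thesis using alt[of "a + b"] alt[of a] alt[of b] by linarith
qed

text \<open>The factor \<open>s\<close> is a sign, but only the vanishing of the form has to be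
  transported, so its value is left open here and in \<open>mform_sort\<close>.\<close>

lemma mform_insort:
  fixes l :: "nat list"
  shows "mform (Suc (length l)) \<gamma> \<Longrightarrow> \<exists>s. \<gamma> (map E (x # l)) = s * \<gamma> (map E (insort x l))"
proof (induction l arbitrary: \<gamma>)
  case Nil
  show ?case by (rule exI[of _ 1]) simp
next
  case (Cons y l)
  show ?case
  proof (cases "x \<le> y")
    case True
    then show ?thesis by (intro exI[of _ 1]) simp
  next
    case False
    have "\<gamma> (map E (x # y # l)) = - interior_product (E y) \<gamma> (map E (x # l))"
      using mform_swap[of "length l" \<gamma> "map E l" "E x" "E y"] Cons.prems
      by (simp only: interior_product_def list.map length_map list.size(4) add_Suc_right add_0_right)
    moreover have "mform (Suc (length l)) (interior_product (E y) \<gamma>)" using Cons.prems by simp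
    then obtain s where
      "interior_product (E y) \<gamma> (map E (x # l)) = s * interior_product (E y) \<gamma> (map E (insort x l))"
      using Cons.IH by blast
    ultimately have "\<gamma> (map E (x # y # l)) = (- s) * \<gamma> (map E (y # insort x l))"
      by (simp only: interior_product_def list.map)
    then show ?thesis using False by (intro exI[of _ "- s"]) (simp only: insort_key.simps if_False)
  qed
qed

lemma mform_sort:
  fixes l :: "nat list"
  shows "mform (length l) \<gamma> \<Longrightarrow> \<exists>s. \<gamma> (map E l) = s * \<gamma> (map E (sort l))"
proof (induction l arbitrary: \<gamma>)
  case Nil
  show ?case by (rule exI[of _ 1]) simp
next
  case (Cons x l)
  have "mform (length l) (interior_product (E x) \<gamma>)" using Cons.prems by simp
  then obtain s where "interior_product (E x) \<gamma> (map E l) = s * interior_product (E x) \<gamma> (map E (sort l))"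
    using Cons.IH by blast
  moreover have "mform (Suc (length (sort l))) \<gamma>" using Cons.prems by (simp only: length_sort list.size(4) add_Suc_right add_0_right)
  then obtain s' where "\<gamma> (map E (x # sort l)) = s' * \<gamma> (map E (insort x (sort l)))"
    using mform_insort by blast
  ultimately have "\<gamma> (map E (x # l)) = (s * s') * \<gamma> (map E (sort (x # l)))"
    by (simp add: interior_product_def)
  then show ?case by blast
qed

lemma mform_sorted_not_distinct:
  fixes l :: "nat list"
  shows "mform (length l) \<gamma> \<Longrightarrow> sorted l \<Longrightarrow> \<not> distinct l \<Longrightarrow> \<gamma> (map E l) = 0"
proof (induction l arbitrary: \<gamma>)
  case (Cons x l)
  show ?case
  proof (cases "distinct l")
    case True
    with Cons.prems have "x \<in> set l" by simp
    with Cons.prems(2) obtain l' where "l = x # l'"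
      by (cases l) (auto intro: antisym)
    then show ?thesis using Cons.prems(1) by simp
  next
    case False
    then show ?thesis
      using Cons.IH[of "interior_product (E x) \<gamma>"] Cons.prems by (simp add: interior_product_def)
  qed
qed simp

text \<open>For 5-forms in dimension 6 this leaves six argument lists to check instead of
  6^5.\<close>

lemma mform_zero_on_sorted_basis:
  fixes I :: "nat set"
  assumes "\<And>v. v = (\<Sum>i\<in>I. c i v *\<^sub>R E i)" "mform n \<gamma>"
    and "\<And>l. length l = n \<Longrightarrow> set l \<subseteq> I \<Longrightarrow> sorted l \<Longrightarrow> distinct l \<Longrightarrow> \<gamma> (map E l) = 0"
    and "length vs = n"
  shows "\<gamma> vs = 0"
proof (rule mform_zero_on_basis[OF assms(1,2) _ assms(4)])
  fix l assume l: "length l = n" "set l \<subseteq> I"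
  obtain s where s: "\<gamma> (map E l) = s * \<gamma> (map E (sort l))"
    using mform_sort[of l \<gamma> E] l assms(2) by auto
  have "\<gamma> (map E (sort l)) = 0"
  proof (cases "distinct (sort l)")
    case True
    then show ?thesis using l by (intro assms(3)) auto
  next
    case False
    then show ?thesis using l assms(2) by (intro mform_sorted_not_distinct) auto
  qed
  then show "\<gamma> (map E l) = 0" using s by simp
qed

section \<open>The endomorphism K in an adapted coframe\<close>

lemma dual_basis_exists:
  fixes e :: "nat \<Rightarrow> (real ^ 6) \<Rightarrow>\<^sub>L real"
  assumes "span (e ` {1..6}) = UNIV"
  obtains E where "\<And>i j. i \<in> {1..6} \<Longrightarrow> j \<in> {1..6} \<Longrightarrow> e i (E j) = (if i = j then 1 else 0)"
    "\<And>v. v = (\<Sum>i\<in>{1..6}. e i v *\<^sub>R E i)"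
proof -
  have "card (UNIV :: 6 set) = card {1..6::nat}" by simp
  then obtain h where h: "bij_betw h (UNIV :: 6 set) {1..6::nat}"
    by (meson finite_same_card_bij finite finite_atLeastAtMost)
  define L :: "real ^ 6 \<Rightarrow> real ^ 6" where "L = (\<lambda>v. \<chi> i. e (h i) v)"
  have lin: "linear L"
    by (rule linearI) (auto simp: L_def vec_eq_iff blinfun.add_right blinfun.scaleR_right)
  \<comment> \<open>The functionals vanishing on \<open>v\<close> form a subspace; if it contains
    the coframe it contains the inner product with \<open>v\<close> too, so \<open>v\<close> is
    zero.\<close>
  have zero: "v = 0" if "\<And>i. i \<in> {1..6} \<Longrightarrow> e i v = 0" for v
  proof -
    have "subspace {g. blinfun_apply g v = 0}"
      by (auto simp: subspace_def blinfun.add_left blinfun.scaleR_left)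
    then have "span (e ` {1..6}) \<subseteq> {g. blinfun_apply g v = 0}"
      using that by (intro span_minimal) auto
    then have "blinfun_inner_right v \<in> {g. blinfun_apply g v = 0}" unfolding assms by blast
    then show ?thesis by simp
  qed
  have comp: "e i v = L v $ (inv_into UNIV h i)" if "i \<in> {1..6}" for i v
    using h that by (simp add: L_def bij_betw_inv_into_right)
  have inj: "inj L"
    unfolding linear_injective_0[OF lin] using zero comp by simp
  then have surj: "surj L" using linear_injective_imp_surjective[OF lin] by simp
  define E where "E = (\<lambda>j. inv L (axis (inv_into UNIV h j) 1))"
  have LE: "L (E j) = axis (inv_into UNIV h j) 1" for j
    unfolding E_def by (rule surj_f_inv_f[OF surj])
  have inj_h: "inv_into UNIV h i = inv_into UNIV h j \<longleftrightarrow> i = j" if "i \<in> {1..6}" "j \<in> {1..6}" for i j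
    using that h by (metis bij_betw_inv_into_right)
  have eE: "e i (E j) = (if i = j then 1 else 0)" if "i \<in> {1..6}" "j \<in> {1..6}" for i j
    using comp[OF that(1)] LE inj_h[OF that] by (auto simp: axis_def)
  have "v = (\<Sum>i\<in>{1..6}. e i v *\<^sub>R E i)" for v
  proof -
    have "e j (v - (\<Sum>i\<in>{1..6}. e i v *\<^sub>R E i)) = 0" if "j \<in> {1..6}" for j
    proof -
      have "e j (\<Sum>i\<in>{1..6}. e i v *\<^sub>R E i) = (\<Sum>i\<in>{1..6}. if i = j then e i v else 0)"
        unfolding blinfun.sum_right blinfun.scaleR_right using eE that by (intro sum.cong) auto
      then show ?thesis using that by (simp add: blinfun.diff_right)
    qed
    then show ?thesis using zero by fastforce
  qed
  with eE show ?thesis using that by blast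
qed

lemma e2_pair: "e2 e i j [a, b] = e i a * e j b - e i b * e j a"
  by (simp add: e2_def wedge_Cons wedge_0 wedge_short covec_def interior_product_def)

lemma e3_triple: "e3 e i j k [a, b, c] = e i a * (e j b * e k c - e j c * e k b)
    - e i b * (e j a * e k c - e j c * e k a) + e i c * (e j a * e k b - e j b * e k a)"
  by (simp add: e3_def wedge_Cons wedge_0 wedge_short covec_def interior_product_def algebra_simps)

lemma wedge_1_2_rec:
  "wedge 1 \<alpha> \<beta> [] = 0" "wedge 2 \<alpha> \<beta> [] = 0"
  "wedge 1 \<alpha> \<beta> (v # vs) = wedge 0 (interior_product v \<alpha>) \<beta> vs - wedge 1 \<alpha> (interior_product v \<beta>) vs"
  "wedge 2 \<alpha> \<beta> (v # vs) = wedge 1 (interior_product v \<alpha>) \<beta> vs + wedge 2 \<alpha> (interior_product v \<beta>) vs"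
  using wedge_Cons[of 0 \<alpha> \<beta> v vs] wedge_Cons[of 1 \<alpha> \<beta> v vs] by (simp_all add: wedge_short numeral_2_eq_2)

lemma sorted_five_of_six:
  fixes l :: "nat list"
  assumes "length l = 5" "set l \<subseteq> {1..6}" "sorted l" "distinct l"
  shows "l \<in> {[2,3,4,5,6], [1,3,4,5,6], [1,2,4,5,6], [1,2,3,5,6], [1,2,3,4,6], [1,2,3,4,5]}"
proof -
  have "card ({1..6} - set l) = 1"
    using assms by (simp add: card_Diff_subset distinct_card)
  then obtain j where "{1..6} - set l = {j}" by (auto simp: card_1_singleton_iff)
  then have j: "j \<in> {1..6}" and set: "set l = {1..6} - {j}" using assms(2) by auto
  have *: "l = l'" if "set l' = {1..6} - {j}" "sorted l'" "distinct l'" for l'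
    using that set assms(3,4) by (metis sorted_distinct_set_unique)
  have I: "{1..6::nat} = {1,2,3,4,5,6}" by auto
  from j consider "j = 1" | "j = 2" | "j = 3" | "j = 4" | "j = 5" | "j = 6"
    unfolding I by blast
  then show ?thesis
  proof cases
    case 1
    have "l = [2,3,4,5,6]" by (rule *) (auto simp: 1 I)
    then show ?thesis by simp
  next
    case 2
    have "l = [1,3,4,5,6]" by (rule *) (auto simp: 2 I)
    then show ?thesis by simp
  next
    case 3
    have "l = [1,2,4,5,6]" by (rule *) (auto simp: 3 I)
    then show ?thesis by simp
  next
    case 4
    have "l = [1,2,3,5,6]" by (rule *) (auto simp: 4 I)
    then show ?thesis by simp
  next
    case 5
    have "l = [1,2,3,4,6]" by (rule *) (auto simp: 5 I)
    then show ?thesis by simp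
  next
    case 6
    have "l = [1,2,3,4,5]" by (rule *) (auto simp: 6 I)
    then show ?thesis by simp
  qed
qed

definition volume_form :: "((real ^ 6) list \<Rightarrow> real) \<Rightarrow> (real ^ 6) list \<Rightarrow> real" where
  "volume_form om = (\<lambda>us. wedge 2 om (wedge 2 om om) us / fact 3)"

text \<open>\<open>f\<close> are the coordinates given by the coframe and \<open>E\<close> is the
  dual frame. Both forms are written out as polynomials in the coordinates, so that pointwise
  identities become polynomial identities.\<close>

locale adapted_coframe =
  fixes om ph :: "(real ^ 6) list \<Rightarrow> real" and f :: "nat \<Rightarrow> real ^ 6 \<Rightarrow> real" and E :: "nat \<Rightarrow> real ^ 6"
  assumes lin: "linear (f i)"
    and fE: "i \<in> {1..6} \<Longrightarrow> j \<in> {1..6} \<Longrightarrow> f i (E j) = (if i = j then 1 else 0)"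
    and expand: "v = (\<Sum>i\<in>{1..6}. f i v *\<^sub>R E i)"
    and om: "om [a, b] = f 1 a * f 2 b - f 1 b * f 2 a + (f 3 a * f 4 b - f 3 b * f 4 a)
      + (f 5 a * f 6 b - f 5 b * f 6 a)"
    and ph: "ph [a, b, c] =
        (f 1 a * (f 4 b * f 6 c - f 4 c * f 6 b) - f 1 b * (f 4 a * f 6 c - f 4 c * f 6 a)
          + f 1 c * (f 4 a * f 6 b - f 4 b * f 6 a))
      + (f 2 a * (f 3 b * f 6 c - f 3 c * f 6 b) - f 2 b * (f 3 a * f 6 c - f 3 c * f 6 a)
          + f 2 c * (f 3 a * f 6 b - f 3 b * f 6 a))
      + (f 2 a * (f 4 b * f 5 c - f 4 c * f 5 b) - f 2 b * (f 4 a * f 5 c - f 4 c * f 5 a)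
          + f 2 c * (f 4 a * f 5 b - f 4 b * f 5 a))"
    and mom: "mform 2 om" and mph: "mform 3 ph"
begin

declare One_nat_def [simp del] \<comment> \<open>the index \<open>1\<close> must not become \<open>Suc 0\<close>\<close>

lemma coords_eqI: "(\<And>i. i \<in> {1..6} \<Longrightarrow> f i v = f i w) \<Longrightarrow> v = w"
  using expand[of v] expand[of w] by simp

lemma fE_simps:
  "f 1 (E 1) = 1" "f 1 (E 2) = 0" "f 1 (E 3) = 0" "f 1 (E 4) = 0" "f 1 (E 5) = 0" "f 1 (E 6) = 0"
  "f 2 (E 1) = 0" "f 2 (E 2) = 1" "f 2 (E 3) = 0" "f 2 (E 4) = 0" "f 2 (E 5) = 0" "f 2 (E 6) = 0"
  "f 3 (E 1) = 0" "f 3 (E 2) = 0" "f 3 (E 3) = 1" "f 3 (E 4) = 0" "f 3 (E 5) = 0" "f 3 (E 6) = 0"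
  "f 4 (E 1) = 0" "f 4 (E 2) = 0" "f 4 (E 3) = 0" "f 4 (E 4) = 1" "f 4 (E 5) = 0" "f 4 (E 6) = 0"
  "f 5 (E 1) = 0" "f 5 (E 2) = 0" "f 5 (E 3) = 0" "f 5 (E 4) = 0" "f 5 (E 5) = 1" "f 5 (E 6) = 0"
  "f 6 (E 1) = 0" "f 6 (E 2) = 0" "f 6 (E 3) = 0" "f 6 (E 4) = 0" "f 6 (E 5) = 0" "f 6 (E 6) = 1"
  by (simp_all add: fE)

definition KN :: "real ^ 6 \<Rightarrow> real ^ 6" where
  "KN u = (- 2 * f 2 u) *\<^sub>R E 1 + (- 2 * f 4 u) *\<^sub>R E 3 + (- 2 * f 6 u) *\<^sub>R E 5"

lemma f_KN:
  "f 1 (KN u) = - 2 * f 2 u" "f 2 (KN u) = 0" "f 3 (KN u) = - 2 * f 4 u"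
  "f 4 (KN u) = 0" "f 5 (KN u) = - 2 * f 6 u" "f 6 (KN u) = 0"
  by (simp_all add: KN_def linear_diff[OF lin] linear_neg[OF lin] linear_cmul[OF lin] fE_simps)

lemma om_E_simps:
  "om [E 1, E 1] = 0" "om [E 1, E 2] = 1" "om [E 1, E 3] = 0" "om [E 1, E 4] = 0" "om [E 1, E 5] = 0" "om [E 1, E 6] = 0"
  "om [E 2, E 1] = -1" "om [E 2, E 2] = 0" "om [E 2, E 3] = 0" "om [E 2, E 4] = 0" "om [E 2, E 5] = 0" "om [E 2, E 6] = 0"
  "om [E 3, E 1] = 0" "om [E 3, E 2] = 0" "om [E 3, E 3] = 0" "om [E 3, E 4] = 1" "om [E 3, E 5] = 0" "om [E 3, E 6] = 0"
  "om [E 4, E 1] = 0" "om [E 4, E 2] = 0" "om [E 4, E 3] = -1" "om [E 4, E 4] = 0" "om [E 4, E 5] = 0" "om [E 4, E 6] = 0"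
  "om [E 5, E 1] = 0" "om [E 5, E 2] = 0" "om [E 5, E 3] = 0" "om [E 5, E 4] = 0" "om [E 5, E 5] = 0" "om [E 5, E 6] = 1"
  "om [E 6, E 1] = 0" "om [E 6, E 2] = 0" "om [E 6, E 3] = 0" "om [E 6, E 4] = 0" "om [E 6, E 5] = -1" "om [E 6, E 6] = 0"
  "om [w, E 1] = - f 2 w" "om [w, E 2] = f 1 w" "om [w, E 3] = - f 4 w"
  "om [w, E 4] = f 3 w" "om [w, E 5] = - f 6 w" "om [w, E 6] = f 5 w"
  by (simp_all add: om fE_simps)

lemma volume_form_basis:
  "volume_form om [w, E 2, E 3, E 4, E 5, E 6] = f 1 w"
  "volume_form om [w, E 1, E 3, E 4, E 5, E 6] = - f 2 w"
  "volume_form om [w, E 1, E 2, E 4, E 5, E 6] = f 3 w"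
  "volume_form om [w, E 1, E 2, E 3, E 5, E 6] = - f 4 w"
  "volume_form om [w, E 1, E 2, E 3, E 4, E 6] = f 5 w"
  "volume_form om [w, E 1, E 2, E 3, E 4, E 5] = - f 6 w"
  unfolding volume_form_def
  by (simp_all only: wedge_1_2_rec wedge_0 interior_product_def om_E_simps fE_simps) (simp_all add: fact_numeral)

text \<open>Origin of the 2: contracting with \<open>E 2\<close> gives e^36 + e^45, and e^36 \<and>
  e^245 and e^45 \<and> e^236 both equal e^23456. The values for \<open>E 4\<close> and
  \<open>E 6\<close> arise in the same way.\<close>

lemma phi_square_basis:
  "wedge 2 (interior_product u ph) ph [E 2, E 3, E 4, E 5, E 6] = 2 * f 2 u"
  "wedge 2 (interior_product u ph) ph [E 1, E 3, E 4, E 5, E 6] = 0"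
  "wedge 2 (interior_product u ph) ph [E 1, E 2, E 4, E 5, E 6] = 2 * f 4 u"
  "wedge 2 (interior_product u ph) ph [E 1, E 2, E 3, E 5, E 6] = 0"
  "wedge 2 (interior_product u ph) ph [E 1, E 2, E 3, E 4, E 6] = 2 * f 6 u"
  "wedge 2 (interior_product u ph) ph [E 1, E 2, E 3, E 4, E 5] = 0"
  by (simp_all only: wedge_1_2_rec wedge_0 interior_product_def ph fE_simps) simp_all

text \<open>Justifies the definite description in \<open>K_end\<close>. Six increasing lists of
  frame vectors read off the six coordinates of \<open>w\<close>; conversely the difference of the
  two sides is an alternating 5-form, so the same six lists suffice.\<close>

lemma K_equation_iff:
  "(\<forall>vs. length vs = 5 \<longrightarrow> interior_product w (volume_form om) vs
      = - wedge 2 (interior_product u ph) ph vs) \<longleftrightarrow> w = KN u" (is "(\<forall>vs. _ \<longrightarrow> ?P vs) \<longleftrightarrow> _")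
proof
  assume L: "\<forall>vs. length vs = 5 \<longrightarrow> ?P vs"
  have P: "?P [E 2, E 3, E 4, E 5, E 6]" "?P [E 1, E 3, E 4, E 5, E 6]" "?P [E 1, E 2, E 4, E 5, E 6]"
    "?P [E 1, E 2, E 3, E 5, E 6]" "?P [E 1, E 2, E 3, E 4, E 6]" "?P [E 1, E 2, E 3, E 4, E 5]"
    by (rule L[rule_format], simp)+
  have "f 1 w = f 1 (KN u)" "f 2 w = f 2 (KN u)" "f 3 w = f 3 (KN u)" "f 4 w = f 4 (KN u)"
    "f 5 w = f 5 (KN u)" "f 6 w = f 6 (KN u)"
    using P unfolding f_KN interior_product_def[of w] volume_form_basis phi_square_basis by simp_all
  moreover have "{1..6::nat} = {1,2,3,4,5,6}" by auto
  ultimately show "w = KN u" by (intro coords_eqI) auto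
next
  assume w: "w = KN u"
  define \<gamma> where "\<gamma> = (\<lambda>vs. interior_product w (volume_form om) vs + wedge 2 (interior_product u ph) ph vs)"
  have "mform 4 (wedge 2 om om)" by (rule mform_wedge[OF mom mom]) simp
  then have "mform (Suc 5) (wedge 2 om (wedge 2 om om))"
    using mform_wedge[OF mom, of 4 "wedge 2 om om" "Suc 5"] by simp
  then have "mform 5 (interior_product w (wedge 2 om (wedge 2 om om)))"
    unfolding mform.simps(2) by blast
  moreover have "mform 2 (interior_product u ph)"
    using mph by (simp add: numeral_3_eq_3 numeral_2_eq_2)
  then have "mform 5 (wedge 2 (interior_product u ph) ph)"
    by (rule mform_wedge[OF _ mph]) simp
  ultimately have m: "mform 5 (\<lambda>vs. (1 / fact 3) * interior_product w (wedge 2 om (wedge 2 om om)) vs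
      + 1 * wedge 2 (interior_product u ph) ph vs)"
    by (rule mform_linear_combination)
  have m: "mform 5 \<gamma>"
    by (rule mform_cong[OF m]) (simp add: \<gamma>_def volume_form_def interior_product_def)
  show "\<forall>vs. length vs = 5 \<longrightarrow> ?P vs"
  proof (intro allI impI)
    fix vs :: "(real ^ 6) list" assume len: "length vs = 5"
    have "\<gamma> vs = 0"
    proof (rule mform_zero_on_sorted_basis[OF expand m _ len])
      fix l :: "nat list" assume "length l = 5" "set l \<subseteq> {1..6}" "sorted l" "distinct l"
      from sorted_five_of_six[OF this] show "\<gamma> (map E l) = 0"
        by (elim insertE emptyE)
          (simp_all add: \<gamma>_def interior_product_def[of "KN u"] w volume_form_basis phi_square_basis f_KN)
    qed
    then show "?P vs" by (simp add: \<gamma>_def)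
  qed
qed

lemma linear_KN: "linear KN"
  by (rule linearI) (simp_all add: KN_def linear_add[OF lin] linear_cmul[OF lin] algebra_simps)

lemma KN_KN: "KN (KN u) = 0"
  by (simp add: KN_def[of "KN u"] f_KN)

lemma KN_zero_imp:
  assumes "KN u = 0" shows "u \<in> range KN"
proof -
  have "f 1 (KN u) = 0" "f 3 (KN u) = 0" "f 5 (KN u) = 0" by (simp_all add: assms linear_0[OF lin])
  then have z: "f 2 u = 0" "f 4 u = 0" "f 6 u = 0" by (simp_all add: f_KN)
  define s where "s = (- f 1 u / 2) *\<^sub>R E 2 + (- f 3 u / 2) *\<^sub>R E 4 + (- f 5 u / 2) *\<^sub>R E 6"
  have s: "f 2 s = - f 1 u / 2" "f 4 s = - f 3 u / 2" "f 6 s = - f 5 u / 2"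
    by (simp_all add: s_def linear_diff[OF lin] linear_neg[OF lin] linear_cmul[OF lin] fE_simps)
  have "f 1 u = f 1 (KN s)" "f 2 u = f 2 (KN s)" "f 3 u = f 3 (KN s)" "f 4 u = f 4 (KN s)"
    "f 5 u = f 5 (KN s)" "f 6 u = f 6 (KN s)"
    by (simp_all add: f_KN s z)
  moreover have "{1..6::nat} = {1,2,3,4,5,6}" by auto
  ultimately have "u = KN s" by (intro coords_eqI) auto
  then show ?thesis by blast
qed

lemma om_KN: "om [KN a, b] = - om [a, KN b]"
  by (simp add: om f_KN)

text \<open>This symmetry makes \<open>ph [KN a, b, c]\<close> alternating in all three arguments,
  so that \<open>F_form\<close> is a 3-form.\<close>

lemma ph_KN: "ph [KN a, b, c] = ph [a, KN b, c]"
  by (simp add: ph f_KN algebra_simps)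

lemma ph_nondegenerate:
  assumes "\<And>b c. ph [w, b, c] = 0" shows "w = 0"
proof -
  have "f 1 w = 0" using assms[of "E 4" "E 6"] by (simp add: ph fE_simps)
  moreover have "f 2 w = 0" using assms[of "E 3" "E 6"] by (simp add: ph fE_simps)
  moreover have "f 3 w = 0" using assms[of "E 2" "E 6"] by (simp add: ph fE_simps)
  moreover have "f 4 w = 0" using assms[of "E 1" "E 6"] by (simp add: ph fE_simps)
  moreover have "f 5 w = 0" using assms[of "E 2" "E 4"] by (simp add: ph fE_simps)
  moreover have "f 6 w = 0" using assms[of "E 1" "E 4"] by (simp add: ph fE_simps)
  moreover have "{1..6::nat} = {1,2,3,4,5,6}" by auto
  ultimately show ?thesis by (intro coords_eqI) (auto simp: linear_0[OF lin])
qed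

lemma om_nondegenerate:
  assumes "\<And>b. om [w, b] = 0" shows "w = 0"
proof -
  have "f i w = 0" if "i \<in> {1,2,3,4,5,6}" for i
    using that assms[of "E 1"] assms[of "E 2"] assms[of "E 3"] assms[of "E 4"] assms[of "E 5"] assms[of "E 6"]
    by (auto simp: om_E_simps)
  moreover have "{1..6::nat} = {1,2,3,4,5,6}" by auto
  ultimately show ?thesis by (intro coords_eqI) (auto simp: linear_0[OF lin])
qed

text \<open>Let M be the matrix of the coordinates 2, 4, 6 of \<open>a\<close>, \<open>b\<close>,
  \<open>c\<close>. The matrix of \<open>om [_, KN _]\<close> is 2 M M^T and
  \<open>ph [KN a, b, c]\<close> is -2 det M, so both sides are 8 (det M)^2.\<close>

lemma det_om_KN:
  "om [a, KN a] * (om [b, KN b] * om [c, KN c] - om [b, KN c] * om [c, KN b])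
    - om [a, KN b] * (om [b, KN a] * om [c, KN c] - om [b, KN c] * om [c, KN a])
    + om [a, KN c] * (om [b, KN a] * om [c, KN b] - om [b, KN b] * om [c, KN a])
   = 2 * (ph [KN a, b, c])\<^sup>2"
  by (simp add: om ph f_KN power2_eq_square) algebra

end

lemma adapted_coframe_exists:
  assumes "in_O0_plus om ph" "mform 2 om" "mform 3 ph"
  obtains f E where "adapted_coframe om ph f E"
proof -
  from assms(1) obtain e :: "nat \<Rightarrow> (real ^ 6) \<Rightarrow>\<^sub>L real" where e: "span (e ` {1..6}) = UNIV"
    "\<And>vs. length vs = 2 \<Longrightarrow> om vs = e2 e 1 2 vs + e2 e 3 4 vs + e2 e 5 6 vs"
    "\<And>vs. length vs = 3 \<Longrightarrow> ph vs = e3 e 1 4 6 vs + e3 e 2 3 6 vs + e3 e 2 4 5 vs"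
    unfolding in_O0_plus_def by blast
  obtain E where E: "\<And>i j. i \<in> {1..6} \<Longrightarrow> j \<in> {1..6} \<Longrightarrow> e i (E j) = (if i = j then 1 else 0)"
    "\<And>v. v = (\<Sum>i\<in>{1..6}. e i v *\<^sub>R E i)"
    by (rule dual_basis_exists[OF e(1)]) blast
  have "adapted_coframe om ph (\<lambda>i. blinfun_apply (e i)) E"
    using E assms(2,3) by unfold_locales
      (auto simp: e(2,3) e2_pair e3_triple blinfun.add_right blinfun.scaleR_right intro!: linearI)
  then show ?thesis using that by blast
qed

lemma K_end_eq_KN:
  assumes "adapted_coframe (\<omega> c x) (\<phi> c x) f E"
  shows "K_end \<omega> \<phi> c x = adapted_coframe.KN f E"
proof
  interpret adapted_coframe "\<omega> c x" "\<phi> c x" f E by fact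
  show "K_end \<omega> \<phi> c x u = KN u" for u
    unfolding K_end_def volume_form_def[symmetric] K_equation_iff by simp
qed

section \<open>Local identities for K\<close>

lemma smooth_on_ident: "open S \<Longrightarrow> smooth_on S (\<lambda>x. x)"
  by (rule smooth_on_fderivI[where f' = "\<lambda>x h. h"]) (auto intro: smooth_on_const)

text \<open>Smoothness is required for each fixed argument only, as in \<open>diff_form\<close>;
  linearity in finite dimension extends it to arguments that vary with the point.\<close>

definition linear_family :: "'x::real_normed_vector set \<Rightarrow> ('x \<Rightarrow> 'a::euclidean_space \<Rightarrow> 'r::real_normed_vector) \<Rightarrow> bool" where
  "linear_family U f \<longleftrightarrow> open U \<and> (\<forall>x\<in>U. linear (f x)) \<and> (\<forall>v. smooth_on U (\<lambda>x. f x v))"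

definition bilinear_family :: "'x::real_normed_vector set \<Rightarrow>
    ('x \<Rightarrow> 'a::euclidean_space \<Rightarrow> 'b::euclidean_space \<Rightarrow> 'r::real_normed_vector) \<Rightarrow> bool" where
  "bilinear_family U f \<longleftrightarrow> (\<forall>a. linear_family U (\<lambda>x. f x a)) \<and> (\<forall>b. linear_family U (\<lambda>x a. f x a b))"

definition trilinear_family :: "'x::real_normed_vector set \<Rightarrow>
    ('x \<Rightarrow> 'a::euclidean_space \<Rightarrow> 'b::euclidean_space \<Rightarrow> 'c::euclidean_space \<Rightarrow> 'r::real_normed_vector) \<Rightarrow> bool" where
  "trilinear_family U f \<longleftrightarrow> (\<forall>a. bilinear_family U (\<lambda>x. f x a)) \<and> (\<forall>b c. linear_family U (\<lambda>x a. f x a b c))"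

lemma linear_family_smooth_arg:
  fixes j :: "'u::real_normed_vector \<Rightarrow> 'x::euclidean_space"
  assumes "linear_family U f" "open S" "smooth_on S j" "j ` S \<subseteq> U" "smooth_on S a"
  shows "smooth_on S (\<lambda>y. f (j y) (a y))"
proof (rule smooth_on_linear_arg[OF assms(2) _ _ assms(5)])
  show "linear (f (j y))" if "y \<in> S" for y
    using assms(1,4) that by (auto simp: linear_family_def)
  show "smooth_on S (\<lambda>y. f (j y) v)" for v
    using assms(1) unfolding linear_family_def
    by (intro smooth_on_compose[OF assms(2) _ assms(4,3), where f = "\<lambda>x. f x v"]) blast+
qed

lemma bilinear_family_smooth_arg:
  fixes j :: "'u::real_normed_vector \<Rightarrow> 'x::euclidean_space"
  assumes "bilinear_family U f" "open S" "smooth_on S j" "j ` S \<subseteq> U" "smooth_on S a" "smooth_on S b"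
  shows "smooth_on S (\<lambda>y. f (j y) (a y) (b y))"
proof (rule smooth_on_linear_arg[where f = "\<lambda>y a. f (j y) a (b y)", OF assms(2) _ _ assms(5)])
  show "linear (\<lambda>a. f (j y) a (b y))" if "y \<in> S" for y
    using assms(1,4) that by (auto simp: bilinear_family_def linear_family_def)
  show "smooth_on S (\<lambda>y. f (j y) v (b y))" for v
    using assms(1) unfolding bilinear_family_def
    by (intro linear_family_smooth_arg[OF _ assms(2-4,6)]) blast
qed

lemma linear_family_has_derivative:
  assumes "linear_family U f" "open S" "y \<in> S" "j ` S \<subseteq> U"
    and dj: "(j has_derivative j') (at y)" and da: "(a has_derivative a') (at y)"
  shows "((\<lambda>y. f (j y) (a y)) has_derivative
      (\<lambda>h. fderiv (\<lambda>x. f x (a y)) (j y) (j' h) + f (j y) (a' h))) (at y)"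
proof (rule has_derivative_linear_arg(1)[OF assms(2,3) _ _ da, where f = "\<lambda>y. f (j y)"
      and f' = "\<lambda>h v. fderiv (\<lambda>x. f x v) (j y) (j' h)"])
  show "linear (f (j y))" if "y \<in> S" for y
    using assms(1,4) that by (auto simp: linear_family_def)
  fix v
  have "((\<lambda>x. f x v) has_derivative fderiv (\<lambda>x. f x v) (j y)) (at (j y))"
    using assms by (intro smooth_on_has_derivative[of U]) (auto simp: linear_family_def)
  from diff_chain_at[OF dj this]
  show "((\<lambda>y. f (j y) v) has_derivative (\<lambda>h. fderiv (\<lambda>x. f x v) (j y) (j' h))) (at y)"
    by (simp add: o_def)
qed

lemma bilinear_family_has_derivative:
  assumes "bilinear_family U f" "open S" "y \<in> S" "j ` S \<subseteq> U"
    and dj: "(j has_derivative j') (at y)" and da: "(a has_derivative a') (at y)"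
    and db: "(b has_derivative b') (at y)"
  shows "((\<lambda>y. f (j y) (a y) (b y)) has_derivative
      (\<lambda>h. fderiv (\<lambda>x. f x (a y) (b y)) (j y) (j' h) + f (j y) (a y) (b' h) + f (j y) (a' h) (b y))) (at y)"
proof (rule has_derivative_linear_arg(1)[OF assms(2,3) _ _ da, where f = "\<lambda>y a. f (j y) a (b y)"
      and f' = "\<lambda>h v. fderiv (\<lambda>x. f x v (b y)) (j y) (j' h) + f (j y) v (b' h)"])
  show "linear (\<lambda>a. f (j y) a (b y))" if "y \<in> S" for y
    using assms(1,4) that by (auto simp: bilinear_family_def linear_family_def)
  fix v
  show "((\<lambda>y. f (j y) v (b y)) has_derivative
      (\<lambda>h. fderiv (\<lambda>x. f x v (b y)) (j y) (j' h) + f (j y) v (b' h))) (at y)"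
    using assms(1) by (intro linear_family_has_derivative[OF _ assms(2-4) dj db])
      (auto simp: bilinear_family_def)
qed

lemma trilinear_family_has_derivative:
  assumes "trilinear_family U f" "open S" "y \<in> S" "j ` S \<subseteq> U"
    and dj: "(j has_derivative j') (at y)" and da: "(a has_derivative a') (at y)"
    and db: "(b has_derivative b') (at y)" and dc: "(c has_derivative c') (at y)"
  shows "((\<lambda>y. f (j y) (a y) (b y) (c y)) has_derivative
      (\<lambda>h. fderiv (\<lambda>x. f x (a y) (b y) (c y)) (j y) (j' h) + f (j y) (a y) (b y) (c' h)
         + f (j y) (a y) (b' h) (c y) + f (j y) (a' h) (b y) (c y))) (at y)"
proof (rule has_derivative_linear_arg(1)[OF assms(2,3) _ _ da, where f = "\<lambda>y a. f (j y) a (b y) (c y)"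
      and f' = "\<lambda>h v. fderiv (\<lambda>x. f x v (b y) (c y)) (j y) (j' h) + f (j y) v (b y) (c' h) + f (j y) v (b' h) (c y)"])
  show "linear (\<lambda>a. f (j y) a (b y) (c y))" if "y \<in> S" for y
    using assms(1,4) that by (auto simp: trilinear_family_def linear_family_def)
  fix v
  show "((\<lambda>y. f (j y) v (b y) (c y)) has_derivative
      (\<lambda>h. fderiv (\<lambda>x. f x v (b y) (c y)) (j y) (j' h) + f (j y) v (b y) (c' h) + f (j y) v (b' h) (c y))) (at y)"
    using assms(1) by (intro bilinear_family_has_derivative[OF _ assms(2-4) dj db dc])
      (auto simp: trilinear_family_def)
qed

lemma linear_family_linear_fderiv:
  assumes "linear_family U f" "x \<in> U" shows "linear (\<lambda>a. fderiv (\<lambda>y. f y a) x h)"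
proof (rule has_derivative_linear_arg(2)[of U x f "\<lambda>h v. fderiv (\<lambda>y. f y v) x h" "\<lambda>y. 0" "\<lambda>h. 0"])
  show "((\<lambda>y. f y v) has_derivative (\<lambda>h. fderiv (\<lambda>y. f y v) x h)) (at x)" for v
    using assms by (intro smooth_on_has_derivative[of U]) (auto simp: linear_family_def)
qed (use assms in \<open>auto simp: linear_family_def\<close>)

lemma bilinear_family_fderiv:
  fixes f :: "'x::euclidean_space \<Rightarrow> 'a::euclidean_space \<Rightarrow> 'r::real_normed_vector"
  assumes "linear_family U f" shows "bilinear_family U (\<lambda>x h a. fderiv (\<lambda>y. f y a) x h)"
  unfolding bilinear_family_def linear_family_def
proof (intro conjI allI ballI)
  have sm: "smooth_on U (\<lambda>y. f y a)" for a using assms by (simp add: linear_family_def)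
  show "smooth_on U (\<lambda>x. fderiv (\<lambda>y. f y a) x h)" for a h by (rule smooth_on_fderiv[OF sm])
  then show "smooth_on U (\<lambda>x. fderiv (\<lambda>y. f y a) x h)" for h a .
  show "linear (\<lambda>a. fderiv (\<lambda>y. f y a) x h)" if "x \<in> U" for x h
    by (rule linear_family_linear_fderiv[OF assms that])
  show "linear (\<lambda>h. fderiv (\<lambda>y. f y a) x h)" if "x \<in> U" for x a
    by (rule smooth_on_linear_fderiv[OF sm that])
  show "open U" "open U" using assms by (simp_all add: linear_family_def)
qed

text \<open>The device for differentiating an identity that holds on an open set.\<close>

lemma has_derivative_zero_on_open:
  assumes "(F has_derivative F') (at x)" "open S" "x \<in> S" "\<And>y. y \<in> S \<Longrightarrow> F y = 0"
  shows "F' h = 0"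
proof -
  have "((\<lambda>y. 0) has_derivative F') (at x)"
    by (rule has_derivative_transform_within_open[OF assms(1-3)]) (simp add: assms(4))
  from has_derivative_unique[OF this has_derivative_const] show ?thesis by simp
qed

text \<open>In a chart, \<open>w\<close>, \<open>p\<close> and \<open>K\<close> are the components of \<open>\<omega>\<close>, \<open>\<phi>\<close> and \<open>K(\<phi>)\<close>; below, \<open>q\<close> is \<open>F(\<phi>)\<close> up to
  the factor \<open>-2\<close>, and \<open>Q x h\<close> is the derivative of \<open>K\<close> in the direction \<open>h\<close>.\<close>

locale ambient_patch =
  fixes U :: "(real ^ 6) set" and w :: "real ^ 6 \<Rightarrow> real ^ 6 \<Rightarrow> real ^ 6 \<Rightarrow> real"
    and p :: "real ^ 6 \<Rightarrow> real ^ 6 \<Rightarrow> real ^ 6 \<Rightarrow> real ^ 6 \<Rightarrow> real"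
    and K :: "real ^ 6 \<Rightarrow> real ^ 6 \<Rightarrow> real ^ 6"
  assumes U: "open U" and w: "bilinear_family U w" and p: "trilinear_family U p" and K: "linear_family U K"
    and w_alt: "x \<in> U \<Longrightarrow> w x a b = - w x b a"
    and p_alt: "x \<in> U \<Longrightarrow> p x a b c = - p x b a c" "x \<in> U \<Longrightarrow> p x a b c = - p x a c b"
    and KK: "x \<in> U \<Longrightarrow> K x (K x a) = 0"
    and ker_K: "x \<in> U \<Longrightarrow> K x a = 0 \<Longrightarrow> a \<in> range (K x)"
    and wK: "x \<in> U \<Longrightarrow> w x (K x a) b = - w x a (K x b)"
    and pK: "x \<in> U \<Longrightarrow> p x (K x a) b c = p x a (K x b) c"
    and w_nondeg: "x \<in> U \<Longrightarrow> (\<And>b. w x a b = 0) \<Longrightarrow> a = 0"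
    and p_nondeg: "x \<in> U \<Longrightarrow> (\<And>b c. p x a b c = 0) \<Longrightarrow> a = 0"
    and dw: "x \<in> U \<Longrightarrow> fderiv (\<lambda>y. w y b c) x a - fderiv (\<lambda>y. w y a c) x b + fderiv (\<lambda>y. w y a b) x c = 0"
    and dp: "x \<in> U \<Longrightarrow> fderiv (\<lambda>y. p y b c d) x a - fderiv (\<lambda>y. p y a c d) x b
      + fderiv (\<lambda>y. p y a b d) x c - fderiv (\<lambda>y. p y a b c) x d = 0"
    and dF: "x \<in> U \<Longrightarrow> fderiv (\<lambda>y. p y (K y b) c d) x a - fderiv (\<lambda>y. p y (K y a) c d) x b
      + fderiv (\<lambda>y. p y (K y a) b d) x c - fderiv (\<lambda>y. p y (K y a) b c) x d = 0"
    and det_wK: "x \<in> U \<Longrightarrow>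
      w x a (K x a) * (w x b (K x b) * w x c (K x c) - w x b (K x c) * w x c (K x b))
    - w x a (K x b) * (w x b (K x a) * w x c (K x c) - w x b (K x c) * w x c (K x a))
    + w x a (K x c) * (w x b (K x a) * w x c (K x b) - w x b (K x b) * w x c (K x a))
   = 2 * (p x (K x a) b c)\<^sup>2"
begin

definition Q :: "real ^ 6 \<Rightarrow> real ^ 6 \<Rightarrow> real ^ 6 \<Rightarrow> real ^ 6" where
  "Q x h a = fderiv (\<lambda>y. K y a) x h"

definition q :: "real ^ 6 \<Rightarrow> real ^ 6 \<Rightarrow> real ^ 6 \<Rightarrow> real ^ 6 \<Rightarrow> real" where
  "q x a b c = p x (K x a) b c"

lemma Q: "bilinear_family U Q"
  using bilinear_family_fderiv[OF K] by (simp add: Q_def[abs_def])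

lemma lin_w: "x \<in> U \<Longrightarrow> linear (w x a)" "x \<in> U \<Longrightarrow> linear (\<lambda>a. w x a b)"
  using w by (auto simp: bilinear_family_def linear_family_def)

lemma lin_p: "x \<in> U \<Longrightarrow> linear (p x a b)" "x \<in> U \<Longrightarrow> linear (\<lambda>b. p x a b c)" "x \<in> U \<Longrightarrow> linear (\<lambda>a. p x a b c)"
  using p by (auto simp: trilinear_family_def bilinear_family_def linear_family_def)

lemma p_zero: "x \<in> U \<Longrightarrow> p x 0 b c = 0" "x \<in> U \<Longrightarrow> p x a 0 c = 0" "x \<in> U \<Longrightarrow> p x a b 0 = 0"
  using lin_p[of x, THEN linear_0] by auto

lemma lin_K: "x \<in> U \<Longrightarrow> linear (K x)"
  using K by (auto simp: linear_family_def)

lemma lin_Q: "x \<in> U \<Longrightarrow> linear (Q x a)" "x \<in> U \<Longrightarrow> linear (\<lambda>a. Q x a b)"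
  using Q by (auto simp: bilinear_family_def linear_family_def)

lemma K_add: "x \<in> U \<Longrightarrow> K x (a + b) = K x a + K x b" and K_diff: "x \<in> U \<Longrightarrow> K x (a - b) = K x a - K x b"
  using lin_K by (auto simp: linear_add linear_diff)

lemma q: "trilinear_family U q"
proof -
  have "linear_family U (\<lambda>x a. q x a b c)" for b c
  proof -
    have "smooth_on U (\<lambda>x. p x (K x a) b c)" for a
    proof (rule linear_family_smooth_arg[where f = "\<lambda>x a. p x a b c" and j = "\<lambda>x. x", OF _ U])
      show "linear_family U (\<lambda>x a. p x a b c)" using p by (simp add: trilinear_family_def)
      show "smooth_on U (\<lambda>x. K x a)" using K by (simp add: linear_family_def)
    qed (simp_all add: smooth_on_ident U)
    then show ?thesis
      using U linear_compose[OF lin_K lin_p(3)] by (auto simp: linear_family_def q_def o_def)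
  qed
  moreover have "bilinear_family U (\<lambda>x. q x a)" for a
  proof -
    have "smooth_on U (\<lambda>x. q x a b c)" for b c using calculation[of b c] by (simp add: linear_family_def)
    then show ?thesis using U lin_p by (auto simp: bilinear_family_def linear_family_def q_def[abs_def])
  qed
  ultimately show ?thesis by (simp add: trilinear_family_def)
qed

lemma lin_q: "x \<in> U \<Longrightarrow> linear (q x a b)" "x \<in> U \<Longrightarrow> linear (\<lambda>b. q x a b c)" "x \<in> U \<Longrightarrow> linear (\<lambda>a. q x a b c)"
  using q by (auto simp: trilinear_family_def bilinear_family_def linear_family_def)

lemma q_zero: "x \<in> U \<Longrightarrow> q x 0 b c = 0" "x \<in> U \<Longrightarrow> q x a 0 c = 0" "x \<in> U \<Longrightarrow> q x a b 0 = 0"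
  using lin_q[of x, THEN linear_0] by auto

lemma q_alt: "x \<in> U \<Longrightarrow> q x a b c = - q x b a c" "x \<in> U \<Longrightarrow> q x a b c = - q x a c b"
  using p_alt pK by (metis q_def)+

lemma wKK: "x \<in> U \<Longrightarrow> w x (K x a) (K x b) = 0"
  by (simp add: wK KK linear_0 lin_w)

lemma pKK: "x \<in> U \<Longrightarrow> p x (K x a) (K x b) c = 0"
  using pK[of x "K x a" b c] by (simp add: KK p_zero)

text \<open>Derivatives of pointwise identities: K K = 0, isotropy of the image of \<open>K\<close>,
  vanishing of \<open>q\<close> and of \<open>p\<close> when \<open>K\<close> is inserted once or
  twice respectively, and the definition of \<open>q\<close>. They turn derivatives of the forms on
  vectors \<open>K b\<close> into algebraic terms in \<open>Q\<close>.\<close>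

lemma
  assumes x: "x \<in> U"
  shows Q_K: "Q x h (K x b) = - K x (Q x h b)"
    and dw_KK: "fderiv (\<lambda>y. w y (K x a) (K x b)) x h + w x (K x a) (Q x h b) + w x (Q x h a) (K x b) = 0"
    and dq_K: "fderiv (\<lambda>y. q y (K x b) c d) x h = - q x (Q x h b) c d"
    and dp_KK: "fderiv (\<lambda>y. p y (K x b) (K x c) d) x h + p x (K x b) (Q x h c) d + p x (Q x h b) (K x c) d = 0"
    and dq: "fderiv (\<lambda>y. q y b c d) x h = fderiv (\<lambda>y. p y (K x b) c d) x h + p x (Q x h b) c d"
proof -
  have id: "((\<lambda>y. y) has_derivative (\<lambda>h. h)) (at x)" by (rule has_derivative_ident)
  have const: "((\<lambda>y. c) has_derivative (\<lambda>h. 0)) (at x)" for c :: "real ^ 6" by (rule has_derivative_const)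
  have dK: "((\<lambda>y. K y b) has_derivative (\<lambda>h. Q x h b)) (at x)" for b
    unfolding Q_def using K x by (auto simp: linear_family_def intro: smooth_on_has_derivative)
  have "((\<lambda>y. K y (K y b)) has_derivative (\<lambda>h. Q x h (K x b) + K x (Q x h b))) (at x)"
    using linear_family_has_derivative[OF K U x _ id dK] by (simp add: Q_def)
  from has_derivative_zero_on_open[OF this U x KK, of h]
  show "Q x h (K x b) = - K x (Q x h b)" by (simp add: eq_neg_iff_add_eq_0)
  have "((\<lambda>y. w y (K y a) (K y b)) has_derivative
      (\<lambda>h. fderiv (\<lambda>y. w y (K x a) (K x b)) x h + w x (K x a) (Q x h b) + w x (Q x h a) (K x b))) (at x)"
    using bilinear_family_has_derivative[OF w U x _ id dK dK] by simp
  from has_derivative_zero_on_open[OF this U x wKK]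
  show "fderiv (\<lambda>y. w y (K x a) (K x b)) x h + w x (K x a) (Q x h b) + w x (Q x h a) (K x b) = 0" .
  have "((\<lambda>y. q y (K y b) c d) has_derivative
      (\<lambda>h. fderiv (\<lambda>y. q y (K x b) c d) x h + q x (Q x h b) c d)) (at x)"
    using trilinear_family_has_derivative[OF q U x _ id dK const const, of b c d]
    by (simp add: q_zero x)
  moreover have "q y (K y b) c d = 0" if "y \<in> U" for y
    by (simp add: q_def KK that p_zero)
  ultimately show "fderiv (\<lambda>y. q y (K x b) c d) x h = - q x (Q x h b) c d"
    using has_derivative_zero_on_open[OF _ U x, of "\<lambda>y. q y (K y b) c d"] by (simp add: eq_neg_iff_add_eq_0)
  have "((\<lambda>y. p y (K y b) (K y c) d) has_derivative
      (\<lambda>h. fderiv (\<lambda>y. p y (K x b) (K x c) d) x h + p x (K x b) (Q x h c) d + p x (Q x h b) (K x c) d)) (at x)"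
    using trilinear_family_has_derivative[OF p U x _ id dK dK const, of b c d]
    by (simp add: p_zero x)
  from has_derivative_zero_on_open[OF this U x pKK]
  show "fderiv (\<lambda>y. p y (K x b) (K x c) d) x h + p x (K x b) (Q x h c) d + p x (Q x h b) (K x c) d = 0" .
  have "((\<lambda>y. q y b c d) has_derivative
      (\<lambda>h. fderiv (\<lambda>y. p y (K x b) c d) x h + p x (Q x h b) c d)) (at x)"
    using trilinear_family_has_derivative[OF p U x _ id dK const const, of b c d]
    by (simp add: p_zero x q_def)
  from fderiv_eqI[OF this]
  show "fderiv (\<lambda>y. q y b c d) x h = fderiv (\<lambda>y. p y (K x b) c d) x h + p x (Q x h b) c d" by metis
qed

text \<open>The Lie derivative of \<open>F\<close> along \<open>K u\<close> vanishes.\<close>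

lemma dq_along_K:
  assumes x: "x \<in> U"
  shows "fderiv (\<lambda>y. q y a b c) x (K x u) = - q x (Q x a u) b c - q x a (Q x b u) c - q x a b (Q x c u)"
proof -
  \<comment> \<open>Closedness of \<open>F\<close>, evaluated on \<open>K u\<close>,
    \<open>a\<close>, \<open>b\<close>, \<open>c\<close>. On the right \<open>K x u\<close> is
    inserted into \<open>q\<close>, so \<open>dq_K\<close> makes these terms algebraic.\<close>
  have "fderiv (\<lambda>y. q y a b c) x (K x u) = fderiv (\<lambda>y. q y (K x u) b c) x a
    - fderiv (\<lambda>y. q y (K x u) a c) x b + fderiv (\<lambda>y. q y (K x u) a b) x c"
    using dF[OF x, of a b c "K x u"] by (simp add: q_def)
  then show ?thesis
    using q_alt(1)[OF x, of "Q x b u" a c] q_alt(1)[OF x, of "Q x c u" a b] q_alt(2)[OF x, of a "Q x c u" b]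
    by (simp add: dq_K[OF x])
qed

text \<open>For constant \<open>u\<close>, \<open>v\<close> the left side is [K u, K v] - K [K u, v]
  - K [u, K v]. It is tested inside \<open>p\<close>, which is nondegenerate: invariance of
  \<open>F\<close> along \<open>K u\<close> and \<open>K v\<close> rewrites the leading terms, and
  the derivatives of \<open>p\<close> that remain are those of d\<phi> on \<open>K u\<close>,
  \<open>K v\<close>, \<open>b\<close>, \<open>c\<close>.\<close>

lemma Nijenhuis:
  assumes x: "x \<in> U"
  shows "Q x (K x u) v - Q x (K x v) u + K x (Q x v u) - K x (Q x u v) = 0"
proof (rule p_nondeg[OF x])
  fix b c
  have 1: "p x (Q x (K x u) v) b c = - q x (Q x v u) b c - q x v (Q x b u) c - q x v b (Q x c u)
      - fderiv (\<lambda>y. p y (K x v) b c) x (K x u)" for u v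
    using dq_along_K[OF x, of v b c u] dq[OF x, of v b c "K x u"] by simp
  have 2: "fderiv (\<lambda>y. p y (K x v) b c) x (K x u) - fderiv (\<lambda>y. p y (K x u) b c) x (K x v)
      + fderiv (\<lambda>y. p y (K x u) (K x v) c) x b - fderiv (\<lambda>y. p y (K x u) (K x v) b) x c = 0"
    using dp[OF x, of "K x v" b c "K x u"] by simp
  have 3: "fderiv (\<lambda>y. p y (K x u) (K x v) d) x h = - q x u (Q x h v) d + q x v (Q x h u) d" for h d
    using dp_KK[OF x, of u v d h] p_alt(1)[OF x, of "Q x h u" "K x v" d] by (simp add: q_def)
  have "p x (Q x (K x u) v - Q x (K x v) u + K x (Q x v u) - K x (Q x u v)) b c
    = p x (Q x (K x u) v) b c - p x (Q x (K x v) u) b c + q x (Q x v u) b c - q x (Q x u v) b c"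
    by (simp add: linear_add[OF lin_p(3)[OF x]] linear_diff[OF lin_p(3)[OF x]] q_def)
  also have "\<dots> = 0"
    using 1[of u v] 1[of v u] 2 3[of c b] 3[of b c]
      q_alt(2)[OF x, of v b "Q x c u"] q_alt(2)[OF x, of u b "Q x c v"] by linarith
  finally show "p x (Q x (K x u) v - Q x (K x v) u + K x (Q x v u) - K x (Q x u v)) b c = 0" .
qed

end

section \<open>Leaves in local coordinates\<close>

lemma hessian_potential_exists:
  fixes G :: "'v::euclidean_space \<Rightarrow> 'v \<Rightarrow> 'v \<Rightarrow> real"
  assumes S: "open S" "convex S" "x0 \<in> S"
    and G: "bilinear_family S G" and sym: "\<And>y a b. y \<in> S \<Longrightarrow> G y a b = G y b a"
    and closed: "\<And>y a b c. y \<in> S \<Longrightarrow> fderiv (\<lambda>y. G y a c) y b = fderiv (\<lambda>y. G y b c) y a"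
  obtains f where "smooth_on S f" "\<And>y a b. y \<in> S \<Longrightarrow> fderiv (\<lambda>z. fderiv f z b) y a = G y a b"
proof -
  have lin: "linear (\<lambda>a. G y a b)" "linear (G y b)" if "y \<in> S" for y b
    using G that by (auto simp: bilinear_family_def linear_family_def)
  have sm: "smooth_on S (\<lambda>y. G y a b)" for a b
    using G by (auto simp: bilinear_family_def linear_family_def)
  have "\<exists>\<alpha>. \<forall>y\<in>S. (\<alpha> has_derivative (\<lambda>a. G y a b)) (at y)" for b
  proof (rule closed_one_form_primitive[OF S, of "\<lambda>y a. G y a b"])
    show "fderiv (\<lambda>y. G y u b) y v = fderiv (\<lambda>y. G y v b) y u" if "y \<in> S" for y u v
      by (rule closed[OF that])
  qed (use lin sm in auto)
  then obtain \<alpha> where \<alpha>: "\<And>b y. y \<in> S \<Longrightarrow> (\<alpha> b has_derivative (\<lambda>a. G y a b)) (at y)" by metis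
  \<comment> \<open>The primitives \<alpha> are chosen separately for each \<open>b\<close>, each up
    to a constant, and need not be linear in \<open>b\<close>. \<open>A\<close> keeps those of basis
    vectors and extends linearly; symmetry of \<open>G\<close> makes it closed.\<close>
  define A where "A = (\<lambda>y v. \<Sum>i\<in>Basis. (v \<bullet> i) * \<alpha> i y)"
  have dA: "((\<lambda>y. A y v) has_derivative (\<lambda>a. G y a v)) (at y)" if "y \<in> S" for y v
  proof -
    have "((\<lambda>y. A y v) has_derivative (\<lambda>a. \<Sum>i\<in>Basis. (v \<bullet> i) * G y a i)) (at y)"
      unfolding A_def by (intro has_derivative_sum has_derivative_mult_right \<alpha> that)
    moreover have "(\<Sum>i\<in>Basis. (v \<bullet> i) * G y a i) = G y a v" for a
      using linear_expand_Basis[OF lin(2)[OF that], of a v] by simp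
    ultimately show ?thesis by simp
  qed
  have linA: "linear (A y)" for y
    by (rule linearI) (simp_all add: A_def inner_add_left algebra_simps sum.distrib sum_distrib_left)
  have smA: "smooth_on S (\<lambda>y. A y v)" for v
    by (rule smooth_on_fderivI[OF S(1) dA sm])
  have "fderiv (\<lambda>y. A y u) y v = fderiv (\<lambda>y. A y v) y u" if "y \<in> S" for y u v
    using fderiv_eqI[OF dA[OF that]] sym[OF that] by metis
  then obtain f where f: "\<And>y. y \<in> S \<Longrightarrow> (f has_derivative A y) (at y)"
    using closed_one_form_primitive[OF S linA smA] by blast
  have "smooth_on S f" by (rule smooth_on_fderivI[OF S(1) f smA])
  moreover have "fderiv (\<lambda>z. fderiv f z b) y a = G y a b" if "y \<in> S" for y a b
  proof -
    have "fderiv (\<lambda>z. fderiv f z b) y = fderiv (\<lambda>z. A z b) y"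
      by (rule fderiv_cong_open[OF S(1) that]) (simp add: fderiv_eqI[OF f])
    then show ?thesis using fderiv_eqI[OF dA[OF that]] by metis
  qed
  ultimately show ?thesis using that by blast
qed

context ambient_patch begin

text \<open>Removing from any preimage its component in the range of \<open>K\<close> does not
  change its image, since K K = 0. Two such preimages differ by an element of ker K, that is of the
  range, which is also orthogonal to the range.\<close>

lemma normal_preimage:
  assumes x: "x \<in> U" and v: "K x v = 0"
  shows "\<exists>!s. K x s = v \<and> (\<forall>a. s \<bullet> K x a = 0)"
proof -
  have sub: "span (range (K x)) = range (K x)"
    using linear_subspace_image[OF lin_K[OF x] subspace_UNIV] by (simp add: span_eq_iff)
  obtain b where b: "v = K x b" using ker_K[OF x v] by blast
  obtain y z where yz: "y \<in> span (range (K x))" "\<And>r. r \<in> span (range (K x)) \<Longrightarrow> orthogonal z r" "b = y + z"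
    using orthogonal_subspace_decomp_exists by metis
  have "K x z = v" using yz(1,3) b by (auto simp: sub K_add[OF x] KK[OF x])
  moreover have "z \<bullet> K x a = 0" for a using yz(2) by (simp add: sub orthogonal_def)
  moreover have "s = s'" if "K x s = v" "\<forall>a. s \<bullet> K x a = 0" "K x s' = v" "\<forall>a. s' \<bullet> K x a = 0" for s s'
  proof -
    have "K x (s - s') = 0" using that by (simp add: K_diff[OF x])
    then obtain c where "s - s' = K x c" using ker_K[OF x] by blast
    then have "(s - s') \<bullet> (s - s') = (s - s') \<bullet> K x c" by simp
    also have "\<dots> = 0" using that by (simp add: inner_diff_left)
    finally have "(s - s') \<bullet> (s - s') = 0" .
    then show ?thesis by simp
  qed
  ultimately show ?thesis by blast
qed

lemma K_basis: "x \<in> U \<Longrightarrow> K x b = (\<Sum>i\<in>UNIV. b $ i *\<^sub>R K x (axis i 1))"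
  using basis_expansion[of b] linear_sum[OF lin_K] linear_cmul[OF lin_K]
  by (metis (mono_tags, lifting) scalar_mult_eq_scaleR sum.cong)

lemma q_cong:
  assumes x: "x \<in> U" and "K x a = K x a'" shows "q x a b c = q x a' b c"
  using assms by (simp add: q_def)

definition Q2 :: "real ^ 6 \<Rightarrow> real ^ 6 \<Rightarrow> real ^ 6 \<Rightarrow> real ^ 6 \<Rightarrow> real ^ 6" where
  "Q2 x h v a = fderiv (\<lambda>y. Q y v a) x h"

lemma Q2_commute: "x \<in> U \<Longrightarrow> Q2 x h v a = Q2 x v h a"
  unfolding Q2_def Q_def using K by (intro fderiv_commute[OF U]) (auto simp: linear_family_def)

lemma dNijenhuis:
  assumes x: "x \<in> U"
  shows "Q2 x v (K x a) b + Q x (Q x v a) b - Q2 x v (K x b) a - Q x (Q x v b) a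
    + Q x v (Q x b a) - Q x v (Q x a b) + K x (Q2 x v b a) - K x (Q2 x v a b) = 0"
proof -
  have id: "((\<lambda>y. y) has_derivative (\<lambda>h. h)) (at x)" by (rule has_derivative_ident)
  have const: "((\<lambda>y. c) has_derivative (\<lambda>h. 0)) (at x)" for c :: "real ^ 6" by (rule has_derivative_const)
  have dK: "((\<lambda>y. K y b) has_derivative (\<lambda>h. Q x h b)) (at x)" for b
    unfolding Q_def using K x by (auto simp: linear_family_def intro: smooth_on_has_derivative)
  have dQ: "((\<lambda>y. Q y c b) has_derivative (\<lambda>h. Q2 x h c b)) (at x)" for b c
    unfolding Q2_def using Q x by (auto simp: bilinear_family_def linear_family_def intro: smooth_on_has_derivative)
  have dQK: "((\<lambda>y. Q y (K y a) b) has_derivative (\<lambda>h. Q2 x h (K x a) b + Q x (Q x h a) b)) (at x)" for a b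
    using bilinear_family_has_derivative[OF Q U x _ id dK const, of a b]
    by (simp add: Q2_def linear_0[OF lin_Q(1)[OF x]])
  have dKQ: "((\<lambda>y. K y (Q y a b)) has_derivative (\<lambda>h. Q x h (Q x a b) + K x (Q2 x h a b))) (at x)" for a b
    using linear_family_has_derivative[OF K U x _ id dQ, of a b] by (simp add: Q_def)
  have "((\<lambda>y. Q y (K y a) b - Q y (K y b) a + K y (Q y b a) - K y (Q y a b)) has_derivative
     (\<lambda>v. (Q2 x v (K x a) b + Q x (Q x v a) b) - (Q2 x v (K x b) a + Q x (Q x v b) a)
      + (Q x v (Q x b a) + K x (Q2 x v b a)) - (Q x v (Q x a b) + K x (Q2 x v a b)))) (at x)"
    by (intro has_derivative_diff has_derivative_add dQK dKQ)
  from has_derivative_zero_on_open[OF this U x Nijenhuis, of v]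
  show ?thesis by (simp add: algebra_simps)
qed

end

locale leaf_patch = ambient_patch +
  fixes Om :: "(real ^ 3) set" and io :: "real ^ 3 \<Rightarrow> real ^ 6"
  assumes Om: "open Om" and io: "smooth_on Om io" and io_U: "io ` Om \<subseteq> U"
    and J_inj: "y \<in> Om \<Longrightarrow> inj (fderiv io y)"
    and J_range: "y \<in> Om \<Longrightarrow> range (fderiv io y) = {v. K (io y) v = 0}"
begin

definition J :: "real ^ 3 \<Rightarrow> real ^ 3 \<Rightarrow> real ^ 6" where "J y u = fderiv io y u"

definition H :: "real ^ 3 \<Rightarrow> real ^ 3 \<Rightarrow> real ^ 3 \<Rightarrow> real ^ 6" where "H y h u = fderiv (\<lambda>y. fderiv io y u) y h"

text \<open>Orthogonality to the image of \<open>K\<close> only serves to single out one preimage of \<open>J u\<close> under \<open>K\<close>,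
  which then depends smoothly on the point.\<close>

definition s :: "real ^ 3 \<Rightarrow> real ^ 3 \<Rightarrow> real ^ 6" where
  "s y u = (THE s. K (io y) s = J y u \<and> (\<forall>a. s \<bullet> K (io y) a = 0))"

definition T :: "real ^ 3 \<Rightarrow> real ^ 3 \<Rightarrow> real ^ 3 \<Rightarrow> real ^ 6" where "T y h u = fderiv (\<lambda>y. s y u) y h"

definition g :: "real ^ 3 \<Rightarrow> real ^ 3 \<Rightarrow> real ^ 3 \<Rightarrow> real" where "g y a b = w (io y) (s y a) (J y b)"

lemma io_in: "y \<in> Om \<Longrightarrow> io y \<in> U" using io_U by blast

lemma J_fam: "linear_family Om J"
  unfolding linear_family_def J_def[abs_def]
  using Om smooth_on_linear_fderiv[OF io] smooth_on_fderiv[OF io] by blast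

lemma lin_J: "y \<in> Om \<Longrightarrow> linear (J y)" using J_fam by (auto simp: linear_family_def)

lemma KJ: "y \<in> Om \<Longrightarrow> K (io y) (J y u) = 0"
  using J_range[of y] unfolding J_def by blast

lemma J_zero: "y \<in> Om \<Longrightarrow> J y u = 0 \<Longrightarrow> u = 0"
  using J_inj[of y] linear_injective_0[OF lin_J[of y]] by (simp add: J_def[abs_def])

lemma J_surj: "y \<in> Om \<Longrightarrow> K (io y) v = 0 \<Longrightarrow> \<exists>u. v = J y u"
  using J_range[of y] unfolding J_def by blast

lemma Ks: "y \<in> Om \<Longrightarrow> K (io y) (s y u) = J y u"
  and s_orth: "y \<in> Om \<Longrightarrow> s y u \<bullet> K (io y) a = 0"
  using theI'[OF normal_preimage[OF io_in KJ, of y u]] unfolding s_def by blast+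

lemma s_eqI: "y \<in> Om \<Longrightarrow> K (io y) v = J y u \<Longrightarrow> (\<And>a. v \<bullet> K (io y) a = 0) \<Longrightarrow> s y u = v"
  using normal_preimage[OF io_in KJ, of y u] Ks[of y u] s_orth[of y u] by blast

lemma lin_s:
  assumes y: "y \<in> Om" shows "linear (s y)"
proof (rule linearI)
  show "s y (a + b) = s y a + s y b" for a b
    by (rule s_eqI[OF y])
      (simp_all add: K_add[OF io_in[OF y]] Ks[OF y] linear_add[OF lin_J[OF y]] inner_add_left s_orth[OF y])
  show "s y (c *\<^sub>R a) = c *\<^sub>R s y a" for a c
    by (rule s_eqI[OF y])
      (simp_all add: linear_cmul[OF lin_K[OF io_in[OF y]]] Ks[OF y] linear_cmul[OF lin_J[OF y]] s_orth[OF y])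
qed

lemma smooth_J: "smooth_on Om (\<lambda>y. J y u)" using J_fam by (simp add: linear_family_def)

lemma smooth_K_io: "smooth_on Om (\<lambda>y. K (io y) v)"
  by (rule linear_family_smooth_arg[OF K Om io io_U smooth_on_const])

text \<open>An overdetermined system of twelve equations: the index \<open>(True, j)\<close> stands
  for component \<open>j\<close> of K v = J u, and \<open>(False, j)\<close> for orthogonality to
  \<open>K\<close> of the \<open>j\<close>-th axis. A homogeneous solution lies in the range of
  \<open>K\<close> and is orthogonal to it.\<close>

lemma smooth_s: "smooth_on Om (\<lambda>y. s y u)"
proof (rule smooth_on_linear_solution[OF Om, where I = "UNIV :: (bool \<times> 6) set"
      and r = "\<lambda>i y v. if fst i then K (io y) v $ snd i else v \<bullet> K (io y) (axis (snd i) 1)"])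
  fix i :: "bool \<times> 6"
  show "linear (\<lambda>v. if fst i then K (io y) v $ snd i else v \<bullet> K (io y) (axis (snd i) 1))" if "y \<in> Om" for y
    by (cases "fst i") (auto intro!: linearI
        simp: K_add io_in that linear_cmul[OF lin_K[OF io_in[OF that]]] inner_add_left)
  show "smooth_on Om (\<lambda>y. if fst i then K (io y) v $ snd i else v \<bullet> K (io y) (axis (snd i) 1))" for v
    using smooth_on_bounded_linear[OF bounded_linear_vec_nth Om smooth_K_io]
      smooth_on_bounded_linear[OF bounded_linear_inner_right Om smooth_K_io]
    by (cases "fst i") auto
  have "smooth_on Om (\<lambda>y. K (io y) (s y u) $ j)" for j
    using smooth_on_bounded_linear[OF bounded_linear_vec_nth[of j] Om smooth_J[of u]]
    by (rule iffD2[OF smooth_on_cong[OF Om], rotated]) (simp add: Ks)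
  moreover have "smooth_on Om (\<lambda>y. s y u \<bullet> K (io y) a)" for a
    using smooth_on_const[of Om "0::real"]
    by (rule iffD2[OF smooth_on_cong[OF Om], rotated]) (simp add: s_orth)
  ultimately show "smooth_on Om (\<lambda>y. if fst i then K (io y) (s y u) $ snd i else s y u \<bullet> K (io y) (axis (snd i) 1))"
    by (cases "fst i") auto
next
  fix y v assume y: "y \<in> Om"
    and z: "\<And>i. i \<in> UNIV \<Longrightarrow> (if fst i then K (io y) v $ snd i else v \<bullet> K (io y) (axis (snd i) 1)) = 0"
  have "K (io y) v = 0" using z[of "(True, _)"] by (simp add: vec_eq_iff)
  then obtain b where b: "v = K (io y) b" using ker_K[OF io_in[OF y]] by blast
  have "v \<bullet> v = v \<bullet> (\<Sum>i\<in>UNIV. b $ i *\<^sub>R K (io y) (axis i 1))"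
    using b K_basis[OF io_in[OF y], of b] by simp
  also have "\<dots> = 0" using z[of "(False, _)"] by (simp add: inner_sum_right)
  finally show "v = 0" by simp
qed simp

lemma dio: "y \<in> Om \<Longrightarrow> (io has_derivative J y) (at y)"
  unfolding J_def[abs_def] by (rule smooth_on_has_derivative[OF io])

lemma dJ: "y \<in> Om \<Longrightarrow> ((\<lambda>y. J y u) has_derivative (\<lambda>h. H y h u)) (at y)"
  unfolding H_def using smooth_on_has_derivative[OF smooth_J, of y u] by (simp add: J_def)

lemma ds: "y \<in> Om \<Longrightarrow> ((\<lambda>y. s y u) has_derivative (\<lambda>h. T y h u)) (at y)"
  unfolding T_def by (rule smooth_on_has_derivative[OF smooth_s])

lemma H_sym: "y \<in> Om \<Longrightarrow> H y a b = H y b a"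
  unfolding H_def by (rule fderiv_commute[OF Om _ io])

lemma H_eq:
  assumes y: "y \<in> Om"
  shows "H y h u = Q (io y) (J y h) (s y u) + K (io y) (T y h u)"
proof -
  have "((\<lambda>y. K (io y) (s y u)) has_derivative
      (\<lambda>h. Q (io y) (J y h) (s y u) + K (io y) (T y h u))) (at y)"
    using linear_family_has_derivative[OF K Om y io_U dio[OF y] ds[OF y]] by (simp add: Q_def)
  then have "((\<lambda>y. J y u) has_derivative (\<lambda>h. Q (io y) (J y h) (s y u) + K (io y) (T y h u))) (at y)"
    by (rule has_derivative_transform_within_open[OF _ Om y]) (simp add: Ks)
  from has_derivative_unique[OF this dJ[OF y]] show ?thesis by metis
qed

lemma g_fam: "bilinear_family Om g"
proof -
  have "smooth_on Om (\<lambda>y. g y a b)" for a b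
    unfolding g_def by (rule bilinear_family_smooth_arg[OF w Om io io_U smooth_s smooth_J])
  moreover have "linear (g y a)" "linear (\<lambda>a. g y a b)" if "y \<in> Om" for y a b
    using linear_compose[OF lin_J[OF that] lin_w(1)[OF io_in[OF that]], of "s y a"]
      linear_compose[OF lin_s[OF that] lin_w(2)[OF io_in[OF that]], of "J y b"]
    by (simp_all add: g_def[abs_def] o_def)
  ultimately show ?thesis using Om by (simp add: bilinear_family_def linear_family_def)
qed

text \<open>Any preimage may replace \<open>s\<close>: moving \<open>K\<close> from
  \<open>J b\<close> = K (s b) across \<open>w\<close> shows that only \<open>K v\<close>
  enters.\<close>

lemma g_sK: "y \<in> Om \<Longrightarrow> K (io y) v = J y a \<Longrightarrow> w (io y) v (J y b) = g y a b"
  using wK[OF io_in, of y] Ks[of y] by (metis g_def neg_equal_iff_equal)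

lemma g_sym: "y \<in> Om \<Longrightarrow> g y a b = g y b a"
  using wK[OF io_in, of y "s y a" "s y b"] w_alt[OF io_in, of y "J y a" "s y b"] Ks[of y]
  by (simp add: g_def)

lemma w_J_nondeg:
  assumes y: "y \<in> Om" and "\<And>v. w (io y) (J y u) v = 0" shows "u = 0"
  using w_nondeg[OF io_in[OF y] assms(2)] J_zero[OF y] by blast

lemma g_nondeg:
  assumes y: "y \<in> Om" and z: "\<And>b. g y a b = 0" shows "a = 0"
proof (rule w_J_nondeg[OF y])
  fix v
  obtain b where b: "K (io y) v = J y b" using J_surj[OF y KK[OF io_in[OF y]]] by blast
  have "w (io y) (J y a) v = - w (io y) (s y a) (K (io y) v)"
    using wK[OF io_in[OF y], of "s y a" v] Ks[OF y] by simp
  then show "w (io y) (J y a) v = 0" using z[of b] by (simp add: b g_def)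
qed

text \<open>The right hand side is the square of the volume form that \<open>K\<close> induces on the leaf from the
  transverse volume form \<open>F\<close>.\<close>

lemma det_g:
  assumes y: "y \<in> Om"
  shows "g y a a * (g y b b * g y c c - g y b c * g y c b)
    - g y a b * (g y b a * g y c c - g y b c * g y c a)
    + g y a c * (g y b a * g y c b - g y b b * g y c a)
   = 2 * (q (io y) (s y a) (s y b) (s y c))\<^sup>2"
  using det_wK[OF io_in[OF y], of "s y a" "s y b" "s y c"] by (simp add: g_def q_def Ks[OF y])

end

section \<open>The connections on a leaf\<close>

context leaf_patch begin

lemma dw_J:
  assumes y: "y \<in> Om"
  shows "((\<lambda>y. w (io y) (J y z) v) has_derivative
      (\<lambda>h. fderiv (\<lambda>x. w x (J y z) v) (io y) (J y h) + w (io y) (H y h z) v)) (at y)"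
  using bilinear_family_has_derivative[OF w Om y io_U dio[OF y] dJ[OF y] has_derivative_const, of z v]
  by (simp add: linear_0[OF lin_w(1)[OF io_in[OF y]]])

end

text \<open>The formulas for \<open>D\<close> and \<open>B\<close> are the definitions of the two
  partial connections evaluated on the fields \<open>K a\<close> and \<open>K d\<close>, where
  \<open>a\<close> = \<open>s y u\<close> and \<open>d\<close> = \<open>s y z\<close> are frozen at
  the point. The terms with \<open>H\<close> and \<open>Q (J u)\<close> in \<open>D\<close> convert
  an ambient derivative into a Christoffel symbol of the leaf; in \<open>B\<close> the field paired
  with the derivative is the constant \<open>v\<close>.\<close>

locale leaf_connections = leaf_patch +
  fixes D B N :: "real ^ 3 \<Rightarrow> real ^ 3 \<Rightarrow> real ^ 3 \<Rightarrow> real ^ 3"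
  assumes D: "y \<in> Om \<Longrightarrow> J y (D y u z) =
        H y u z - Q (io y) (J y u) (s y z) - K (io y) (Q (io y) (s y z) (s y u))"
    and B: "y \<in> Om \<Longrightarrow> w (io y) (J y (B y u z)) v =
        fderiv (\<lambda>y. w (io y) (J y z) v) y u + w (io y) (J y z) (Q (io y) v (s y u))"
    and smooth_B: "smooth_on Om (\<lambda>y. B y u z)"
    and bilinear_N: "y \<in> Om \<Longrightarrow> bilinear (N y)" and bilinear_D: "y \<in> Om \<Longrightarrow> bilinear (D y)"
    and bilinear_B: "y \<in> Om \<Longrightarrow> bilinear (B y)"
    and N_sym: "y \<in> Om \<Longrightarrow> N y u z = N y z u"
    and N_metric: "y \<in> Om \<Longrightarrow> fderiv (\<lambda>y. g y u z) y h = g y (N y h u) z + g y u (N y h z)"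
begin

lemma D_K: "y \<in> Om \<Longrightarrow> J y (D y u z) = K (io y) (T y u z - Q (io y) (s y z) (s y u))"
  by (simp add: D H_eq K_diff io_in)

lemma D_sym:
  assumes y: "y \<in> Om" shows "D y u z = D y z u"
proof -
  have "J y (D y u z) = J y (D y z u)"
    using Nijenhuis[OF io_in[OF y], of "s y u" "s y z"] H_sym[OF y, of u z]
    by (simp add: D[OF y] Ks[OF y] algebra_simps)
  then have "J y (D y u z - D y z u) = 0" by (simp add: linear_diff[OF lin_J[OF y]])
  from J_zero[OF y this] show ?thesis by simp
qed

text \<open>Closedness of \<open>w\<close> turns the antisymmetric part of the derivative terms into
  the derivative of \<open>w (J u) (J z)\<close> in direction \<open>v\<close>, with the vectors
  frozen. Since the image of \<open>K\<close> is isotropic everywhere, \<open>dw_KK\<close> cancels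
  it against the \<open>Q\<close> terms.\<close>

lemma B_sym:
  assumes y: "y \<in> Om" shows "B y u z = B y z u"
proof -
  have x: "io y \<in> U" by (rule io_in[OF y])
  have "w (io y) (J y (B y u z)) v = w (io y) (J y (B y z u)) v" for v
  proof -
    have 1: "w (io y) (J y (B y u z)) v = fderiv (\<lambda>x. w x (J y z) v) (io y) (J y u) + w (io y) (H y u z) v
        + w (io y) (J y z) (Q (io y) v (s y u))" for u z
      using fderiv_eqI[OF dw_J[OF y]] by (simp add: B[OF y])
    show ?thesis
      using 1[of u z] 1[of z u] H_sym[OF y, of u z] dw[OF x, of "J y z" v "J y u"]
        dw_KK[OF x, of "s y u" "s y z" v] w_alt[OF x, of "Q (io y) v (s y u)" "J y z"]
      by (simp add: Ks[OF y])
  qed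
  then have "w (io y) (J y (B y u z - B y z u)) v = 0" for v
    by (simp add: linear_diff[OF lin_J[OF y]] linear_diff[OF lin_w(2)[OF x]])
  from w_J_nondeg[OF y this] show ?thesis by simp
qed

text \<open>In \<open>g a z\<close> = - \<open>w (J z) (s a)\<close>, differentiating
  \<open>J z\<close> and the point produces the Bott derivative of \<open>z\<close>. Differentiating
  \<open>s a\<close> gives \<open>T u a\<close>, which differs by a \<open>Q\<close> term from a
  preimage of \<open>J (D u a)\<close>, and that \<open>Q\<close> term is the one in
  \<open>B\<close>.\<close>

lemma duality:
  assumes y: "y \<in> Om"
  shows "fderiv (\<lambda>y. g y a z) y u = g y (D y u a) z + g y a (B y u z)"
proof -
  have x: "io y \<in> U" by (rule io_in[OF y])
  have gw: "g y a z = - w (io y) (J y z) (s y a)" if "y \<in> Om" for y a z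
    unfolding g_def by (rule w_alt[OF io_in[OF that]])
  have "((\<lambda>y. w (io y) (J y z) (s y a)) has_derivative (\<lambda>h. fderiv (\<lambda>x. w x (J y z) (s y a)) (io y) (J y h)
      + w (io y) (J y z) (T y h a) + w (io y) (H y h z) (s y a))) (at y)"
    by (rule bilinear_family_has_derivative[OF w Om y io_U dio[OF y] dJ[OF y] ds[OF y]])
  from has_derivative_minus[OF this]
  have "((\<lambda>y. g y a z) has_derivative (\<lambda>h. - (fderiv (\<lambda>x. w x (J y z) (s y a)) (io y) (J y h)
      + w (io y) (J y z) (T y h a) + w (io y) (H y h z) (s y a)))) (at y)"
    by (rule has_derivative_transform_within_open[OF _ Om y]) (simp add: gw)
  from fderiv_eqI[OF this] have 1: "fderiv (\<lambda>y. g y a z) y u = - (fderiv (\<lambda>x. w x (J y z) (s y a)) (io y) (J y u)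
      + w (io y) (J y z) (T y u a) + w (io y) (H y u z) (s y a))" by metis
  have 2: "w (io y) (J y (B y u z)) (s y a) = fderiv (\<lambda>x. w x (J y z) (s y a)) (io y) (J y u)
      + w (io y) (H y u z) (s y a) + w (io y) (J y z) (Q (io y) (s y a) (s y u))"
    using fderiv_eqI[OF dw_J[OF y]] by (simp add: B[OF y])
  have "g y a (B y u z) = - w (io y) (J y (B y u z)) (s y a)"
    by (rule gw[OF y])
  moreover have "g y (D y u a) z = - w (io y) (J y z) (T y u a - Q (io y) (s y a) (s y u))"
    using g_sK[OF y D_K[OF y, symmetric], of u a z]
      w_alt[OF x, of "T y u a - Q (io y) (s y a) (s y u)" "J y z"] by simp
  ultimately show ?thesis
    using 1 2 by (simp add: linear_diff[OF lin_w(1)[OF x]])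
qed

text \<open>\<open>g (P u a) z\<close> is symmetric in \<open>u\<close>, \<open>a\<close> because
  the three connections are torsion-free. It is skew in \<open>a\<close>, \<open>z\<close> because
  duality, symmetrised in these arguments, says that \<open>D + B\<close> is compatible with
  \<open>2 g\<close>. A trilinear form with both symmetries vanishes.\<close>

lemma N_eq:
  assumes y: "y \<in> Om" shows "2 *\<^sub>R N y u z = D y u z + B y u z"
proof -
  define P where "P = (\<lambda>u z. D y u z + B y u z - 2 *\<^sub>R N y u z)"
  have lin: "linear (g y a)" "linear (\<lambda>a. g y a b)" for a b
    using g_fam y by (auto simp: bilinear_family_def linear_family_def)
  have P_sym: "P u z = P z u" for u z
    using D_sym[OF y] B_sym[OF y] N_sym[OF y] by (simp add: P_def)
  have skew: "g y (P u a) z + g y a (P u z) = 0" for u a z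
  proof -
    have "g y (N y u a) z + g y a (N y u z) = g y (D y u a) z + g y a (B y u z)"
      using duality[OF y, of a z u] N_metric[OF y, of a z u] by simp
    moreover have "g y (N y u z) a + g y z (N y u a) = g y (D y u z) a + g y z (B y u a)"
      using duality[OF y, of z a u] N_metric[OF y, of z a u] by simp
    ultimately show ?thesis
      using g_sym[OF y, of "N y u z" a] g_sym[OF y, of z "N y u a"]
        g_sym[OF y, of "D y u z" a] g_sym[OF y, of z "B y u a"]
      unfolding P_def by (simp add: linear_add[OF lin(1)] linear_add[OF lin(2)] linear_diff[OF lin(1)] linear_diff[OF lin(2)]
          linear_cmul[OF lin(1)] linear_cmul[OF lin(2)])
  qed
  have "g y (P u z) a = - g y (P u a) z" for u z a
    using skew[of u z a] g_sym[OF y, of z "P u a"] by linarith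
  then have "g y (P u z) a = 0" for a
    using P_sym[of u a] P_sym[of a z] P_sym[of z u] by (metis neg_equal_zero)
  from g_nondeg[OF y this] have "P u z = 0" .
  then show ?thesis by (simp add: P_def)
qed

section \<open>Flatness of the Bott connection\<close>

lemma w_J_fam: "bilinear_family Om (\<lambda>y z v. w (io y) (J y z) v)"
proof -
  have "smooth_on Om (\<lambda>y. w (io y) (J y z) v)" for z v
    by (rule bilinear_family_smooth_arg[OF w Om io io_U smooth_J smooth_on_const])
  moreover have "linear (\<lambda>z. w (io y) (J y z) v)" if "y \<in> Om" for y v
    using linear_compose[OF lin_J[OF that] lin_w(2)[OF io_in[OF that]]] by (simp add: o_def)
  ultimately show ?thesis
    using Om lin_w(1)[OF io_in] by (simp add: bilinear_family_def linear_family_def)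
qed

text \<open>Transported by \<open>J\<close> and \<open>w\<close> to sections of the annihilator of the distribution, \<open>B\<close> becomes the
  connection whose covariant derivative of \<open>\<theta>\<close> along \<open>u\<close> is the derivative of \<open>\<theta>\<close> plus \<open>\<theta> (Q _ (s u))\<close>;
  its curvature is a derivative of the Nijenhuis tensor of \<open>K\<close>. In the following formula \<open>y0\<close> marks
  the occurrences of the point that are not differentiated.\<close>

lemma B_second_derivative:
  assumes y: "y \<in> Om" and y0: "y0 = y"
  shows "w (io y) (J y (fderiv (\<lambda>y. B y a z) y u + B y u (B y a z))) v =
    fderiv (\<lambda>y. fderiv (\<lambda>y. w (io y) (J y z) v) y a) y u
    + (fderiv (\<lambda>y. w (io y) (J y z) (Q (io y0) v (s y0 a))) y u
       + fderiv (\<lambda>y. w (io y) (J y z) (Q (io y0) v (s y0 u))) y a)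
    + w (io y) (J y z) (Q2 (io y) (J y u) v (s y a) + Q (io y) v (T y u a) + Q (io y) (Q (io y) v (s y u)) (s y a))"
proof -
  define th where "th = (\<lambda>y z v. w (io y) (J y z) v)"
  have x: "io y \<in> U" by (rule io_in[OF y])
  have id: "((\<lambda>y. y) has_derivative (\<lambda>h. h)) (at y)" by (rule has_derivative_ident)
  have th: "bilinear_family Om th" using w_J_fam by (simp add: th_def)
  have lin: "linear (th y z)" "linear (\<lambda>z. th y z v)" for z v
    using th y by (auto simp: bilinear_family_def linear_family_def)
  have B': "th y (B y u z) v = fderiv (\<lambda>y. th y z v) y u + th y z (Q (io y) v (s y u))" if "y \<in> Om" for y u z v
    using B[OF that] by (simp add: th_def)
  have dB: "((\<lambda>y. B y a z) has_derivative fderiv (\<lambda>y. B y a z) y) (at y)"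
    by (rule smooth_on_has_derivative[OF smooth_B y])
  have dQ: "((\<lambda>y. Q (io y) v (s y a)) has_derivative
      (\<lambda>h. Q2 (io y) (J y h) v (s y a) + Q (io y) v (T y h a))) (at y)"
    using linear_family_has_derivative[of U "\<lambda>x. Q x v", OF _ Om y io_U dio[OF y] ds[OF y]] Q
    by (simp add: Q2_def bilinear_family_def)
  have "((\<lambda>y. th y (B y a z) v) has_derivative (\<lambda>h. fderiv (\<lambda>x. th x (B y a z) v) y h
      + th y (fderiv (\<lambda>y. B y a z) y h) v)) (at y)"
    using bilinear_family_has_derivative[OF th Om y _ id dB has_derivative_const, of v]
    by (simp add: linear_0[OF lin(1)])
  then have 1: "((\<lambda>y. fderiv (\<lambda>y. th y z v) y a + th y z (Q (io y) v (s y a))) has_derivative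
      (\<lambda>h. fderiv (\<lambda>x. th x (B y a z) v) y h + th y (fderiv (\<lambda>y. B y a z) y h) v)) (at y)"
    by (rule has_derivative_transform_within_open[OF _ Om y]) (simp add: B')
  have sm: "smooth_on Om (\<lambda>y. th y z v)" using th by (simp add: bilinear_family_def linear_family_def)
  have "((\<lambda>y. th y z (Q (io y) v (s y a))) has_derivative (\<lambda>h. fderiv (\<lambda>x. th x z (Q (io y) v (s y a))) y h
      + th y z (Q2 (io y) (J y h) v (s y a) + Q (io y) v (T y h a)))) (at y)"
    using linear_family_has_derivative[of Om "\<lambda>y. th y z", OF _ Om y _ id dQ] th
    by (simp add: bilinear_family_def)
  with smooth_on_has_derivative[OF smooth_on_fderiv[OF sm] y, of a]
  have 2: "((\<lambda>y. fderiv (\<lambda>y. th y z v) y a + th y z (Q (io y) v (s y a))) has_derivative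
      (\<lambda>h. fderiv (\<lambda>y. fderiv (\<lambda>y. th y z v) y a) y h + (fderiv (\<lambda>x. th x z (Q (io y) v (s y a))) y h
      + th y z (Q2 (io y) (J y h) v (s y a) + Q (io y) v (T y h a))))) (at y)"
    by (rule has_derivative_add)
  have "fderiv (\<lambda>x. th x (B y a z) v) y u + th y (fderiv (\<lambda>y. B y a z) y u) v =
      fderiv (\<lambda>y. fderiv (\<lambda>y. th y z v) y a) y u + (fderiv (\<lambda>x. th x z (Q (io y) v (s y a))) y u
      + th y z (Q2 (io y) (J y u) v (s y a) + Q (io y) v (T y u a)))"
    using has_derivative_unique[OF 1 2] by metis
  moreover have "th y (B y u (B y a z)) v = fderiv (\<lambda>y'. th y' (B y a z) v) y u + th y (B y a z) (Q (io y) v (s y u))"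
    by (rule B'[OF y])
  moreover have "th y (B y a z) (Q (io y) v (s y u)) =
      fderiv (\<lambda>y'. th y' z (Q (io y) v (s y u))) y a + th y z (Q (io y) (Q (io y) v (s y u)) (s y a))"
    by (rule B'[OF y])
  ultimately have "th y (fderiv (\<lambda>y. B y a z) y u + B y u (B y a z)) v =
    fderiv (\<lambda>y. fderiv (\<lambda>y. th y z v) y a) y u
    + (fderiv (\<lambda>y'. th y' z (Q (io y) v (s y a))) y u + fderiv (\<lambda>y'. th y' z (Q (io y) v (s y u))) y a)
    + th y z (Q2 (io y) (J y u) v (s y a) + Q (io y) v (T y u a) + Q (io y) (Q (io y) v (s y u)) (s y a))"
    by (simp add: linear_add[OF lin(1)] linear_add[OF lin(2)])
  then show ?thesis by (simp only: th_def y0)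
qed

text \<open>Paired with \<open>v\<close>, the curvature becomes \<open>w (J z)\<close> of
  \<open>X u a - X a u\<close>, since all other terms of \<open>B_second_derivative\<close> are
  symmetric in \<open>u\<close>, \<open>a\<close>. The image of \<open>K\<close> is isotropic, so it
  is enough that this vector lies in the range of \<open>K\<close>, which \<open>dNijenhuis\<close>
  gives.\<close>

lemma B_flat:
  assumes y: "y \<in> Om"
  shows "fderiv (\<lambda>y. B y a z) y u - fderiv (\<lambda>y. B y u z) y a + B y u (B y a z) - B y a (B y u z) = 0"
proof (rule w_J_nondeg[OF y])
  fix v
  let ?x = "io y" and ?a = "s y u" and ?b = "s y a"
  have x: "?x \<in> U" by (rule io_in[OF y])
  define X where "X = (\<lambda>u a. Q2 ?x (J y u) v (s y a) + Q ?x v (T y u a) + Q ?x (Q ?x v (s y u)) (s y a))"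
  \<comment> \<open>The difference of the preimages of \<open>J (D u a)\<close> and
    \<open>J (D a u)\<close> found in \<open>D_K\<close>. Hence \<open>K\<close> \<tau> is the
    torsion of \<open>D\<close>, which is zero, and \<tau> lies in the range of
    \<open>K\<close>.\<close>
  define \<tau> where "\<tau> = T y u a - T y a u - Q ?x ?b ?a + Q ?x ?a ?b"
  have "K ?x (T y u a) = H y u a - Q ?x (J y u) (s y a)" for u a
    using H_eq[OF y, of u a] by simp
  then have "K ?x \<tau> = Q ?x (J y a) ?a - Q ?x (J y u) ?b - K ?x (Q ?x ?b ?a) + K ?x (Q ?x ?a ?b)"
    using H_sym[OF y, of u a] by (simp add: \<tau>_def K_diff[OF x] K_add[OF x])
  also have "\<dots> = 0"
    using Nijenhuis[OF x, of ?a ?b] by (simp add: Ks[OF y] algebra_simps)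
  finally obtain c where c: "\<tau> = K ?x c" using ker_K[OF x] by blast
  have "X u a - X a u = Q ?x v \<tau> - K ?x (Q2 ?x v ?b ?a) + K ?x (Q2 ?x v ?a ?b)"
  proof -
    have "Q ?x v \<tau> = Q ?x v (T y u a) - Q ?x v (T y a u) - Q ?x v (Q ?x ?b ?a) + Q ?x v (Q ?x ?a ?b)"
      by (simp add: \<tau>_def linear_add[OF lin_Q(1)[OF x]] linear_diff[OF lin_Q(1)[OF x]])
    moreover have "Q2 ?x (J y u) v ?b = Q2 ?x v (K ?x ?a) ?b" "Q2 ?x (J y a) v ?a = Q2 ?x v (K ?x ?b) ?a"
      using Q2_commute[OF x] by (simp_all add: Ks[OF y])
    ultimately have "X u a - X a u - (Q ?x v \<tau> - K ?x (Q2 ?x v ?b ?a) + K ?x (Q2 ?x v ?a ?b)) =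
      Q2 ?x v (K ?x ?a) ?b + Q ?x (Q ?x v ?a) ?b - Q2 ?x v (K ?x ?b) ?a - Q ?x (Q ?x v ?b) ?a
      + Q ?x v (Q ?x ?b ?a) - Q ?x v (Q ?x ?a ?b) + K ?x (Q2 ?x v ?b ?a) - K ?x (Q2 ?x v ?a ?b)"
      unfolding X_def by simp
    then show ?thesis using dNijenhuis[OF x, of v ?a ?b] by simp
  qed
  also have "\<dots> = K ?x (- Q ?x v c - Q2 ?x v ?b ?a + Q2 ?x v ?a ?b)"
    by (simp add: c Q_K[OF x] K_add[OF x] K_diff[OF x] linear_neg[OF lin_K[OF x]])
  finally have X: "w ?x (J y z) (X u a - X a u) = 0"
    using wKK[OF x] Ks[OF y, of z] by metis
  have lin: "linear (\<lambda>z. w ?x (J y z) v)"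
    using linear_compose[OF lin_J[OF y] lin_w(2)[OF x]] by (simp add: o_def)
  have comm: "fderiv (\<lambda>y. fderiv (\<lambda>y. w (io y) (J y z) v) y a) y u
      = fderiv (\<lambda>y. fderiv (\<lambda>y. w (io y) (J y z) v) y u) y a"
    using w_J_fam by (intro fderiv_commute[OF Om y]) (simp add: bilinear_family_def linear_family_def)
  have "w ?x (J y (fderiv (\<lambda>y. B y a z) y u + B y u (B y a z))) v
      - w ?x (J y (fderiv (\<lambda>y. B y u z) y a + B y a (B y u z))) v = w ?x (J y z) (X u a) - w ?x (J y z) (X a u)"
    using B_second_derivative[OF y refl, of a z u v] B_second_derivative[OF y refl, of u z a v] comm
    unfolding X_def by simp
  also have "\<dots> = 0" using X by (simp add: linear_diff[OF lin_w(1)[OF x]])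
  finally show "w ?x (J y (fderiv (\<lambda>y. B y a z) y u - fderiv (\<lambda>y. B y u z) y a
      + B y u (B y a z) - B y a (B y u z))) v = 0"
    by (simp add: linear_add[OF lin] linear_diff[OF lin])
qed

section \<open>The determinant of the metric in affine coordinates of \<open>B\<close>\<close>

lemma dg_of_B_zero:
  assumes y: "y \<in> Om" and B0: "\<And>u z. B y u z = 0"
  shows "fderiv (\<lambda>y. g y a z) y u = g y (D y u a) z"
proof -
  have "linear (g y a)" using g_fam y by (auto simp: bilinear_family_def linear_family_def)
  then show ?thesis using duality[OF y, of a z u] by (simp add: B0 linear_0)
qed

lemma expand3: "v = v $ 1 *\<^sub>R axis 1 1 + v $ 2 *\<^sub>R axis 2 1 + v $ 3 *\<^sub>R axis 3 (1::real)" for v :: "real ^ 3"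
  by (simp add: vec_eq_iff forall_3 axis_def)

lemma q_repeat: "x \<in> U \<Longrightarrow> q x a a c = 0" "x \<in> U \<Longrightarrow> q x a b a = 0" "x \<in> U \<Longrightarrow> q x a b b = 0"
  using q_alt(1)[of x a a c] q_alt(2)[of x a b b] q_alt(1)[of x a b a] q_alt(2)[of x b a a] by auto

text \<open>Both volume forms on the leaf are parallel: the one given by \<open>F\<close> for \<open>D\<close>, the one of \<open>g\<close> for the
  Levi-Civita connection. As they are proportional, \<open>det g\<close> has derivative \<open>tr D\<close> times itself and
  also twice this value.\<close>

lemma det_g_stationary:
  assumes y: "y \<in> Om" and B0: "\<And>u z. B y u z = 0"
  shows "fderiv (\<lambda>y. det (\<chi> i j. g y (axis i 1) (axis j 1))) y u = 0"
proof -
  define e :: "3 \<Rightarrow> real ^ 3" where "e = (\<lambda>i. axis i 1)"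
  define G where "G = (\<lambda>y i j. g y (e i) (e j))"
  define m where "m = (\<lambda>i j. D y u (e i) $ j)"
  define V where "V = (\<lambda>y. q (io y) (s y (e 1)) (s y (e 2)) (s y (e 3)))"
  define F where "F = (\<lambda>y. G y 1 1 * (G y 2 2 * G y 3 3 - G y 2 3 * G y 3 2)
    - G y 1 2 * (G y 2 1 * G y 3 3 - G y 2 3 * G y 3 1)
    + G y 1 3 * (G y 2 1 * G y 3 2 - G y 2 2 * G y 3 1))"
  define G' where "G' = (\<lambda>i j. fderiv (\<lambda>y. G y i j) y u)"
  have x: "io y \<in> U" by (rule io_in[OF y])
  have det_F: "det (\<chi> i j. g y (axis i 1) (axis j 1)) = F y" for y
    unfolding det_3 F_def G_def e_def by simp algebra
  have D_exp: "D y u (e i) = m i 1 *\<^sub>R e 1 + m i 2 *\<^sub>R e 2 + m i 3 *\<^sub>R e 3" for i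
    unfolding m_def e_def by (rule expand3)
  have lin_g: "linear (\<lambda>a. g y a b)" for b
    using g_fam y by (auto simp: bilinear_family_def linear_family_def)
  have G'_eq: "G' i j = m i 1 * G y 1 j + m i 2 * G y 2 j + m i 3 * G y 3 j" for i j
    unfolding G'_def G_def dg_of_B_zero[OF y B0] D_exp
    by (simp add: linear_add[OF lin_g] linear_cmul[OF lin_g])
  have dG: "((\<lambda>y. G y i j) has_derivative fderiv (\<lambda>y. G y i j) y) (at y)" for i j
    unfolding G_def using g_fam y
    by (intro smooth_on_has_derivative[of Om]) (auto simp: bilinear_family_def linear_family_def)
  define d where "d = (\<lambda>i j. fderiv (\<lambda>y. G y i j) y)"
  have "(F has_derivative (\<lambda>h. (G y 1 1 * ((G y 2 2 * d 3 3 h + d 2 2 h * G y 3 3) - (G y 2 3 * d 3 2 h + d 2 3 h * G y 3 2)) + d 1 1 h * (G y 2 2 * G y 3 3 - G y 2 3 * G y 3 2))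
      - (G y 1 2 * ((G y 2 1 * d 3 3 h + d 2 1 h * G y 3 3) - (G y 2 3 * d 3 1 h + d 2 3 h * G y 3 1)) + d 1 2 h * (G y 2 1 * G y 3 3 - G y 2 3 * G y 3 1))
      + (G y 1 3 * ((G y 2 1 * d 3 2 h + d 2 1 h * G y 3 2) - (G y 2 2 * d 3 1 h + d 2 2 h * G y 3 1)) + d 1 3 h * (G y 2 1 * G y 3 2 - G y 2 2 * G y 3 1)))) (at y)"
    unfolding F_def d_def by (intro has_derivative_add has_derivative_diff has_derivative_mult dG)
  from fderiv_eqI[OF this] have "fderiv F y u = (G y 1 1 * ((G y 2 2 * G' 3 3 + G' 2 2 * G y 3 3) - (G y 2 3 * G' 3 2 + G' 2 3 * G y 3 2)) + G' 1 1 * (G y 2 2 * G y 3 3 - G y 2 3 * G y 3 2))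
      - (G y 1 2 * ((G y 2 1 * G' 3 3 + G' 2 1 * G y 3 3) - (G y 2 3 * G' 3 1 + G' 2 3 * G y 3 1)) + G' 1 2 * (G y 2 1 * G y 3 3 - G y 2 3 * G y 3 1))
      + (G y 1 3 * ((G y 2 1 * G' 3 2 + G' 2 1 * G y 3 2) - (G y 2 2 * G' 3 1 + G' 2 2 * G y 3 1)) + G' 1 3 * (G y 2 1 * G y 3 2 - G y 2 2 * G y 3 1))"
    by (simp only: G'_def d_def)
  then have 1: "fderiv F y u = (m 1 1 + m 2 2 + m 3 3) * F y"
    unfolding G'_eq F_def by algebra
  have F_V: "F y = 2 * (V y)\<^sup>2" if "y \<in> Om" for y
    using det_g[OF that, of "e 1" "e 2" "e 3"] by (simp add: F_def G_def V_def)
  have sD: "K (io y) (T y u a - Q (io y) (s y a) (s y u)) = K (io y) (s y (D y u a))" for a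
    using D_K[OF y, of u a] Ks[OF y] by simp
  \<comment> \<open>\<open>q\<close> descends to the quotient by ker K in each argument, so the
    preimage of \<open>J (D u a)\<close> from \<open>D_K\<close> may be replaced by
    \<open>s (D u a)\<close>.\<close>
  have q1: "q (io y) (T y u a - Q (io y) (s y a) (s y u)) b c = q (io y) (s y (D y u a)) b c" for a b c
    by (rule q_cong[OF x sD])
  have q2: "q (io y) b (T y u a - Q (io y) (s y a) (s y u)) c = q (io y) b (s y (D y u a)) c" for a b c
    using q1[of a b c] q_alt(1)[OF x, of b _ c] by metis
  have q3: "q (io y) b c (T y u a - Q (io y) (s y a) (s y u)) = q (io y) b c (s y (D y u a))" for a b c
    using q2[of b a c] q_alt(2)[OF x, of b c] by metis
  have "(V has_derivative (\<lambda>h. fderiv (\<lambda>x. q x (s y (e 1)) (s y (e 2)) (s y (e 3))) (io y) (J y h)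
      + q (io y) (s y (e 1)) (s y (e 2)) (T y h (e 3)) + q (io y) (s y (e 1)) (T y h (e 2)) (s y (e 3))
      + q (io y) (T y h (e 1)) (s y (e 2)) (s y (e 3)))) (at y)"
    unfolding V_def
    by (rule trilinear_family_has_derivative[OF q Om y io_U dio[OF y] ds[OF y] ds[OF y] ds[OF y]])
  note dV = this
  \<comment> \<open>\<open>J u\<close> = K (s u), so invariance of \<open>F\<close> expresses the
    derivative of \<open>q\<close> by three \<open>Q\<close> terms. They correct each
    \<open>T\<close> to a preimage of the corresponding \<open>D\<close> derivative: the volume
    \<open>V\<close> is parallel for \<open>D\<close>.\<close>
  have "fderiv V y u = q (io y) (s y (e 1)) (s y (e 2)) (T y u (e 3) - Q (io y) (s y (e 3)) (s y u))
      + q (io y) (s y (e 1)) (T y u (e 2) - Q (io y) (s y (e 2)) (s y u)) (s y (e 3))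
      + q (io y) (T y u (e 1) - Q (io y) (s y (e 1)) (s y u)) (s y (e 2)) (s y (e 3))"
    using fderiv_eqI[OF dV] dq_along_K[OF x, of "s y (e 1)" "s y (e 2)" "s y (e 3)" "s y u"]
    by (simp add: Ks[OF y] linear_diff[OF lin_q(1)[OF x]] linear_diff[OF lin_q(2)[OF x]] linear_diff[OF lin_q(3)[OF x]])
  also have "\<dots> = (m 1 1 + m 2 2 + m 3 3) * V y"
    unfolding q1 q2 q3 D_exp V_def
    by (simp add: linear_add[OF lin_s[OF y]] linear_cmul[OF lin_s[OF y]]
        linear_add[OF lin_q(1)[OF x]] linear_add[OF lin_q(2)[OF x]] linear_add[OF lin_q(3)[OF x]]
        linear_cmul[OF lin_q(1)[OF x]] linear_cmul[OF lin_q(2)[OF x]] linear_cmul[OF lin_q(3)[OF x]]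
        q_repeat[OF x] algebra_simps)
  finally have 2: "fderiv V y u = (m 1 1 + m 2 2 + m 3 3) * V y" .
  have "((\<lambda>y. 2 * (V y)\<^sup>2) has_derivative (\<lambda>h. 2 * (2 * V y * fderiv V y h))) (at y)"
    using dV fderiv_eqI[OF dV] by (auto intro!: derivative_eq_intros simp: power2_eq_square)
  then have "(F has_derivative (\<lambda>h. 2 * (2 * V y * fderiv V y h))) (at y)"
    by (rule has_derivative_transform_within_open[OF _ Om y]) (simp add: F_V)
  from fderiv_eqI[OF this] have "fderiv F y u = 2 * ((m 1 1 + m 2 2 + m 3 3) * F y)"
    using F_V[OF y] 2 by (simp add: power2_eq_square)
  with 1 have "fderiv F y u = 0" by simp
  then show ?thesis by (simp only: det_F)
qed

end

section \<open>Charts and vector fields\<close>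

lemma chart_inv_into: "is_chart T c \<Longrightarrow> p \<in> fst c \<Longrightarrow> inv_into (fst c) (snd c) (snd c p) = p"
proof -
  assume c: "is_chart T c" and p: "p \<in> fst c"
  then have "inj_on (snd c) (topspace (subtopology T (fst c)))"
    unfolding is_chart_def by (blast intro: homeomorphic_imp_injective_map)
  moreover have "topspace (subtopology T (fst c)) = fst c"
    using c openin_subset[of T "fst c"] by (auto simp: is_chart_def)
  ultimately show ?thesis using p by simp
qed

lemma trans_map_at: "is_chart T c \<Longrightarrow> p \<in> fst c \<Longrightarrow> trans_map c c' (snd c p) = snd c' p"
  by (simp add: trans_map_def chart_inv_into)

lemma chart_open_image:
  assumes "is_chart T c" "openin T W" shows "open (snd c ` (fst c \<inter> W))"
proof -
  have "openin (subtopology T (fst c)) (fst c \<inter> W)"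
    using assms by (auto simp: is_chart_def openin_subtopology_Int2)
  then have "openin (top_of_set (img c)) (snd c ` (fst c \<inter> W))"
    using assms(1) homeomorphic_imp_open_map unfolding is_chart_def open_map_def by blast
  then show ?thesis
    using assms(1) openin_open_trans unfolding is_chart_def by blast
qed

text \<open>The charts may belong to manifolds of different dimensions. The same chain rule
  therefore covers changes of leaf charts, changes of ambient charts and the inclusion of a
  leaf.\<close>

lemma trans_map_chain:
  assumes b: "is_chart T1 b" and c: "is_chart T2 c" and P: "open (snd b ` P)" "P \<subseteq> fst b \<inter> fst c" "p \<in> P"
    and "trans_map b c differentiable (at (snd b p))" "trans_map c d differentiable (at (snd c p))"
  shows "(trans_map b d has_derivative (\<lambda>u. fderiv (trans_map c d) (snd c p) (fderiv (trans_map b c) (snd b p) u))) (at (snd b p))"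
proof -
  have "p \<in> fst b" using P by blast
  then have "snd c p = trans_map b c (snd b p)" using trans_map_at[OF b, of p c] by simp
  then have "((trans_map c d \<circ> trans_map b c) has_derivative
      (fderiv (trans_map c d) (snd c p) \<circ> fderiv (trans_map b c) (snd b p))) (at (snd b p))"
    using assms(6,7) by (intro diff_chain_at) (auto intro: has_derivative_fderiv)
  then show ?thesis
    unfolding o_def
  proof (rule has_derivative_transform_within_open[OF _ P(1)])
    fix x assume "x \<in> snd b ` P"
    then obtain r where "x = snd b r" "r \<in> fst b" "r \<in> fst c" using P(2) by blast
    then show "trans_map c d (trans_map b c x) = trans_map b d x"
      by (simp add: trans_map_at[OF b] trans_map_at[OF c])
  qed (use P in simp)
qed

lemma vector_field_smooth: "vector_field A W X \<Longrightarrow> c \<in> A \<Longrightarrow> smooth_on (snd c ` (fst c \<inter> W)) (X c)"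
  unfolding vector_field_def by blast

lemma vector_field_transform:
  "vector_field A W X \<Longrightarrow> c \<in> A \<Longrightarrow> c' \<in> A \<Longrightarrow> p \<in> fst c \<Longrightarrow> p \<in> fst c' \<Longrightarrow> p \<in> W \<Longrightarrow>
    X c' (snd c' p) = fderiv (trans_map c c') (snd c p) (X c (snd c p))"
  unfolding vector_field_def by blast

locale manifold =
  fixes T :: "'a topology" and A :: "('a, 'n::finite) chart set"
  assumes manifold: "smooth_manifold T A"
begin

lemma chart: "c \<in> A \<Longrightarrow> is_chart T c"
  using manifold unfolding smooth_manifold_def by blast

lemma chart_open: "c \<in> A \<Longrightarrow> openin T (fst c)" "c \<in> A \<Longrightarrow> open (img c)"
  using chart by (auto simp: is_chart_def)

lemma covered: "p \<in> topspace T \<Longrightarrow> \<exists>c\<in>A. p \<in> fst c"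
  using manifold unfolding smooth_manifold_def by blast

lemma in_topspace: "c \<in> A \<Longrightarrow> p \<in> fst c \<Longrightarrow> p \<in> topspace T"
  using openin_subset[OF chart_open(1)] by blast

lemma in_img: "p \<in> fst c \<Longrightarrow> snd c p \<in> img c" by (simp add: img_def)

lemma trans_map_smooth: "c \<in> A \<Longrightarrow> c' \<in> A \<Longrightarrow> smooth_on (snd c ` (fst c \<inter> fst c')) (trans_map c c')"
  using manifold unfolding smooth_manifold_def compatible_def by blast

end

text \<open>Contains only the smoothness of the inclusion; injectivity and the image of its
  differential are imposed in \<open>leaf_manifold\<close>. The leaf topology may be finer than the
  subspace topology, so openness of chart overlaps comes from \<open>cont\<close>.\<close>

locale immersion = L: manifold TL AL + M: manifold T A
  for TL :: "'a topology" and AL :: "('a, 'm::finite) chart set"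
    and T :: "'a topology" and A :: "('a, 'n::finite) chart set" +
  assumes cont: "continuous_map TL T id"
    and smooth: "b \<in> AL \<Longrightarrow> c \<in> A \<Longrightarrow> smooth_on (snd b ` (fst b \<inter> fst c)) (trans_map b c)"
begin

lemma openin_leaf: "openin T W \<Longrightarrow> openin TL (W \<inter> topspace TL)"
proof -
  assume "openin T W"
  then have "openin TL {p \<in> topspace TL. id p \<in> W}" by (rule openin_continuous_map_preimage[OF cont])
  moreover have "{p \<in> topspace TL. id p \<in> W} = W \<inter> topspace TL" by auto
  ultimately show ?thesis by simp
qed

lemma open_overlap:
  assumes "b \<in> AL" "openin T W" shows "open (snd b ` (fst b \<inter> W))"
proof -
  have "fst b \<inter> W = fst b \<inter> (W \<inter> topspace TL)" using L.in_topspace[OF assms(1)] by blast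
  then show ?thesis using chart_open_image[OF L.chart[OF assms(1)] openin_leaf[OF assms(2)]] by simp
qed

lemma differentiable: "b \<in> AL \<Longrightarrow> c \<in> A \<Longrightarrow> p \<in> fst b \<Longrightarrow> p \<in> fst c \<Longrightarrow> trans_map b c differentiable (at (snd b p))"
  by (rule smooth_on_differentiable[OF smooth]) auto

lemma linear: "b \<in> AL \<Longrightarrow> c \<in> A \<Longrightarrow> p \<in> fst b \<Longrightarrow> p \<in> fst c \<Longrightarrow> linear (fderiv (trans_map b c) (snd b p))"
  by (rule linear_frechet_derivative[OF differentiable])

lemma chain_right:
  assumes "b \<in> AL" "c \<in> A" "c' \<in> A" "p \<in> fst b" "p \<in> fst c" "p \<in> fst c'"
  shows "fderiv (trans_map b c') (snd b p) u = fderiv (trans_map c c') (snd c p) (fderiv (trans_map b c) (snd b p) u)"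
proof -
  have "trans_map c c' differentiable (at (snd c p))"
    using assms by (intro smooth_on_differentiable[OF M.trans_map_smooth]) auto
  from fderiv_eqI[OF trans_map_chain[OF L.chart[OF assms(1)] M.chart[OF assms(2)]
      open_overlap[OF assms(1) M.chart_open(1)[OF assms(2)]] order_refl IntI[OF assms(4,5)]
      differentiable[OF assms(1,2,4,5)] this]]
  show ?thesis by (rule fun_cong)
qed

lemma chain_left:
  assumes "b \<in> AL" "b' \<in> AL" "c \<in> A" "p \<in> fst b" "p \<in> fst b'" "p \<in> fst c"
  shows "fderiv (trans_map b c) (snd b p) u = fderiv (trans_map b' c) (snd b' p) (fderiv (trans_map b b') (snd b p) u)"
proof -
  have "trans_map b b' differentiable (at (snd b p))"
    using assms by (intro smooth_on_differentiable[OF L.trans_map_smooth]) auto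
  from fderiv_eqI[OF trans_map_chain[OF L.chart[OF assms(1)] L.chart[OF assms(2)]
      chart_open_image[OF L.chart[OF assms(1)] L.chart_open(1)[OF assms(2)]] order_refl IntI[OF assms(4,5)]
      this differentiable[OF assms(2,3,5,6)]]]
  show ?thesis by (rule fun_cong)
qed

end

context manifold begin

text \<open>A manifold is included in itself by the identity, so the results on inclusions also
  serve for changes of charts.\<close>

sublocale self: immersion T A T A
  by unfold_locales (auto intro: trans_map_smooth)

lemma fderiv_trans_map_refl:
  assumes "c \<in> A" "p \<in> fst c" shows "fderiv (trans_map c c) (snd c p) u = u"
proof -
  have "fderiv (trans_map c c) (snd c p) = fderiv (\<lambda>x. x) (snd c p)"
    by (rule fderiv_cong_open[OF chart_open(2)[OF assms(1)] in_img[OF assms(2)]])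
      (auto simp: img_def trans_map_at[OF chart[OF assms(1)]])
  then show ?thesis by simp
qed

lemma fderiv_trans_map_inverse:
  assumes "c \<in> A" "c' \<in> A" "p \<in> fst c" "p \<in> fst c'"
  shows "fderiv (trans_map c' c) (snd c' p) (fderiv (trans_map c c') (snd c p) u) = u"
  using self.chain_right[of c c' c p u] assms fderiv_trans_map_refl by simp

text \<open>A vector field must have components in all charts at once; this is the field over
  \<open>fst c\<close> whose components in \<open>c\<close> are \<open>f\<close>.\<close>

definition lift :: "('a, 'n) chart \<Rightarrow> (real ^ 'n \<Rightarrow> real ^ 'n) \<Rightarrow> ('a, 'n) vfield" where
  "lift c f = (\<lambda>c' x. fderiv (trans_map c c') (trans_map c' c x) (f (trans_map c' c x)))"

lemma lift_at: "c' \<in> A \<Longrightarrow> p \<in> fst c' \<Longrightarrow> lift c f c' (snd c' p) = fderiv (trans_map c c') (snd c p) (f (snd c p))"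
  by (simp add: lift_def trans_map_at[OF chart])

lemma lift_self: "c \<in> A \<Longrightarrow> x \<in> img c \<Longrightarrow> lift c f c x = f x"
  by (auto simp: img_def lift_at fderiv_trans_map_refl)

lemma fderiv_lift_self: "c \<in> A \<Longrightarrow> x \<in> img c \<Longrightarrow> fderiv (lift c f c) x = fderiv f x"
  by (rule fderiv_cong_open[OF chart_open(2)]) (auto simp: lift_self)

lemma open_overlap2: "c \<in> A \<Longrightarrow> c' \<in> A \<Longrightarrow> open (snd c ` (fst c \<inter> fst c'))"
  by (rule self.open_overlap[OF _ chart_open(1)])

lemma vector_field_lift:
  assumes c: "c \<in> A" and f: "smooth_on (img c) f"
  shows "vector_field A (fst c) (lift c f)"
  unfolding vector_field_def
proof (intro conjI ballI)
  fix c' assume c': "c' \<in> A"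
  let ?S = "snd c' ` (fst c' \<inter> fst c)" and ?U = "snd c ` (fst c \<inter> fst c')"
  note S = open_overlap2[OF c' c] and U = open_overlap2[OF c c']
  have j: "smooth_on ?S (trans_map c' c)" by (rule trans_map_smooth[OF c' c])
  have jS: "trans_map c' c ` ?S \<subseteq> ?U"
  proof (rule image_subsetI)
    fix x assume "x \<in> ?S"
    then obtain p where "x = snd c' p" "p \<in> fst c'" "p \<in> fst c" by blast
    then show "trans_map c' c x \<in> ?U" using trans_map_at[OF chart[OF c'], of p c] by simp
  qed
  have "linear_family ?U (fderiv (trans_map c c'))"
    unfolding linear_family_def
    using U smooth_on_linear_fderiv[OF trans_map_smooth[OF c c']] smooth_on_fderiv[OF trans_map_smooth[OF c c']]
    by blast
  moreover have "smooth_on ?S (\<lambda>x. f (trans_map c' c x))"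
    using jS unfolding img_def
    by (intro smooth_on_compose[OF S chart_open(2)[OF c, unfolded img_def] _ j f[unfolded img_def]]) blast
  ultimately show "smooth_on ?S (lift c f c')"
    unfolding lift_def
    by (rule linear_family_smooth_arg[where f = "fderiv (trans_map c c')"
          and a = "\<lambda>x. f (trans_map c' c x)", OF _ S j jS])
next
  fix c1 c2 p assume c12: "c1 \<in> A" "c2 \<in> A" and p: "p \<in> fst c1 \<inter> fst c2 \<inter> fst c"
  have "lift c f c2 (snd c2 p) = fderiv (trans_map c c2) (snd c p) (f (snd c p))"
    "lift c f c1 (snd c1 p) = fderiv (trans_map c c1) (snd c p) (f (snd c p))"
    by (rule lift_at; use p c12 in blast)+
  then show "lift c f c2 (snd c2 p) = fderiv (trans_map c1 c2) (snd c1 p) (lift c f c1 (snd c1 p))"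
    using self.chain_right[OF c c12, of p "f (snd c p)"] p by simp
qed

text \<open>The transformed derivative of each field acquires a second derivative of the transition
  map, and by symmetry these terms cancel in the bracket.\<close>

lemma lie_bracket_natural:
  assumes "vector_field A W X" "vector_field A W Y" "openin T W" "c \<in> A" "c' \<in> A"
    and p: "p \<in> fst c" "p \<in> fst c'" "p \<in> W"
  shows "lie_bracket X Y c' (snd c' p) = fderiv (trans_map c c') (snd c p) (lie_bracket X Y c (snd c p))"
proof -
  define f where "f = trans_map c c'"
  define S where "S = snd c ` (fst c \<inter> (fst c' \<inter> W))"
  have S: "open S"
    unfolding S_def by (intro self.open_overlap openin_Int chart_open(1) assms)
  have x: "snd c p \<in> S" using p unfolding S_def by blast
  have fx: "f (snd c p) = snd c' p"
    unfolding f_def by (rule trans_map_at[OF chart[OF \<open>c \<in> A\<close>] p(1)])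
  have f: "smooth_on S f"
    unfolding f_def S_def by (rule smooth_on_subset[OF trans_map_smooth[OF assms(4,5)]]) blast
  have df: "(f has_derivative fderiv f (snd c p)) (at (snd c p))" by (rule smooth_on_has_derivative[OF f x])
  have fam: "linear_family S (fderiv f)"
    unfolding linear_family_def using S smooth_on_linear_fderiv[OF f] smooth_on_fderiv[OF f] by blast
  have main: "fderiv (X c') (snd c' p) (fderiv f (snd c p) a) =
      fderiv (\<lambda>x. fderiv f x (X c (snd c p))) (snd c p) a + fderiv f (snd c p) (fderiv (X c) (snd c p) a)"
    if X: "vector_field A W X" for X a
  proof -
    have dX: "(X c has_derivative fderiv (X c) (snd c p)) (at (snd c p))"
      using p by (intro smooth_on_has_derivative[OF vector_field_smooth[OF X assms(4)]]) blast
    have dX': "(X c' has_derivative fderiv (X c') (snd c' p)) (at (f (snd c p)))"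
      unfolding fx using p by (intro smooth_on_has_derivative[OF vector_field_smooth[OF X assms(5)]]) blast
    have 1: "((\<lambda>x. X c' (f x)) has_derivative (\<lambda>a. fderiv (X c') (snd c' p) (fderiv f (snd c p) a))) (at (snd c p))"
      using diff_chain_at[OF df dX'] by (simp add: o_def)
    have "((\<lambda>x. fderiv f x (X c x)) has_derivative (\<lambda>a. fderiv (\<lambda>x. fderiv f x (X c (snd c p))) (snd c p) a
        + fderiv f (snd c p) (fderiv (X c) (snd c p) a))) (at (snd c p))"
      using linear_family_has_derivative[OF fam S x _ has_derivative_ident dX] by simp
    then have 2: "((\<lambda>x. X c' (f x)) has_derivative (\<lambda>a. fderiv (\<lambda>x. fderiv f x (X c (snd c p))) (snd c p) a
        + fderiv f (snd c p) (fderiv (X c) (snd c p) a))) (at (snd c p))"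
    proof (rule has_derivative_transform_within_open[OF _ S x])
      fix x assume "x \<in> S"
      then obtain r where r: "r \<in> fst c" "r \<in> fst c'" "r \<in> W" "x = snd c r" unfolding S_def by blast
      then have "X c' (snd c' r) = fderiv f x (X c x)"
        using vector_field_transform[OF X assms(4,5) r(1-3)] by (simp only: f_def)
      moreover have "f x = snd c' r"
        using trans_map_at[OF chart[OF \<open>c \<in> A\<close>] r(1), of c'] r(4) by (simp only: f_def)
      ultimately show "fderiv f x (X c x) = X c' (f x)" by simp
    qed
    from has_derivative_unique[OF 1 2] show ?thesis by metis
  qed
  have nat: "X c' (snd c' p) = fderiv f (snd c p) (X c (snd c p))" if "vector_field A W X" for X
    unfolding f_def by (rule vector_field_transform[OF that assms(4,5) p])
  have "fderiv (\<lambda>x. fderiv f x (X c (snd c p))) (snd c p) (Y c (snd c p))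
      = fderiv (\<lambda>x. fderiv f x (Y c (snd c p))) (snd c p) (X c (snd c p))"
    by (rule fderiv_commute[OF S x f])
  then show ?thesis
    unfolding f_def[symmetric] lie_bracket_def nat[OF assms(1)] nat[OF assms(2)] main[OF assms(1)] main[OF assms(2)]
    by (simp add: linear_diff[OF has_derivative_linear[OF df]])
qed

end

section \<open>Transport and smoothness of wedge products, exterior derivatives in low
  degree\<close>

lemma wedge_transfer:
  assumes "\<And>us. length us = k \<Longrightarrow> \<alpha> us = \<alpha>' (map F us)"
    and "\<And>us. k + length us = length vs \<Longrightarrow> \<beta> us = \<beta>' (map F us)"
  shows "wedge k \<alpha> \<beta> vs = wedge k \<alpha>' \<beta>' (map F vs)"
  unfolding wedge_map using assms by (rule wedge_cong)

lemma smooth_on_wedge: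
  assumes S: "open S" and "\<And>us. length us = k \<Longrightarrow> smooth_on S (\<lambda>x. \<alpha> x us)"
    and "\<And>us. k + length us = length vs \<Longrightarrow> smooth_on S (\<lambda>x. \<beta> x us)"
  shows "smooth_on S (\<lambda>x. wedge k (\<alpha> x) (\<beta> x) vs)"
  unfolding wedge_def
proof (rule smooth_on_sum[OF S])
  fix I assume I: "I \<in> {I. I \<subseteq> {..<length vs} \<and> card I = k}"
  then have "card I \<le> length vs" using card_mono[of "{..<length vs}" I] by simp
  with I have "smooth_on S (\<lambda>x. \<alpha> x (nths vs I))" "smooth_on S (\<lambda>x. \<beta> x (nths vs (- I)))"
    using assms(2,3) by (auto simp: length_nths_subset length_nths_Compl)
  then show "smooth_on S (\<lambda>x. (-1) ^ card {(i, j). i \<in> I \<and> j \<in> {..<length vs} - I \<and> j < i}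
      * \<alpha> x (nths vs I) * \<beta> x (nths vs (- I)))"
    using smooth_on_const[of S "(-1 :: real) ^ card {(i, j). i \<in> I \<and> j \<in> {..<length vs} - I \<and> j < i}"]
    by (intro smooth_on_mult S)
qed

lemma ext_deriv_2: "ext_deriv \<alpha> c x [a, b, d] = fderiv (\<lambda>y. \<alpha> c y [b, d]) x a
    - fderiv (\<lambda>y. \<alpha> c y [a, d]) x b + fderiv (\<lambda>y. \<alpha> c y [a, b]) x d"
  by (simp add: ext_deriv_def lessThan_Suc nths_Cons)

lemma ext_deriv_3: "ext_deriv \<alpha> c x [a, b, d, e] = fderiv (\<lambda>y. \<alpha> c y [b, d, e]) x a
    - fderiv (\<lambda>y. \<alpha> c y [a, d, e]) x b + fderiv (\<lambda>y. \<alpha> c y [a, b, e]) x d - fderiv (\<lambda>y. \<alpha> c y [a, b, d]) x e"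
  by (simp add: ext_deriv_def lessThan_Suc nths_Cons)

section \<open>Partial connections on the distribution\<close>

lemma mform_2_pair:
  assumes "mform 2 \<alpha>"
  shows "linear (\<lambda>a. \<alpha> [a, b])" "linear (\<lambda>b. \<alpha> [a, b])" "\<alpha> [a, b] = - \<alpha> [b, a]"
proof -
  have m: "mform (Suc (Suc 0)) \<alpha>" using assms by (simp only: numeral_2_eq_2)
  show "linear (\<lambda>a. \<alpha> [a, b])" using mform_imp_linear[OF m, of "[b]"] by simp
  have "mform (Suc 0) (interior_product a \<alpha>)" using m by simp
  from mform_imp_linear[OF this, of "[]"] show "linear (\<lambda>b. \<alpha> [a, b])" by (simp add: interior_product_def)
  show "\<alpha> [a, b] = - \<alpha> [b, a]" by (rule mform_swap[OF m]) simp
qed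

lemma mform_3_triple:
  assumes "mform 3 \<alpha>"
  shows "linear (\<lambda>a. \<alpha> [a, b, c])" "linear (\<lambda>b. \<alpha> [a, b, c])" "linear (\<lambda>c. \<alpha> [a, b, c])"
    "\<alpha> [a, b, c] = - \<alpha> [b, a, c]" "\<alpha> [a, b, c] = - \<alpha> [a, c, b]"
proof -
  have m: "mform (Suc (Suc (Suc 0))) \<alpha>" using assms by (simp only: numeral_3_eq_3)
  have "mform 2 (interior_product a \<alpha>)" using m by (simp add: numeral_2_eq_2)
  note m2 = mform_2_pair[OF this, unfolded interior_product_def]
  show "linear (\<lambda>a. \<alpha> [a, b, c])" using mform_imp_linear[OF m, of "[b, c]"] by simp
  show "linear (\<lambda>b. \<alpha> [a, b, c])" "linear (\<lambda>c. \<alpha> [a, b, c])" "\<alpha> [a, b, c] = - \<alpha> [a, c, b]"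
    by (rule m2)+
  show "\<alpha> [a, b, c] = - \<alpha> [b, a, c]" by (rule mform_swap[OF m]) simp
qed

context ambient_patch begin

lemma w_represents:
  assumes x: "x \<in> U" and \<beta>: "linear \<beta>" obtains z where "\<And>v. w x z v = \<beta> v"
proof -
  define L where "L = (\<lambda>a. \<chi> i. w x a (axis i 1))"
  have lin: "linear L"
    by (rule linearI) (simp_all add: L_def vec_eq_iff linear_add[OF lin_w(2)[OF x]] linear_cmul[OF lin_w(2)[OF x]])
  have expand: "\<gamma> v = (\<Sum>i\<in>UNIV. v $ i * \<gamma> (axis i 1))" if "linear \<gamma>" for \<gamma> :: "real ^ 6 \<Rightarrow> real" and v
  proof -
    have "\<gamma> v = \<gamma> (\<Sum>i\<in>UNIV. v $ i *\<^sub>R axis i 1)"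
      using basis_expansion[of v] by (simp add: scalar_mult_eq_scaleR)
    then show ?thesis by (simp add: linear_sum[OF that] linear_cmul[OF that])
  qed
  have w_expand: "w x a v = (\<Sum>i\<in>UNIV. v $ i * w x a (axis i 1))" for a v
    by (rule expand[OF lin_w(1)[OF x]])
  have "inj L"
    unfolding linear_injective_0[OF lin]
  proof (intro allI impI)
    fix a assume "L a = 0"
    then have "w x a (axis i 1) = 0" for i by (simp add: L_def vec_eq_iff)
    then have "w x a v = 0" for v using w_expand[of a v] by simp
    then show "a = 0" by (rule w_nondeg[OF x])
  qed
  then have "surj L" using linear_injective_imp_surjective[OF lin] by simp
  then obtain z where "L z = (\<chi> i. \<beta> (axis i 1))" by (metis surjD)
  then have "w x z (axis i 1) = \<beta> (axis i 1)" for i by (simp add: L_def vec_eq_iff)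
  then have "w x z v = \<beta> v" for v
    using w_expand[of z v] expand[OF \<beta>, of v] by simp
  then show ?thesis using that by blast
qed

text \<open>The right side of the Bott formula for X = K a, Y = K d and the constant field
  \<open>v\<close>: the bracket of \<open>K a\<close> with \<open>v\<close> is -
  \<open>Q x v a\<close>, and skewness of \<open>w\<close> absorbs the sign.\<close>

definition bott :: "real ^ 6 \<Rightarrow> real ^ 6 \<Rightarrow> real ^ 6 \<Rightarrow> real ^ 6 \<Rightarrow> real" where
  "bott a d x v = fderiv (\<lambda>y. w y (K y d) v) x (K x a) + w x (K x d) (Q x v a)"

lemma smooth_K: "smooth_on U (\<lambda>x. K x a)"
  using K unfolding linear_family_def by blast

lemma wK_fam: "linear_family U (\<lambda>y. w y (K y d))"
  unfolding linear_family_def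
proof (intro conjI ballI allI U)
  show "linear (w x (K x d))" if "x \<in> U" for x by (rule lin_w(1)[OF that])
  show "smooth_on U (\<lambda>x. w x (K x d) v)" for v
    by (rule bilinear_family_smooth_arg[OF w U smooth_on_ident[OF U] _ smooth_K smooth_on_const]) simp
qed

lemma bott_fam: "linear_family U (bott a d)"
  unfolding linear_family_def
proof (intro conjI ballI allI U)
  fix x assume x: "x \<in> U"
  have "linear (\<lambda>v. Q x v a)" by (rule lin_Q(2)[OF x])
  from linear_compose_add[OF linear_family_linear_fderiv[OF wK_fam x, of d "K x a"]
      linear_compose[OF this lin_w(1)[OF x, of "K x d"]]]
  show "linear (bott a d x)" by (simp add: bott_def[abs_def] o_def)
next
  fix v
  have F: "smooth_on U (\<lambda>y. w y (K y d) v)" using wK_fam unfolding linear_family_def by blast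
  have "linear_family U (fderiv (\<lambda>y. w y (K y d) v))"
    unfolding linear_family_def using U smooth_on_linear_fderiv[OF F] smooth_on_fderiv[OF F] by blast
  then have "smooth_on U (\<lambda>x. fderiv (\<lambda>y. w y (K y d) v) x (K x a))"
    by (rule linear_family_smooth_arg[OF _ U smooth_on_ident[OF U] _ smooth_K]) simp
  moreover have "smooth_on U (\<lambda>x. Q x v a)"
    using Q unfolding bilinear_family_def linear_family_def by blast
  then have "smooth_on U (\<lambda>x. w x (K x d) (Q x v a))"
    by (intro bilinear_family_smooth_arg[OF w U smooth_on_ident[OF U] _ smooth_K]) simp_all
  ultimately show "smooth_on U (\<lambda>x. bott a d x v)"
    unfolding bott_def by (rule smooth_on_add[OF U])
qed

lemma dwK:
  assumes x: "x \<in> U" and V: "(V has_derivative V') (at x)"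
  shows "((\<lambda>y. w y (K y d) (V y)) has_derivative (\<lambda>h. fderiv (\<lambda>y. w y (K y d) (V x)) x h + w x (K x d) (V' h))) (at x)"
  using linear_family_has_derivative[OF wK_fam U x _ has_derivative_ident V, of d] by simp

text \<open>By skewness of \<open>K\<close> this puts the vector representing \<open>bott\<close> in
  ker K, so that the Bott derivative is again tangent to the distribution. Nijenhuis exchanges
  \<open>a\<close> and \<open>r\<close> up to terms in the range of \<open>K\<close>, which pair to
  zero with \<open>K d\<close>.\<close>

lemma bott_K:
  assumes x: "x \<in> U" shows "bott a d x (K x r) = 0"
proof -
  have "((\<lambda>y. w y (K y d) (K x r)) has_derivative
      (\<lambda>h. fderiv (\<lambda>y. w y (K x d) (K x r)) x h + w x (Q x h d) (K x r))) (at x)"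
    using bilinear_family_has_derivative[OF w U x _ has_derivative_ident smooth_on_has_derivative[OF smooth_K x]
        has_derivative_const, of d "K x r"]
    by (simp add: linear_0[OF lin_w(1)[OF x]] Q_def)
  from fderiv_eqI[OF this] have 1: "fderiv (\<lambda>y. w y (K y d) (K x r)) x (K x a) =
      fderiv (\<lambda>y. w y (K x d) (K x r)) x (K x a) + w x (Q x (K x a) d) (K x r)" by metis
  have "Q x (K x r) a = Q x (K x a) r + K x (Q x r a - Q x a r)"
    using Nijenhuis[OF x, of r a] by (simp add: K_diff[OF x] algebra_simps)
  then have "w x (K x d) (Q x (K x r) a) = w x (K x d) (Q x (K x a) r)"
    by (simp add: linear_add[OF lin_w(1)[OF x]] wKK[OF x])
  then show ?thesis
    using 1 dw_KK[OF x, of d r "K x a"] by (simp add: bott_def)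
qed

text \<open>A restricted connection is constrained only on triples in its graph, so an actual Bott
  derivative has to be produced. Nondegeneracy of \<open>w\<close> gives it pointwise, the linear
  system makes it smooth.\<close>

lemma bott_field_exists:
  obtains z where "smooth_on U z" "\<And>x. x \<in> U \<Longrightarrow> K x (z x) = 0" "\<And>x v. x \<in> U \<Longrightarrow> w x (z x) v = bott a d x v"
proof -
  have "\<exists>z. \<forall>v. w x z v = bott a d x v" if "x \<in> U" for x
  proof -
    have "linear (bott a d x)" using bott_fam that unfolding linear_family_def by blast
    from w_represents[OF that this] show ?thesis by blast
  qed
  then obtain z where z: "\<And>x v. x \<in> U \<Longrightarrow> w x (z x) v = bott a d x v" by metis
  have "smooth_on U z"
  proof (rule smooth_on_linear_solution[OF U, where I = UNIV and r = "\<lambda>i x v. w x v (axis i 1)"])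
    show "linear (\<lambda>v. w x v (axis i 1))" if "x \<in> U" for i x by (rule lin_w(2)[OF that])
    show "smooth_on U (\<lambda>x. w x v (axis i 1))" for i v
      using w unfolding bilinear_family_def linear_family_def by blast
    show "v = 0" if x: "x \<in> U" and *: "\<And>i. i \<in> UNIV \<Longrightarrow> w x v (axis i 1) = 0" for x v
    proof (rule w_nondeg[OF x])
      fix b
      have "w x v b = w x v (\<Sum>i\<in>UNIV. b $ i *\<^sub>R axis i 1)"
        using basis_expansion[of b] by (simp add: scalar_mult_eq_scaleR)
      also have "\<dots> = 0" using * by (simp add: linear_sum[OF lin_w(1)[OF x]] linear_cmul[OF lin_w(1)[OF x]])
      finally show "w x v b = 0" .
    qed
    have "smooth_on U (\<lambda>x. bott a d x v)" for v using bott_fam unfolding linear_family_def by blast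
    then show "smooth_on U (\<lambda>x. w x (z x) (axis i 1))" for i
      by (rule iffD2[OF smooth_on_cong[OF U], rotated]) (rule z)
  qed simp
  moreover have "K x (z x) = 0" if x: "x \<in> U" for x
  proof (rule w_nondeg[OF x])
    show "w x (K x (z x)) r = 0" for r
      using wK[OF x, of "z x" r] z[OF x] bott_K[OF x] by simp
  qed
  ultimately show ?thesis using z that by blast
qed

text \<open>Passage from constant to arbitrary fields \<open>V\<close>: the derivative of
  \<open>V\<close> enters both through the differentiated pairing and through the bracket, and
  cancels.\<close>

lemma bott_identity:
  assumes x: "x \<in> U" and V: "(V has_derivative V') (at x)"
  shows "bott a d x (V x) = fderiv (\<lambda>y. w y (K y d) (V y)) x (K x a) + w x (V' (K x a) - Q x (V x) a) (K x d)"
proof -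
  have "fderiv (\<lambda>y. w y (K y d) (V y)) x (K x a) =
      fderiv (\<lambda>y. w y (K y d) (V x)) x (K x a) + w x (K x d) (V' (K x a))"
    by (rule fun_cong[OF fderiv_eqI[OF dwK[OF x V]]])
  then show ?thesis
    using w_alt[OF x, of "V' (K x a)" "K x d"] w_alt[OF x, of "Q x (V x) a" "K x d"]
    by (simp only: bott_def linear_diff[OF lin_w(2)[OF x]])
qed

end

locale primitive_manifold = manifold T A
  for T :: "'a topology" and A :: "('a, 6) chart set" +
  fixes \<omega> \<phi> :: "('a, 6) form"
  assumes symplectic: "symplectic_form A \<omega>" and form_3: "diff_form A 3 \<phi>"
    and orbit: "\<forall>c\<in>A. \<forall>x\<in>img c. in_O0_plus (\<omega> c x) (\<phi> c x)"
    and closed_3: "closed_form A 3 \<phi>" and closed_F: "closed_form A 3 (F_form \<omega> \<phi>)"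
begin

abbreviation KE :: "('a, 6) chart \<Rightarrow> real ^ 6 \<Rightarrow> real ^ 6 \<Rightarrow> real ^ 6" where "KE \<equiv> K_end \<omega> \<phi>"

lemma form_2: "diff_form A 2 \<omega>" and closed_2: "closed_form A 2 \<omega>"
  using symplectic unfolding symplectic_form_def by blast+

lemma mform_om: "c \<in> A \<Longrightarrow> x \<in> img c \<Longrightarrow> mform 2 (\<omega> c x)"
  and mform_ph: "c \<in> A \<Longrightarrow> x \<in> img c \<Longrightarrow> mform 3 (\<phi> c x)"
  using form_2 form_3 unfolding diff_form_def by (blast intro: mform_alternating)+

lemma smooth_om: "c \<in> A \<Longrightarrow> length vs = 2 \<Longrightarrow> smooth_on (img c) (\<lambda>x. \<omega> c x vs)"
  and smooth_ph: "c \<in> A \<Longrightarrow> length vs = 3 \<Longrightarrow> smooth_on (img c) (\<lambda>x. \<phi> c x vs)"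
  using form_2 form_3 unfolding diff_form_def by blast+

lemma om_natural: "c \<in> A \<Longrightarrow> c' \<in> A \<Longrightarrow> p \<in> fst c \<Longrightarrow> p \<in> fst c' \<Longrightarrow> length vs = 2 \<Longrightarrow>
    \<omega> c (snd c p) vs = \<omega> c' (snd c' p) (map (fderiv (trans_map c c') (snd c p)) vs)"
  and ph_natural: "c \<in> A \<Longrightarrow> c' \<in> A \<Longrightarrow> p \<in> fst c \<Longrightarrow> p \<in> fst c' \<Longrightarrow> length vs = 3 \<Longrightarrow>
    \<phi> c (snd c p) vs = \<phi> c' (snd c' p) (map (fderiv (trans_map c c') (snd c p)) vs)"
  using form_2 form_3 unfolding diff_form_def by blast+

section \<open>Naturality and smoothness of \<open>K\<close> on the manifold\<close>

lemma adapted: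
  assumes "c \<in> A" "x \<in> img c"
  obtains f E where "adapted_coframe (\<omega> c x) (\<phi> c x) f E" "KE c x = adapted_coframe.KN f E"
proof -
  have "in_O0_plus (\<omega> c x) (\<phi> c x)" using orbit assms by blast
  from adapted_coframe_exists[OF this mform_om[OF assms] mform_ph[OF assms]]
  obtain f E where "adapted_coframe (\<omega> c x) (\<phi> c x) f E" .
  then show ?thesis by (intro that K_end_eq_KN)
qed

lemma KE_iff:
  assumes "c \<in> A" "x \<in> img c"
  shows "(\<forall>vs. length vs = 5 \<longrightarrow> interior_product v (volume_form (\<omega> c x)) vs
      = - wedge 2 (interior_product u (\<phi> c x)) (\<phi> c x) vs) \<longleftrightarrow> v = KE c x u"
proof -
  obtain f E where "adapted_coframe (\<omega> c x) (\<phi> c x) f E" "KE c x = adapted_coframe.KN f E"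
    by (rule adapted[OF assms])
  then show ?thesis by (simp only: adapted_coframe.K_equation_iff)
qed

text \<open>The image of \<open>K u\<close> satisfies the defining equation of \<open>K\<close> in
  the other chart, since all forms in it are natural; \<open>KE_iff\<close> supplies uniqueness. The
  chart change is invertible, so every argument list is an image.\<close>

lemma KE_natural:
  assumes c: "c \<in> A" "c' \<in> A" and p: "p \<in> fst c" "p \<in> fst c'"
  shows "KE c' (snd c' p) (fderiv (trans_map c c') (snd c p) u) = fderiv (trans_map c c') (snd c p) (KE c (snd c p) u)"
proof -
  let ?F = "fderiv (trans_map c c') (snd c p)" and ?G = "fderiv (trans_map c' c) (snd c' p)"
  let ?x = "snd c p" and ?x' = "snd c' p"
  have om: "\<omega> c ?x us = \<omega> c' ?x' (map ?F us)" if "length us = 2" for us by (rule om_natural[OF c p that])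
  have ph: "\<phi> c ?x us = \<phi> c' ?x' (map ?F us)" if "length us = 3" for us by (rule ph_natural[OF c p that])
  have FG: "?F (?G v) = v" for v
    using fderiv_trans_map_inverse[OF c(2,1) p(2,1)] .
  have "interior_product (?F (KE c ?x u)) (volume_form (\<omega> c' ?x')) vs
      = - wedge 2 (interior_product (?F u) (\<phi> c' ?x')) (\<phi> c' ?x') vs" if vs: "length vs = 5" for vs
  proof -
    have vs_eq: "vs = map ?F (map ?G vs)" by (simp add: FG map_idI)
    have "wedge 2 (\<omega> c ?x) (\<omega> c ?x) us = wedge 2 (\<omega> c' ?x') (\<omega> c' ?x') (map ?F us)" if "length us = 4" for us
      by (rule wedge_transfer; rule om; use that in simp)
    then have "volume_form (\<omega> c ?x) us = volume_form (\<omega> c' ?x') (map ?F us)" if "length us = 6" for us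
      unfolding volume_form_def
      by (intro arg_cong[where f = "\<lambda>t. t / fact 3"] wedge_transfer) (use om that in simp_all)
    from this[of "KE c ?x u # map ?G vs"]
    have "interior_product (?F (KE c ?x u)) (volume_form (\<omega> c' ?x')) vs
        = interior_product (KE c ?x u) (volume_form (\<omega> c ?x)) (map ?G vs)"
      using vs vs_eq by (simp add: interior_product_def)
    also have "\<dots> = - wedge 2 (interior_product u (\<phi> c ?x)) (\<phi> c ?x) (map ?G vs)"
      using KE_iff[OF c(1) in_img[OF p(1)], of "KE c ?x u" u] vs by simp
    also have "wedge 2 (interior_product u (\<phi> c ?x)) (\<phi> c ?x) (map ?G vs)
        = wedge 2 (interior_product (?F u) (\<phi> c' ?x')) (\<phi> c' ?x') (map ?F (map ?G vs))"
    proof (rule wedge_transfer)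
      show "interior_product u (\<phi> c ?x) us = interior_product (?F u) (\<phi> c' ?x') (map ?F us)" if "length us = 2" for us
        using ph[of "u # us"] that by (simp add: interior_product_def)
      show "\<phi> c ?x us = \<phi> c' ?x' (map ?F us)" if "2 + length us = length (map ?G vs)" for us
        using that vs by (intro ph) simp
    qed
    finally show ?thesis using vs_eq by simp
  qed
  then show ?thesis using KE_iff[OF c(2) in_img[OF p(2)], of "?F (KE c ?x u)" "?F u"] by simp
qed

text \<open>The defining equation is read as a linear system with one equation for each list of five
  coordinate vectors. A homogeneous solution satisfies the equation of \<open>K 0\<close>, hence is
  zero.\<close>

lemma smooth_KE:
  assumes c: "c \<in> A" shows "smooth_on (img c) (\<lambda>x. KE c x u)"
proof -
  have U: "open (img c)" by (rule chart_open(2)[OF c])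
  let ?B = "range (\<lambda>i. axis i (1::real) :: real ^ 6)"
  let ?I = "{vs :: (real ^ 6) list. set vs \<subseteq> ?B \<and> length vs = 5}"
  have vol: "smooth_on (img c) (\<lambda>x. volume_form (\<omega> c x) us)" if "length us = 6" for us
  proof -
    have "smooth_on (img c) (\<lambda>x. wedge 2 (\<omega> c x) (\<omega> c x) us)" if "length us = 4" for us
      by (rule smooth_on_wedge[OF U]; rule smooth_om[OF c]; use that in simp)
    then have "smooth_on (img c) (\<lambda>x. wedge 2 (\<omega> c x) (wedge 2 (\<omega> c x) (\<omega> c x)) us)"
      by (intro smooth_on_wedge[OF U] smooth_om[OF c]) (use that in simp_all)
    then show ?thesis
      unfolding volume_form_def by (intro smooth_on_divide[OF U] smooth_on_const) simp_all
  qed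
  have mvol: "mform 6 (volume_form (\<omega> c x))" if "x \<in> img c" for x
  proof -
    have "mform 4 (wedge 2 (\<omega> c x) (\<omega> c x))" by (rule mform_wedge[OF mform_om mform_om]; use c that in simp)
    then have "mform 6 (wedge 2 (\<omega> c x) (wedge 2 (\<omega> c x) (\<omega> c x)))"
      by (rule mform_wedge[OF mform_om[OF c that]]) simp
    from mform_linear_combination[OF this this, of "1 / fact 3" 0]
    show ?thesis by (rule mform_cong) (simp add: volume_form_def)
  qed
  show ?thesis
  proof (rule smooth_on_linear_solution[OF U, where I = ?I and r = "\<lambda>vs x v. volume_form (\<omega> c x) (v # vs)"])
    show "finite ?I" by (rule finite_lists_length_eq) simp
    show "linear (\<lambda>v. volume_form (\<omega> c x) (v # vs))" if "vs \<in> ?I" "x \<in> img c" for vs x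
      using that by (intro mform_imp_linear[OF mvol]) simp_all
    show "smooth_on (img c) (\<lambda>x. volume_form (\<omega> c x) (v # vs))" if "vs \<in> ?I" for vs v
      using that by (intro vol) simp
    show "v = 0" if x: "x \<in> img c" and z: "\<And>vs. vs \<in> ?I \<Longrightarrow> volume_form (\<omega> c x) (v # vs) = 0" for x v
    proof -
      have m5: "mform 5 (interior_product v (volume_form (\<omega> c x)))"
      proof -
        have "mform (Suc 5) (volume_form (\<omega> c x))" using mvol[OF x] by simp
        then show ?thesis unfolding mform.simps(2) by blast
      qed
      have "interior_product v (volume_form (\<omega> c x)) vs = 0" if len: "length vs = 5" for vs
      proof (rule mform_zero_on_basis[OF _ m5 _ len, where I = UNIV and c = "\<lambda>i v. v $ i" and E = "\<lambda>i. axis i 1"])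
        show "w = (\<Sum>i\<in>UNIV. w $ i *\<^sub>R axis i 1)" for w :: "real ^ 6"
          using basis_expansion[of w] by (simp add: scalar_mult_eq_scaleR)
        show "interior_product v (volume_form (\<omega> c x)) (map (\<lambda>i. axis i 1) l) = 0" if "length l = 5" for l
          unfolding interior_product_def using that by (intro z) auto
      qed
      moreover have "wedge 2 (interior_product 0 (\<phi> c x)) (\<phi> c x) vs = 0" for vs
      proof (rule wedge_left_zero)
        fix us :: "(real ^ 6) list" assume "length us = 2"
        then have "linear (\<lambda>a. \<phi> c x (a # us))" by (intro mform_imp_linear[OF mform_ph[OF c x]]) simp
        from linear_0[OF this] show "interior_product 0 (\<phi> c x) us = 0" by (simp add: interior_product_def)
      qed
      ultimately have "v = KE c x 0" using KE_iff[OF c x, of v 0] by simp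
      moreover have "linear (KE c x)"
        by (rule adapted[OF c x]) (simp add: adapted_coframe.linear_KN)
      ultimately show "v = 0" by (simp add: linear_0)
    qed
    show "smooth_on (img c) (\<lambda>x. volume_form (\<omega> c x) (KE c x u # vs))" if vs: "vs \<in> ?I" for vs
    proof -
      have "smooth_on (img c) (\<lambda>x. wedge 2 (interior_product u (\<phi> c x)) (\<phi> c x) vs)"
        by (rule smooth_on_wedge[OF U]; (unfold interior_product_def)?; rule smooth_ph[OF c]; use vs in simp)
      then have "smooth_on (img c) (\<lambda>x. - wedge 2 (interior_product u (\<phi> c x)) (\<phi> c x) vs)"
        by (rule smooth_on_minus[OF U])
      then show ?thesis
      proof (rule iffD2[OF smooth_on_cong[OF U], rotated])
        show "volume_form (\<omega> c x) (KE c x u # vs) = - wedge 2 (interior_product u (\<phi> c x)) (\<phi> c x) vs"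
          if "x \<in> img c" for x
          using KE_iff[OF c that, of "KE c x u" u] vs by (simp add: interior_product_def)
      qed
    qed
  qed
qed

lemma patch:
  assumes c: "c \<in> A"
  shows "ambient_patch (img c) (\<lambda>x a b. \<omega> c x [a, b]) (\<lambda>x a b d. \<phi> c x [a, b, d]) (KE c)"
proof
  have U: "open (img c)" by (rule chart_open(2)[OF c])
  then show "open (img c)" .
  note om = mform_2_pair[OF mform_om[OF c]] and ph = mform_3_triple[OF mform_ph[OF c]]
  show "bilinear_family (img c) (\<lambda>x a b. \<omega> c x [a, b])"
    unfolding bilinear_family_def linear_family_def using U om(1,2) smooth_om[OF c] by simp
  show "trilinear_family (img c) (\<lambda>x a b d. \<phi> c x [a, b, d])"
    unfolding trilinear_family_def bilinear_family_def linear_family_def using U ph(1-3) smooth_ph[OF c] by simp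
  show lK: "linear_family (img c) (KE c)"
    unfolding linear_family_def
  proof (intro conjI ballI allI U smooth_KE[OF c])
    show "linear (KE c x)" if "x \<in> img c" for x
      by (rule adapted[OF c that]) (simp add: adapted_coframe.linear_KN)
  qed
  fix x assume x: "x \<in> img c"
  obtain f E where ac: "adapted_coframe (\<omega> c x) (\<phi> c x) f E" and KN: "KE c x = adapted_coframe.KN f E"
    by (rule adapted[OF c x])
  interpret ac: adapted_coframe "\<omega> c x" "\<phi> c x" f E by (rule ac)
  show "\<omega> c x [a, b] = - \<omega> c x [b, a]" for a b by (rule om(3)[OF x])
  show "\<phi> c x [a, b, d] = - \<phi> c x [b, a, d]" "\<phi> c x [a, b, d] = - \<phi> c x [a, d, b]" for a b d
    by (rule ph(4,5)[OF x])+
  show "KE c x (KE c x a) = 0" for a unfolding KN by (rule ac.KN_KN)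
  show "a \<in> range (KE c x)" if "KE c x a = 0" for a using that unfolding KN by (rule ac.KN_zero_imp)
  show "\<omega> c x [KE c x a, b] = - \<omega> c x [a, KE c x b]" for a b unfolding KN by (rule ac.om_KN)
  show "\<phi> c x [KE c x a, b, d] = \<phi> c x [a, KE c x b, d]" for a b d unfolding KN by (rule ac.ph_KN)
  show "a = 0" if "\<And>b. \<omega> c x [a, b] = 0" for a by (rule ac.om_nondegenerate[OF that])
  show "a = 0" if "\<And>b d. \<phi> c x [a, b, d] = 0" for a by (rule ac.ph_nondegenerate[OF that])
  show "\<omega> c x [a, KE c x a] * (\<omega> c x [b, KE c x b] * \<omega> c x [d, KE c x d] - \<omega> c x [b, KE c x d] * \<omega> c x [d, KE c x b]) -
    \<omega> c x [a, KE c x b] * (\<omega> c x [b, KE c x a] * \<omega> c x [d, KE c x d] - \<omega> c x [b, KE c x d] * \<omega> c x [d, KE c x a]) +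
    \<omega> c x [a, KE c x d] * (\<omega> c x [b, KE c x a] * \<omega> c x [d, KE c x b] - \<omega> c x [b, KE c x b] * \<omega> c x [d, KE c x a]) =
    2 * (\<phi> c x [KE c x a, b, d])\<^sup>2" for a b d
    unfolding KN by (rule ac.det_om_KN)
  show "fderiv (\<lambda>y. \<omega> c y [b, d]) x a - fderiv (\<lambda>y. \<omega> c y [a, d]) x b + fderiv (\<lambda>y. \<omega> c y [a, b]) x d = 0" for a b d
  proof -
    have "length [a, b, d] = Suc 2" by simp
    then have "ext_deriv \<omega> c x [a, b, d] = 0" using closed_2 c x unfolding closed_form_def by blast
    then show ?thesis by (simp only: ext_deriv_2)
  qed
  show "fderiv (\<lambda>y. \<phi> c y [b, d, e]) x a - fderiv (\<lambda>y. \<phi> c y [a, d, e]) x b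
      + fderiv (\<lambda>y. \<phi> c y [a, b, e]) x d - fderiv (\<lambda>y. \<phi> c y [a, b, d]) x e = 0" for a b d e
  proof -
    have "length [a, b, d, e] = Suc 3" by simp
    then have "ext_deriv \<phi> c x [a, b, d, e] = 0" using closed_3 c x unfolding closed_form_def by blast
    then show ?thesis by (simp only: ext_deriv_3)
  qed
  show "fderiv (\<lambda>y. \<phi> c y [KE c y b, d, e]) x a - fderiv (\<lambda>y. \<phi> c y [KE c y a, d, e]) x b
      + fderiv (\<lambda>y. \<phi> c y [KE c y a, b, e]) x d - fderiv (\<lambda>y. \<phi> c y [KE c y a, b, d]) x e = 0" for a b d e
  proof -
    have F: "fderiv (\<lambda>y. F_form \<omega> \<phi> c y [a, b, d]) x h = - 2 * fderiv (\<lambda>y. \<phi> c y [KE c y a, b, d]) x h" for a b d h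
    proof -
      have "smooth_on (img c) (\<lambda>y. \<phi> c y [KE c y a, b, d])"
        by (rule smooth_on_linear_arg[OF U, where f = "\<lambda>y v. \<phi> c y [v, b, d]"])
          (simp_all add: ph(1) smooth_ph[OF c] smooth_KE[OF c])
      from has_derivative_mult_right[OF smooth_on_has_derivative[OF this x], of "- 2"]
      have "((\<lambda>y. F_form \<omega> \<phi> c y [a, b, d]) has_derivative (\<lambda>h. - 2 * fderiv (\<lambda>y. \<phi> c y [KE c y a, b, d]) x h)) (at x)"
        by (simp add: F_form_def)
      from fderiv_eqI[OF this] show ?thesis by (rule fun_cong)
    qed
    have "length [a, b, d, e] = Suc 3" by simp
    then have "ext_deriv (F_form \<omega> \<phi>) c x [a, b, d, e] = 0" using closed_F c x unfolding closed_form_def by blast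
    then show ?thesis unfolding ext_deriv_3 F by simp
  qed
qed

section \<open>Test sections of the distribution and their derivatives\<close>

lemma KE_zero_lift:
  assumes c: "c \<in> A" and f: "\<And>x. x \<in> img c \<Longrightarrow> KE c x (f x) = 0"
    and "c' \<in> A" "p \<in> fst c" "p \<in> fst c'"
  shows "KE c' (snd c' p) (lift c f c' (snd c' p)) = 0"
proof -
  have "lift c f c' (snd c' p) = fderiv (trans_map c c') (snd c p) (f (snd c p))"
    by (rule lift_at[OF assms(3,5)])
  then show ?thesis
    using KE_natural[OF c assms(3-5), of "f (snd c p)"] f[OF in_img[OF assms(4)]]
      linear_0[OF self.linear[OF c assms(3-5)]] by simp
qed

lemma L_section_lift:
  assumes c: "c \<in> A" and f: "smooth_on (img c) f" "\<And>x. x \<in> img c \<Longrightarrow> KE c x (f x) = 0"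
  shows "L_section T A \<omega> \<phi> (fst c) (lift c f)"
  unfolding L_section_def
  using chart_open(1)[OF c] vector_field_lift[OF c f(1)] KE_zero_lift[OF c f(2)] by blast

lemma KE_KE: "c \<in> A \<Longrightarrow> x \<in> img c \<Longrightarrow> KE c x (KE c x a) = 0"
  by (rule ambient_patch.KK[OF patch])

lemma L_section_lift_KE: "c \<in> A \<Longrightarrow> L_section T A \<omega> \<phi> (fst c) (lift c (\<lambda>x. KE c x a))"
  by (intro L_section_lift smooth_KE KE_KE)

text \<open>The constant field \<open>d\<close> serves as the preimage of
  \<open>K d\<close>.\<close>

lemma D_graph_lift:
  assumes c: "c \<in> A"
  shows "D_graph T A \<omega> \<phi> (fst c) (lift c (\<lambda>x. KE c x a)) (lift c (\<lambda>x. KE c x d))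
    (\<lambda>c' x. KE c' x (lie_bracket (lift c (\<lambda>x. KE c x a)) (lift c (\<lambda>x. d)) c' x))"
  unfolding D_graph_def
proof (intro conjI L_section_lift_KE[OF c] exI[of _ "lift c (\<lambda>x. d)"] ballI refl
    vector_field_lift[OF c smooth_on_const])
  fix c' p assume c': "c' \<in> A" and p: "p \<in> fst c' \<inter> fst c"
  then have "p \<in> fst c" "p \<in> fst c'" by blast+
  then show "KE c' (snd c' p) (lift c (\<lambda>x. d) c' (snd c' p)) = lift c (\<lambda>x. KE c x d) c' (snd c' p)"
    using KE_natural[OF c c', of p d] lift_at[OF c', of p c] by simp
qed

lemma lie_bracket_lift:
  assumes "c \<in> A" "x \<in> img c"
  shows "lie_bracket (lift c f) V c x = fderiv (V c) x (f x) - fderiv f x (V c x)"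
  using assms by (simp add: lie_bracket_def lift_self fderiv_lift_self)

text \<open>The graph demands its formula in every chart and against every field \<open>V\<close>.
  In \<open>c\<close> it is \<open>bott_identity\<close>; elsewhere each of its three terms is
  carried over by naturality of \<omega>, of the bracket and of directional derivatives.\<close>

lemma Bott_graph_lift:
  assumes c: "c \<in> A"
  obtains z where "Bott_graph T A \<omega> \<phi> (fst c) (lift c (\<lambda>x. KE c x a)) (lift c (\<lambda>x. KE c x d)) (lift c z)"
    "\<And>x v. x \<in> img c \<Longrightarrow> \<omega> c x [z x, v] = fderiv (\<lambda>y. \<omega> c y [KE c y d, v]) x (KE c x a)
       + \<omega> c x [KE c x d, fderiv (\<lambda>y. KE c y a) x v]"
proof -
  interpret P: ambient_patch "img c" "\<lambda>x a b. \<omega> c x [a, b]" "\<lambda>x a b d. \<phi> c x [a, b, d]" "KE c"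
    by (rule patch[OF c])
  obtain z where z: "smooth_on (img c) z" "\<And>x. x \<in> img c \<Longrightarrow> KE c x (z x) = 0"
    "\<And>x v. x \<in> img c \<Longrightarrow> \<omega> c x [z x, v] = P.bott a d x v"
    by (rule P.bott_field_exists) blast
  let ?X = "lift c (\<lambda>x. KE c x a)" and ?Y = "lift c (\<lambda>x. KE c x d)"
  have vfX: "vector_field A (fst c) ?X" and vfY: "vector_field A (fst c) ?Y"
    by (intro vector_field_lift[OF c] smooth_KE[OF c])+
  have "\<omega> c' x' [lift c z c' x', V c' x'] = fderiv (\<lambda>y. \<omega> c' y [?Y c' y, V c' y]) x' (?X c' x')
      + \<omega> c' x' [lie_bracket ?X V c' x', ?Y c' x']"
    if V: "vector_field A (fst c) V" and c': "c' \<in> A" and x': "x' \<in> snd c' ` (fst c' \<inter> fst c)" for V c' x'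
  proof -
    obtain p where p: "p \<in> fst c" "p \<in> fst c'" "x' = snd c' p" using x' by blast
    let ?x = "snd c p" and ?F = "fderiv (trans_map c c') (snd c p)"
    have x: "?x \<in> img c" by (rule in_img[OF p(1)])
    have dV: "(V c has_derivative fderiv (V c) ?x) (at ?x)"
      using vector_field_smooth[OF V c] x by (intro smooth_on_has_derivative) (simp_all add: img_def)
    define h where "h = (\<lambda>y. \<omega> c y [?Y c y, V c y])"
    define h' where "h' = (\<lambda>y. \<omega> c' y [?Y c' y, V c' y])"
    have h: "fderiv h ?x = fderiv (\<lambda>y. \<omega> c y [KE c y d, V c y]) ?x"
      unfolding h_def by (rule fderiv_cong_open[OF chart_open(2)[OF c] x]) (simp add: lift_self[OF c])
    have base: "\<omega> c ?x [z ?x, V c ?x] = fderiv h ?x (KE c ?x a) + \<omega> c ?x [lie_bracket ?X V c ?x, ?Y c ?x]"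
      using P.bott_identity[OF x dV, of a d] z(3)[OF x]
      by (simp add: h lie_bracket_lift[OF c x] lift_self[OF c x] P.Q_def)
    have dh': "h' differentiable (at x')"
    proof -
      let ?S = "snd c' ` (fst c' \<inter> fst c)"
      have S: "open ?S" by (rule open_overlap2[OF c' c])
      have om2: "bilinear_family (img c') (\<lambda>x a b. \<omega> c' x [a, b])"
        by (rule ambient_patch.w[OF patch[OF c']])
      have "smooth_on ?S (\<lambda>y. \<omega> c' y [?Y c' y, V c' y])"
        by (rule bilinear_family_smooth_arg[OF om2 S smooth_on_ident[OF S] _ vector_field_smooth[OF vfY c'] vector_field_smooth[OF V c']])
          (auto simp: img_def)
      then show ?thesis unfolding h'_def using x' by (rule smooth_on_differentiable)
    qed
    have fx: "trans_map c c' ?x = x'" using trans_map_at[OF chart[OF c] p(1), of c'] p(3) by simp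
    have "((h' \<circ> trans_map c c') has_derivative (fderiv h' x' \<circ> ?F)) (at ?x)"
      using dh' self.differentiable[OF c c' p(1,2)]
      by (intro diff_chain_at) (auto simp: fx intro: has_derivative_fderiv)
    then have "(h has_derivative (fderiv h' x' \<circ> ?F)) (at ?x)"
    proof (rule has_derivative_transform_within_open[OF _ open_overlap2[OF c c']])
      show "?x \<in> snd c ` (fst c \<inter> fst c')" using p by blast
      fix y assume "y \<in> snd c ` (fst c \<inter> fst c')"
      then obtain r where r: "r \<in> fst c" "r \<in> fst c'" "y = snd c r" by blast
      have "trans_map c c' y = snd c' r" using trans_map_at[OF chart[OF c] r(1), of c'] r(3) by simp
      then show "(h' \<circ> trans_map c c') y = h y"
        using om_natural[OF c c' r(1,2), of "[?Y c y, V c y]"]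
          vector_field_transform[OF vfY c c' r(1,2,1)] vector_field_transform[OF V c c' r(1,2,1)]
        by (simp add: h_def h'_def r(3))
    qed
    from fderiv_eqI[OF this] have "fderiv h ?x (KE c ?x a) = fderiv h' x' (?F (KE c ?x a))" by simp
    also have "?F (KE c ?x a) = ?X c' x'" using lift_at[OF c' p(2), of c] p(3) by simp
    finally have 1: "fderiv h ?x (KE c ?x a) = fderiv h' x' (?X c' x')" .
    have 2: "\<omega> c ?x [lie_bracket ?X V c ?x, ?Y c ?x] = \<omega> c' x' [lie_bracket ?X V c' x', ?Y c' x']"
      using om_natural[OF c c' p(1,2), of "[lie_bracket ?X V c ?x, ?Y c ?x]"]
        lie_bracket_natural[OF vfX V chart_open(1)[OF c] c c' p(1,2,1)] vector_field_transform[OF vfY c c' p(1,2,1)]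
      by (simp add: p(3))
    have 3: "\<omega> c ?x [z ?x, V c ?x] = \<omega> c' x' [lift c z c' x', V c' x']"
      using om_natural[OF c c' p(1,2), of "[z ?x, V c ?x]"] lift_at[OF c' p(2), of c z]
        vector_field_transform[OF V c c' p(1,2,1)] by (simp add: p(3))
    show ?thesis using base unfolding 1 2 3 h'_def .
  qed
  then have "Bott_graph T A \<omega> \<phi> (fst c) ?X ?Y (lift c z)"
    unfolding Bott_graph_def
    using L_section_lift_KE[OF c] L_section_lift[OF c z(1,2)] by blast
  moreover have "\<omega> c x [z x, v] = fderiv (\<lambda>y. \<omega> c y [KE c y d, v]) x (KE c x a)
       + \<omega> c x [KE c x d, fderiv (\<lambda>y. KE c y a) x v]" if "x \<in> img c" for x v
    using z(3)[OF that] by (simp add: P.bott_def P.Q_def)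
  ultimately show ?thesis using that by blast
qed

end

section \<open>Connections and metric on the leaves\<close>

lemma linear_zero_on_axes:
  fixes f :: "real ^ 'n \<Rightarrow> 'b::real_vector"
  assumes "linear f" "\<And>i. f (axis i 1) = 0" shows "f v = 0"
proof -
  have "f v = f (\<Sum>i\<in>UNIV. v $ i *\<^sub>R axis i 1)"
    using basis_expansion[of v] by (simp add: scalar_mult_eq_scaleR)
  then show ?thesis by (simp add: linear_sum[OF assms(1)] linear_cmul[OF assms(1)] assms(2))
qed

lemma bilinear_family_subset:
  assumes "bilinear_family U f" "S \<subseteq> U" "open S" shows "bilinear_family S f"
proof -
  have "smooth_on S (\<lambda>x. f x a b)" for a b
    using assms(1) unfolding bilinear_family_def linear_family_def by (blast intro: smooth_on_subset[OF _ assms(2)])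
  then show ?thesis
    using assms unfolding bilinear_family_def linear_family_def by blast
qed

locale leaf_manifold = primitive_manifold T A \<omega> \<phi> + im: immersion TL AL T A
  for T :: "'a topology" and A :: "('a, 6) chart set" and \<omega> \<phi> :: "('a, 6) form"
    and TL :: "'a topology" and AL :: "('a, 3) chart set" +
  assumes inj_leaf: "b \<in> AL \<Longrightarrow> c \<in> A \<Longrightarrow> p \<in> fst b \<Longrightarrow> p \<in> fst c \<Longrightarrow> inj (fderiv (trans_map b c) (snd b p))"
    and range_leaf: "b \<in> AL \<Longrightarrow> c \<in> A \<Longrightarrow> p \<in> fst b \<Longrightarrow> p \<in> fst c \<Longrightarrow>
      range (fderiv (trans_map b c) (snd b p)) = {v. K_end \<omega> \<phi> c (snd c p) v = 0}"
begin

lemma trans_map_leaf: "b \<in> AL \<Longrightarrow> p \<in> fst b \<Longrightarrow> trans_map b c (snd b p) = snd c p"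
  by (rule trans_map_at[OF im.L.chart])

lemma ambient_chart_exists: "b \<in> AL \<Longrightarrow> p \<in> fst b \<Longrightarrow> \<exists>c\<in>A. p \<in> fst c"
proof -
  assume "b \<in> AL" "p \<in> fst b"
  then have "p \<in> topspace TL" by (rule im.L.in_topspace)
  then have "p \<in> topspace T" using im.cont unfolding continuous_map_def by auto
  then show ?thesis by (rule covered)
qed

lemma leaf_patch:
  assumes b: "b \<in> AL" and c: "c \<in> A"
  shows "leaf_patch (img c) (\<lambda>x a b. \<omega> c x [a, b]) (\<lambda>x a b d. \<phi> c x [a, b, d]) (KE c)
    (snd b ` (fst b \<inter> fst c)) (trans_map b c)"
proof (intro leaf_patch.intro patch[OF c] leaf_patch_axioms.intro)
  show "open (snd b ` (fst b \<inter> fst c))" by (rule im.open_overlap[OF b chart_open(1)[OF c]])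
  show "smooth_on (snd b ` (fst b \<inter> fst c)) (trans_map b c)" by (rule im.smooth[OF b c])
  show "trans_map b c ` snd b ` (fst b \<inter> fst c) \<subseteq> img c"
  proof (rule image_subsetI)
    fix y assume "y \<in> snd b ` (fst b \<inter> fst c)"
    then obtain p where p: "p \<in> fst b" "p \<in> fst c" "y = snd b p" by blast
    then show "trans_map b c y \<in> img c" using trans_map_leaf[OF b p(1), of c] by (simp add: img_def)
  qed
next
  fix y assume "y \<in> snd b ` (fst b \<inter> fst c)"
  then obtain p where p: "p \<in> fst b" "p \<in> fst c" "y = snd b p" by blast
  show "inj (fderiv (trans_map b c) y)" unfolding p(3) by (rule inj_leaf[OF b c p(1,2)])
  show "range (fderiv (trans_map b c) y) = {v. KE c (trans_map b c y) v = 0}"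
    unfolding p(3) trans_map_leaf[OF b p(1)] by (rule range_leaf[OF b c p(1,2)])
qed

section \<open>Restriction of sections and connections to a leaf\<close>

definition restr :: "('a, 6) chart \<Rightarrow> (real ^ 6 \<Rightarrow> real ^ 6) \<Rightarrow> ('a, 3) vfield" where
  "restr c f = (\<lambda>b y. THE u. fderiv (trans_map b c) y u = f (trans_map b c y))"

lemma restr_at:
  assumes "b \<in> AL" "c \<in> A" "p \<in> fst b" "p \<in> fst c" and f: "KE c (snd c p) (f (snd c p)) = 0"
  shows "fderiv (trans_map b c) (snd b p) (restr c f b (snd b p)) = f (snd c p)"
proof -
  have "f (snd c p) \<in> range (fderiv (trans_map b c) (snd b p))"
    unfolding range_leaf[OF assms(1-4)] using f by simp
  then obtain u where u: "fderiv (trans_map b c) (snd b p) u = f (snd c p)" by (metis rangeE)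
  have "restr c f b (snd b p) = u"
    unfolding restr_def trans_map_leaf[OF assms(1,3)] u[symmetric]
    using inj_leaf[OF assms(1-4)] by (intro the_equality refl) (simp add: inj_eq)
  then show ?thesis using u by simp
qed

text \<open>Smoothness comes from the linear system J u = f, which is injective on the leaf. The
  transformation law is checked after applying the injective differential of the inclusion.\<close>

lemma vector_field_restr:
  assumes c: "c \<in> A" and f: "smooth_on (img c) f" "\<And>x. x \<in> img c \<Longrightarrow> KE c x (f x) = 0"
  shows "vector_field AL (fst c \<inter> topspace TL) (restr c f)"
  unfolding vector_field_def
proof (intro conjI ballI)
  fix b assume b: "b \<in> AL"
  let ?S = "snd b ` (fst b \<inter> fst c)"
  interpret P: leaf_patch "img c" "\<lambda>x a b. \<omega> c x [a, b]" "\<lambda>x a b d. \<phi> c x [a, b, d]" "KE c" ?S "trans_map b c"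
    by (rule leaf_patch[OF b c])
  have eq: "P.J y (restr c f b y) = f (trans_map b c y)" if y: "y \<in> ?S" for y
  proof -
    obtain p where p: "p \<in> fst b" "p \<in> fst c" "y = snd b p" using y by blast
    show ?thesis
      unfolding p(3) P.J_def trans_map_leaf[OF b p(1)]
      by (rule restr_at[where f = f, OF b c p(1,2) f(2)[OF in_img[OF p(2)]]])
  qed
  have fio: "smooth_on ?S (\<lambda>y. f (trans_map b c y))"
    by (rule smooth_on_compose[OF P.Om P.U P.io_U P.io f(1)])
  have "smooth_on ?S (restr c f b)"
  proof (rule smooth_on_linear_solution[OF P.Om, where I = UNIV and r = "\<lambda>i y u. P.J y u $ i"])
    show "linear (\<lambda>u. P.J y u $ i)" if "y \<in> ?S" for i y
      by (rule linearI) (simp_all add: linear_add[OF P.lin_J[OF that]] linear_cmul[OF P.lin_J[OF that]])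
    show "smooth_on ?S (\<lambda>y. P.J y u $ i)" for i u
      by (rule smooth_on_bounded_linear[OF bounded_linear_vec_nth P.Om P.smooth_J])
    show "u = 0" if "y \<in> ?S" "\<And>i. i \<in> UNIV \<Longrightarrow> P.J y u $ i = 0" for y u
      using that by (intro P.J_zero[OF that(1)]) (simp add: vec_eq_iff)
    show "smooth_on ?S (\<lambda>y. P.J y (restr c f b y) $ i)" for i
      using smooth_on_bounded_linear[OF bounded_linear_vec_nth[of i] P.Om fio]
      by (rule iffD2[OF smooth_on_cong[OF P.Om], rotated]) (simp add: eq)
  qed simp
  then show "smooth_on (snd b ` (fst b \<inter> (fst c \<inter> topspace TL))) (restr c f b)"
    by (rule smooth_on_subset) blast
next
  fix b b' p assume b: "b \<in> AL" "b' \<in> AL" and "p \<in> fst b \<inter> fst b' \<inter> (fst c \<inter> topspace TL)"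
  then have p: "p \<in> fst b" "p \<in> fst b'" "p \<in> fst c" by blast+
  have f0: "KE c (snd c p) (f (snd c p)) = 0" by (rule f(2)[OF in_img[OF p(3)]])
  have "fderiv (trans_map b' c) (snd b' p) (restr c f b' (snd b' p)) =
      fderiv (trans_map b' c) (snd b' p) (fderiv (trans_map b b') (snd b p) (restr c f b (snd b p)))"
    using restr_at[where f = f, OF b(1) c p(1,3) f0] restr_at[where f = f, OF b(2) c p(2,3) f0]
      im.chain_left[OF b c p, of "restr c f b (snd b p)"] by simp
  then show "restr c f b' (snd b' p) = fderiv (trans_map b b') (snd b p) (restr c f b (snd b p))"
    by (rule injD[OF inj_leaf[OF b(2) c p(2,3)]])
qed

lemma restriction_of_lift:
  assumes c: "c \<in> A" and f: "\<And>x. x \<in> img c \<Longrightarrow> KE c x (f x) = 0"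
  shows "restriction_of A AL (fst c) (lift c f) (restr c f)"
  unfolding restriction_of_def
proof (intro ballI)
  fix b c' p assume b: "b \<in> AL" and c': "c' \<in> A" and "p \<in> fst b \<inter> fst c' \<inter> fst c"
  then have p: "p \<in> fst b" "p \<in> fst c" "p \<in> fst c'" by blast+
  show "fderiv (trans_map b c') (snd b p) (restr c f b (snd b p)) = lift c f c' (snd c' p)"
    using im.chain_right[OF b c c' p, of "restr c f b (snd b p)"]
      restr_at[where f = f, OF b c p(1,2) f[OF in_img[OF p(2)]]] lift_at[OF c' p(3), of c f] by simp
qed

text \<open>The sections \<open>K a\<close> with \<open>a\<close> constant in the chart \<open>c\<close> span the distribution, hence they determine
  the connection on the leaf.\<close>

lemma restricted_connection_formula:
  assumes \<Gamma>: "restricted_connection A G TL AL \<Gamma>" and b: "b \<in> AL" and c: "c \<in> A" and p: "p \<in> fst b" "p \<in> fst c"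
    and G: "G (fst c) (lift c (\<lambda>x. KE c x a)) (lift c (\<lambda>x. KE c x d)) Z"
    and u: "KE c (snd c p) a = fderiv (trans_map b c) (snd b p) u"
    and z: "KE c (snd c p) d = fderiv (trans_map b c) (snd b p) z"
  shows "fderiv (trans_map b c) (snd b p) (\<Gamma> b (snd b p) u z) = Z c (snd c p)
    + fderiv (\<lambda>y. fderiv (trans_map b c) y z) (snd b p) u
    - fderiv (\<lambda>x. KE c x d) (snd c p) (fderiv (trans_map b c) (snd b p) u)"
proof -
  let ?S = "snd b ` (fst b \<inter> fst c)" and ?y = "snd b p"
  interpret P: leaf_patch "img c" "\<lambda>x a b. \<omega> c x [a, b]" "\<lambda>x a b d. \<phi> c x [a, b, d]" "KE c" ?S "trans_map b c"
    by (rule leaf_patch[OF b c])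
  have y: "?y \<in> ?S" using p by blast
  define X' where "X' = restr c (\<lambda>x. KE c x a)"
  define Y' where "Y' = restr c (\<lambda>x. KE c x d)"
  have vf: "vector_field AL (fst c \<inter> topspace TL) X'" "vector_field AL (fst c \<inter> topspace TL) Y'"
    and re: "restriction_of A AL (fst c) (lift c (\<lambda>x. KE c x a)) X'"
      "restriction_of A AL (fst c) (lift c (\<lambda>x. KE c x d)) Y'"
    unfolding X'_def Y'_def
    by (rule vector_field_restr[OF c smooth_KE[OF c]] restriction_of_lift[OF c]; rule KE_KE[OF c]; assumption)+
  have "restriction_of A AL (fst c) Z (cov_deriv \<Gamma> X' Y')"
    using \<Gamma> G vf re unfolding restricted_connection_def by blast
  then have cov: "P.J ?y (cov_deriv \<Gamma> X' Y' b ?y) = Z c (snd c p)"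
    unfolding restriction_of_def P.J_def using b c p by blast
  have at: "P.J (snd b r) (restr c (\<lambda>x. KE c x v) b (snd b r)) = KE c (snd c r) v"
    if "r \<in> fst b" "r \<in> fst c" for r v
    unfolding P.J_def by (rule restr_at[where f = "\<lambda>x. KE c x v", OF b c that KE_KE[OF c in_img[OF that(2)]]])
  have X'_y: "X' b ?y = u"
    using at[OF p, of a] u injD[OF inj_leaf[OF b c p]] by (simp add: X'_def P.J_def)
  have Y'_y: "Y' b ?y = z"
    using at[OF p, of d] z injD[OF inj_leaf[OF b c p]] by (simp add: Y'_def P.J_def)
  have dY': "(Y' b has_derivative fderiv (Y' b) ?y) (at ?y)"
  proof (rule smooth_on_has_derivative[OF vector_field_smooth[OF vf(2) b]])
    show "?y \<in> snd b ` (fst b \<inter> (fst c \<inter> topspace TL))" using p im.L.in_topspace[OF b p(1)] by blast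
  qed
  \<comment> \<open>The field \<open>K d\<close> along the leaf is differentiated in two ways,
    through its leaf components \<open>Y'\<close> and through the ambient chart; comparing them
    eliminates the derivative of \<open>Y'\<close> from the covariant derivative.\<close>
  have "((\<lambda>y. P.J y (Y' b y)) has_derivative (\<lambda>h. P.H ?y h z + P.J ?y (fderiv (Y' b) ?y h))) (at ?y)"
    using linear_family_has_derivative[OF P.J_fam P.Om y _ has_derivative_ident dY']
    by (simp add: Y'_y P.H_def P.J_def)
  then have 1: "((\<lambda>y. KE c (trans_map b c y) d) has_derivative
      (\<lambda>h. P.H ?y h z + P.J ?y (fderiv (Y' b) ?y h))) (at ?y)"
  proof (rule has_derivative_transform_within_open[OF _ P.Om y])
    fix y assume "y \<in> ?S"
    then obtain r where r: "r \<in> fst b" "r \<in> fst c" "y = snd b r" by blast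
    show "P.J y (Y' b y) = KE c (trans_map b c y) d"
      unfolding Y'_def r(3) trans_map_leaf[OF b r(1)] by (rule at[OF r(1,2)])
  qed
  have 2: "((\<lambda>y. KE c (trans_map b c y) d) has_derivative (\<lambda>h. P.Q (snd c p) (P.J ?y h) d)) (at ?y)"
    using linear_family_has_derivative[OF P.K P.Om y P.io_U P.dio[OF y] has_derivative_const, of d]
    by (simp add: trans_map_leaf[OF b p(1)] P.Q_def linear_0[OF P.lin_K[OF in_img[OF p(2)]]])
  have "P.H ?y u z + P.J ?y (fderiv (Y' b) ?y u) = P.Q (snd c p) (P.J ?y u) d"
    using has_derivative_unique[OF 1 2] by (rule fun_cong)
  then have "P.J ?y (fderiv (Y' b) ?y u) = P.Q (snd c p) (P.J ?y u) d - P.H ?y u z"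
    by (simp add: eq_diff_eq add.commute)
  moreover have "P.J ?y (\<Gamma> b ?y u z) = Z c (snd c p) - P.J ?y (fderiv (Y' b) ?y u)"
    using cov by (simp add: cov_deriv_def X'_y Y'_y linear_add[OF P.lin_J[OF y]] eq_diff_eq add.commute)
  ultimately have "P.J ?y (\<Gamma> b ?y u z) = Z c (snd c p) + P.H ?y u z - P.Q (snd c p) (P.J ?y u) d"
    by simp
  then show ?thesis by (simp only: P.H_def P.Q_def P.J_def)
qed

text \<open>\<open>leaf_metric\<close> uses an arbitrary ambient chart and an arbitrary preimage.
  Naturality of \<omega> and \<open>K\<close> removes the first choice; the second is harmless
  because the other argument of \<omega> lies in the range of \<open>K\<close>.\<close>

lemma leaf_metric_eq:
  assumes b: "b \<in> AL" and c: "c \<in> A" and p: "p \<in> fst b" "p \<in> fst c"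
    and s: "KE c (snd c p) s = fderiv (trans_map b c) (snd b p) u"
  shows "leaf_metric A \<omega> \<phi> b (snd b p) u v = \<omega> c (snd c p) [s, fderiv (trans_map b c) (snd b p) v]"
proof -
  define c' where "c' = (SOME c. c \<in> A \<and> p \<in> fst c)"
  have "c' \<in> A \<and> p \<in> fst c'"
    unfolding c'_def by (rule someI[of "\<lambda>c. c \<in> A \<and> p \<in> fst c" c]) (use c p in blast)
  then have c': "c' \<in> A" "p \<in> fst c'" by blast+
  have pinv: "inv_into (fst b) (snd b) (snd b p) = p" by (rule chart_inv_into[OF im.L.chart[OF b] p(1)])
  let ?F = "fderiv (trans_map c c') (snd c p)" and ?x' = "snd c' p"
  let ?i = "fderiv (trans_map b c) (snd b p)" and ?i' = "fderiv (trans_map b c') (snd b p)"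
  have i': "?i' u = ?F (?i u)" for u by (rule im.chain_right[OF b c c'(1) p c'(2)])
  interpret P: ambient_patch "img c'" "\<lambda>x a b. \<omega> c' x [a, b]" "\<lambda>x a b d. \<phi> c' x [a, b, d]" "KE c'"
    by (rule patch[OF c'(1)])
  have x': "?x' \<in> img c'" by (rule in_img[OF c'(2)])
  have F_s: "KE c' ?x' (?F s) = ?i' u"
    unfolding i' s[symmetric] by (rule KE_natural[OF c c'(1) p(2) c'(2)])
  then have s': "KE c' ?x' (inv (KE c' ?x') (?i' u)) = ?i' u"
    by (metis f_inv_into_f rangeI)
  have "KE c' ?x' (?i' v) = 0"
    using range_leaf[OF b c'(1) p(1) c'(2)] by blast
  then obtain r where r: "?i' v = KE c' ?x' r" using P.ker_K[OF x'] by blast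
  have "leaf_metric A \<omega> \<phi> b (snd b p) u v = \<omega> c' ?x' [inv (KE c' ?x') (?i' u), ?i' v]"
    by (simp add: leaf_metric_def Let_def pinv c'_def)
  also have "\<dots> = \<omega> c' ?x' [?F s, ?i' v]"
    using P.wK[OF x', of "inv (KE c' ?x') (?i' u)" r] P.wK[OF x', of "?F s" r] by (simp add: r s' F_s)
  also have "\<dots> = \<omega> c (snd c p) [s, ?i v]"
    using om_natural[OF c c'(1) p(2) c'(2), of "[s, ?i v]"] by (simp add: i')
  finally show ?thesis .
qed

end

locale leaf_manifold_connections = leaf_manifold T A \<omega> \<phi> TL AL
  for T :: "'a topology" and A :: "('a, 6) chart set" and \<omega> \<phi> :: "('a, 6) form"
    and TL :: "'a topology" and AL :: "('a, 3) chart set" +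
  fixes D N B :: "('a, 3) christoffel"
  assumes D: "restricted_connection A (D_graph T A \<omega> \<phi>) TL AL D"
    and N: "levi_civita TL AL (leaf_metric A \<omega> \<phi>) N"
    and B: "restricted_connection A (Bott_graph T A \<omega> \<phi>) TL AL B"
begin

lemma connections: "affine_connection TL AL D" "affine_connection TL AL N" "affine_connection TL AL B"
  using D N B unfolding restricted_connection_def levi_civita_def by blast+

lemma affine_connection_bilinear: "affine_connection TL AL \<Gamma> \<Longrightarrow> b \<in> AL \<Longrightarrow> y \<in> img b \<Longrightarrow> bilinear (\<Gamma> b y)"
  and affine_connection_smooth: "affine_connection TL AL \<Gamma> \<Longrightarrow> b \<in> AL \<Longrightarrow> smooth_on (img b) (\<lambda>y. \<Gamma> b y u v)"
  unfolding affine_connection_def by blast+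

lemma N_torsion_free: "b \<in> AL \<Longrightarrow> y \<in> img b \<Longrightarrow> N b y u v = N b y v u"
  and N_compatible: "b \<in> AL \<Longrightarrow> y \<in> img b \<Longrightarrow> fderiv (\<lambda>y. leaf_metric A \<omega> \<phi> b y v z) y u =
    leaf_metric A \<omega> \<phi> b y (N b y u v) z + leaf_metric A \<omega> \<phi> b y v (N b y u z)"
  using N unfolding levi_civita_def torsion_free_def by blast+

lemma overlap_img: "snd b ` (fst b \<inter> fst c) \<subseteq> img b"
  unfolding img_def by blast

text \<open>The connections on the manifold meet the coordinate description: for given
  \<open>y\<close>, \<open>u\<close>, \<open>z\<close> the test fields have the coefficients
  \<open>P.s y u\<close> and \<open>P.s y z\<close>, frozen at \<open>y\<close>.\<close>

lemma leaf_connections: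
  assumes b: "b \<in> AL" and c: "c \<in> A"
  shows "leaf_connections (img c) (\<lambda>x a b. \<omega> c x [a, b]) (\<lambda>x a b d. \<phi> c x [a, b, d]) (KE c)
    (snd b ` (fst b \<inter> fst c)) (trans_map b c) (D b) (B b) (N b)"
    and "y \<in> snd b ` (fst b \<inter> fst c) \<Longrightarrow> leaf_metric A \<omega> \<phi> b y u v =
      leaf_patch.g (\<lambda>x a b. \<omega> c x [a, b]) (KE c) (trans_map b c) y u v"
proof -
  let ?S = "snd b ` (fst b \<inter> fst c)"
  interpret P: leaf_patch "img c" "\<lambda>x a b. \<omega> c x [a, b]" "\<lambda>x a b d. \<phi> c x [a, b, d]" "KE c" ?S "trans_map b c"
    by (rule leaf_patch[OF b c])
  have g: "leaf_metric A \<omega> \<phi> b y u v = P.g y u v" if y: "y \<in> ?S" for y u v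
  proof -
    obtain p where p: "p \<in> fst b" "p \<in> fst c" "y = snd b p" using y by blast
    have io: "trans_map b c y = snd c p" unfolding p(3) by (rule trans_map_leaf[OF b p(1)])
    have "KE c (snd c p) (P.s y u) = fderiv (trans_map b c) (snd b p) u"
      using P.Ks[OF y, of u] unfolding io unfolding P.J_def p(3) .
    from leaf_metric_eq[OF b c p(1,2) this, of v] show ?thesis
      unfolding P.g_def P.J_def io unfolding p(3) .
  qed
  then show "leaf_metric A \<omega> \<phi> b y u v = P.g y u v" if "y \<in> ?S" using that .
  have bil: "bilinear (D b y)" "bilinear (N b y)" "bilinear (B b y)" if "y \<in> ?S" for y
    by (intro affine_connection_bilinear connections b subsetD[OF overlap_img that])+
  show "leaf_connections (img c) (\<lambda>x a b. \<omega> c x [a, b]) (\<lambda>x a b d. \<phi> c x [a, b, d]) (KE c)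
      ?S (trans_map b c) (D b) (B b) (N b)"
  proof (intro leaf_connections.intro leaf_patch[OF b c] leaf_connections_axioms.intro bil)
    show "smooth_on ?S (\<lambda>y. B b y u z)" for u z
    proof (rule smooth_on_subset[OF _ overlap_img])
      show "smooth_on (img b) (\<lambda>y. B b y u z)"
        by (rule affine_connection_smooth[OF connections(3) b])
    qed
  next
    fix y u z v assume y: "y \<in> ?S"
    then obtain p where p: "p \<in> fst b" "p \<in> fst c" "y = snd b p" by blast
    have x: "snd c p \<in> img c" by (rule in_img[OF p(2)])
    have io: "trans_map b c y = snd c p" unfolding p(3) by (rule trans_map_leaf[OF b p(1)])
    have s: "KE c (snd c p) (P.s y u) = fderiv (trans_map b c) (snd b p) u" for u
      using P.Ks[OF y, of u] unfolding io unfolding P.J_def p(3) .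
    let ?Q = "P.Q (snd c p)"
    have sJ: "KE c (snd c p) (P.s y u) = P.J y u" for u using P.Ks[OF y, of u] unfolding io .
    \<comment> \<open>The second field is constant in \<open>c\<close>, so only the derivative of
      the first contributes.\<close>
    have bracket: "lie_bracket (lift c (\<lambda>x. KE c x (P.s y u))) (lift c (\<lambda>x. P.s y z)) c (snd c p)
        = - ?Q (P.s y z) (P.s y u)"
      unfolding lie_bracket_lift[OF c x] fderiv_lift_self[OF c x] lift_self[OF c x] P.Q_def by simp
    have "P.J y (D b y u z) = KE c (snd c p)
          (lie_bracket (lift c (\<lambda>x. KE c x (P.s y u))) (lift c (\<lambda>x. P.s y z)) c (snd c p))
        + P.H y u z - ?Q (P.J y u) (P.s y z)"
      unfolding P.J_def P.H_def P.Q_def p(3)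
      by (rule restricted_connection_formula[where G = "D_graph T A \<omega> \<phi>", OF D b c p(1,2) D_graph_lift[OF c] s[unfolded p(3)] s[unfolded p(3)]])
    then show "P.J y (D b y u z) = P.H y u z - P.Q (trans_map b c y) (P.J y u) (P.s y z)
        - KE c (trans_map b c y) (P.Q (trans_map b c y) (P.s y z) (P.s y u))"
      by (simp add: io bracket linear_neg[OF P.lin_K[OF x]])
    obtain zf where zf: "Bott_graph T A \<omega> \<phi> (fst c) (lift c (\<lambda>x. KE c x (P.s y u))) (lift c (\<lambda>x. KE c x (P.s y z))) (lift c zf)"
      "\<And>x v. x \<in> img c \<Longrightarrow> \<omega> c x [zf x, v] = fderiv (\<lambda>y'. \<omega> c y' [KE c y' (P.s y z), v]) x (KE c x (P.s y u))
         + \<omega> c x [KE c x (P.s y z), fderiv (\<lambda>y'. KE c y' (P.s y u)) x v]"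
      by (rule Bott_graph_lift[OF c]) blast
    have JB: "P.J y (B b y u z) = zf (snd c p) + P.H y u z - ?Q (P.J y u) (P.s y z)"
    proof -
      have "P.J y (B b y u z) = lift c zf c (snd c p) + P.H y u z - ?Q (P.J y u) (P.s y z)"
        unfolding P.J_def P.H_def P.Q_def p(3)
        by (rule restricted_connection_formula[where G = "Bott_graph T A \<omega> \<phi>", OF B b c p(1,2) zf(1)[unfolded p(3)] s[unfolded p(3)] s[unfolded p(3)]])
      then show ?thesis by (simp only: lift_self[OF c x])
    qed
    have dwK: "((\<lambda>x. \<omega> c x [KE c x (P.s y z), v]) has_derivative
        (\<lambda>h. fderiv (\<lambda>x. \<omega> c x [KE c (snd c p) (P.s y z), v]) (snd c p) h + \<omega> c (snd c p) [?Q h (P.s y z), v])) (at (snd c p))"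
      using bilinear_family_has_derivative[OF P.w P.U x _ has_derivative_ident
          smooth_on_has_derivative[OF P.smooth_K x] has_derivative_const]
      by (simp add: P.Q_def linear_0[OF P.lin_w(1)[OF x]])
    have "\<omega> c (snd c p) [zf (snd c p), v] = fderiv (\<lambda>x. \<omega> c x [P.J y z, v]) (snd c p) (P.J y u)
        + \<omega> c (snd c p) [?Q (P.J y u) (P.s y z), v] + \<omega> c (snd c p) [P.J y z, ?Q v (P.s y u)]"
      using zf(2)[OF x, of v] fun_cong[OF fderiv_eqI[OF dwK], of "P.J y u"]
      unfolding sJ P.Q_def[symmetric] by (simp only:)
    moreover have "fderiv (\<lambda>y. \<omega> c (trans_map b c y) [P.J y z, v]) y u =
        fderiv (\<lambda>x. \<omega> c x [P.J y z, v]) (snd c p) (P.J y u) + \<omega> c (snd c p) [P.H y u z, v]"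
      using fun_cong[OF fderiv_eqI[OF P.dw_J[OF y, of z v]], of u] unfolding io .
    ultimately show "\<omega> c (trans_map b c y) [P.J y (B b y u z), v] =
        fderiv (\<lambda>y. \<omega> c (trans_map b c y) [P.J y z, v]) y u
        + \<omega> c (trans_map b c y) [P.J y z, P.Q (trans_map b c y) v (P.s y u)]"
      using JB by (simp add: io linear_add[OF P.lin_w(2)[OF x]] linear_diff[OF P.lin_w(2)[OF x]])
  next
    fix y u z assume "y \<in> ?S"
    then show "N b y u z = N b y z u"
      by (intro N_torsion_free b subsetD[OF overlap_img])
  next
    fix y u z h assume y: "y \<in> ?S"
    have "fderiv (\<lambda>y. P.g y u z) y = fderiv (\<lambda>y. leaf_metric A \<omega> \<phi> b y u z) y"
      by (rule fderiv_cong_open[OF P.Om y]) (simp add: g)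
    moreover have "fderiv (\<lambda>y. leaf_metric A \<omega> \<phi> b y u z) y h =
        leaf_metric A \<omega> \<phi> b y (N b y h u) z + leaf_metric A \<omega> \<phi> b y u (N b y h z)"
      by (rule N_compatible[OF b subsetD[OF overlap_img y]])
    ultimately show "fderiv (\<lambda>y. P.g y u z) y h = P.g y (N b y h u) z + P.g y u (N b y h z)"
      using g[OF y] by simp
  qed
qed

text \<open>A leaf chart need not lie in one ambient chart; the local results hold on overlaps, and
  these cover its image.\<close>

lemma overlap_exists:
  assumes "b \<in> AL" "y \<in> img b" obtains c where "c \<in> A" "y \<in> snd b ` (fst b \<inter> fst c)"
proof -
  obtain p where p: "p \<in> fst b" "y = snd b p" using assms(2) unfolding img_def by blast
  obtain c where "c \<in> A" "p \<in> fst c" using ambient_chart_exists[OF assms(1) p(1)] by blast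
  then show ?thesis using that p by blast
qed

lemma Bott_eq_dual:
  assumes "b \<in> AL" "y \<in> img b" shows "B b y u v = dual_connection N D b y u v"
proof -
  obtain c where c: "c \<in> A" "y \<in> snd b ` (fst b \<inter> fst c)" by (rule overlap_exists[OF assms])
  from leaf_connections.N_eq[OF leaf_connections(1)[OF assms(1) c(1)] c(2)]
  show ?thesis by (simp add: dual_connection_def)
qed

lemma torsion_free_B: "torsion_free AL B"
  unfolding torsion_free_def
proof (intro ballI allI)
  fix b y u v assume b: "b \<in> AL" and y: "y \<in> img b"
  obtain c where c: "c \<in> A" "y \<in> snd b ` (fst b \<inter> fst c)" by (rule overlap_exists[OF b y])
  show "B b y u v = B b y v u"
    by (rule leaf_connections.B_sym[OF leaf_connections(1)[OF b c(1)] c(2)])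
qed

lemma flat_B: "flat AL B"
  unfolding flat_def
proof (intro ballI allI)
  fix b y u v w assume b: "b \<in> AL" and y: "y \<in> img b"
  obtain c where c: "c \<in> A" "y \<in> snd b ` (fst b \<inter> fst c)" by (rule overlap_exists[OF b y])
  show "fderiv (\<lambda>y. B b y v w) y u - fderiv (\<lambda>y. B b y u w) y v + B b y u (B b y v w) - B b y v (B b y u w) = 0"
    by (rule leaf_connections.B_flat[OF leaf_connections(1)[OF b c(1)] c(2)])
qed

lemma affine_chart_B_zero:
  assumes "affine_chart AL B b" "y \<in> img b" shows "B b y u v = 0"
proof -
  have b: "b \<in> AL" and z: "B b y (axis j 1) (axis i 1) = 0" for i j
    using assms unfolding affine_chart_def by blast+
  have bil: "bilinear (B b y)" by (rule affine_connection_bilinear[OF connections(3) b assms(2)])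
  have lin: "linear (B b y u)" "linear (\<lambda>u. B b y u v)" for u v
    using bil by (simp_all add: bilinear_def)
  have "B b y (axis j 1) v = 0" for j
    by (rule linear_zero_on_axes[where f = "B b y (axis j 1)", OF lin(1) z])
  then show ?thesis
    by (rule linear_zero_on_axes[where f = "\<lambda>u. B b y u v", OF lin(2)])
qed

lemma local_potential_exists:
  assumes aff: "affine_chart AL B b" and y: "y \<in> img b"
  shows "\<exists>S f. y \<in> S \<and> local_potential (leaf_metric A \<omega> \<phi>) b S f"
proof -
  have b: "b \<in> AL" using aff unfolding affine_chart_def by blast
  obtain c where c: "c \<in> A" "y \<in> snd b ` (fst b \<inter> fst c)" by (rule overlap_exists[OF b y])
  let ?S = "snd b ` (fst b \<inter> fst c)"
  interpret P: leaf_connections "img c" "\<lambda>x a b. \<omega> c x [a, b]" "\<lambda>x a b d. \<phi> c x [a, b, d]" "KE c"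
    ?S "trans_map b c" "D b" "B b" "N b"
    by (rule leaf_connections(1)[OF b c(1)])
  obtain r where r: "r > 0" "ball y r \<subseteq> ?S" using P.Om c(2) open_contains_ball by blast
  have fam: "bilinear_family (ball y r) P.g"
    by (rule bilinear_family_subset[OF P.g_fam r(2) open_ball])
  have B0: "B b y' u v = 0" if "y' \<in> ?S" for y' u v
    using affine_chart_B_zero[OF aff] that overlap_img[of b c] by blast
  have "fderiv (\<lambda>y. P.g y u z) y' v = fderiv (\<lambda>y. P.g y v z) y' u" if "y' \<in> ball y r" for y' u v z
  proof -
    have y': "y' \<in> ?S" using that r(2) by blast
    show ?thesis using P.dg_of_B_zero[OF y' B0[OF y']] P.D_sym[OF y', of u v] by simp
  qed
  moreover have "P.g y' u v = P.g y' v u" if "y' \<in> ball y r" for y' u v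
    by (rule P.g_sym[OF subsetD[OF r(2) that]])
  moreover have "y \<in> ball y r" using r(1) by simp
  ultimately obtain f where f: "smooth_on (ball y r) f"
    "\<And>y' u v. y' \<in> ball y r \<Longrightarrow> fderiv (\<lambda>z. fderiv f z v) y' u = P.g y' u v"
    using hessian_potential_exists[OF open_ball convex_ball _ fam] by blast
  have "hessian_matrix f y' $ i $ j = leaf_metric A \<omega> \<phi> b y' (axis i 1) (axis j 1)" if "y' \<in> ball y r" for y' i j
    using f(2)[OF that] leaf_connections(2)[OF b c(1) subsetD[OF r(2) that]] by (simp add: hessian_matrix_def)
  moreover have "ball y r \<subseteq> img b" using r(2) overlap_img[of b c] by blast
  ultimately have "local_potential (leaf_metric A \<omega> \<phi>) b (ball y r) f"
    unfolding local_potential_def using f(1) by simp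
  then show ?thesis using r(1) centre_in_ball by blast
qed

text \<open>Formulated for the metric, which lives on the whole image of the chart, so that one
  constant serves all local potentials. Connectedness turns local constancy into constancy.\<close>

lemma det_leaf_metric_constant:
  assumes aff: "affine_chart AL B b" and conn: "connected (img b)"
  obtains k where "\<And>y. y \<in> img b \<Longrightarrow> det (\<chi> i j. leaf_metric A \<omega> \<phi> b y (axis i 1) (axis j 1)) = k"
proof -
  have b: "b \<in> AL" using aff unfolding affine_chart_def by blast
  define h where "h = (\<lambda>y. det (\<chi> i j. leaf_metric A \<omega> \<phi> b y (axis i 1) (axis j 1)))"
  have dh: "(h has_derivative (\<lambda>u. 0)) (at y)" if y: "y \<in> img b" for y
  proof -
    obtain c where c: "c \<in> A" "y \<in> snd b ` (fst b \<inter> fst c)" by (rule overlap_exists[OF b y])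
    let ?S = "snd b ` (fst b \<inter> fst c)"
    interpret P: leaf_connections "img c" "\<lambda>x a b. \<omega> c x [a, b]" "\<lambda>x a b d. \<phi> c x [a, b, d]" "KE c"
      ?S "trans_map b c" "D b" "B b" "N b"
      by (rule leaf_connections(1)[OF b c(1)])
    let ?h = "\<lambda>y. det (\<chi> i j. P.g y (axis i 1) (axis j 1))"
    have "smooth_on ?S (\<lambda>y. P.g y u v)" for u v
      using P.g_fam unfolding bilinear_family_def linear_family_def by blast
    then have "smooth_on ?S (\<lambda>y. (\<chi> i j. P.g y (axis i 1) (axis j 1)) $ i $ j)" for i j :: 3 by simp
    then have "smooth_on ?S ?h" by (rule smooth_on_det[OF P.Om])
    from smooth_on_has_derivative[OF this c(2)]
    have "(?h has_derivative fderiv ?h y) (at y)" .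
    moreover have "fderiv ?h y = (\<lambda>u. 0)"
      by (rule ext, rule P.det_g_stationary[OF c(2) affine_chart_B_zero[OF aff y]])
    ultimately have "(?h has_derivative (\<lambda>u. 0)) (at y)" by simp
    then show ?thesis
      by (rule has_derivative_transform_within_open[OF _ P.Om c(2)])
        (simp add: h_def leaf_connections(2)[OF b c(1)])
  qed
  have dh': "(h has_derivative (\<lambda>u. 0)) (at y within img b)" if "y \<in> img b" for y
    by (rule has_derivative_at_withinI[OF dh[OF that]])
  have "continuous_on (img b) h"
    by (rule has_derivative_continuous_on[where f' = "\<lambda>y u. 0", OF dh'])
  moreover have "\<forall>y\<in>img b - {}. (h has_derivative (\<lambda>u. 0)) (at y within img b)" using dh' by blast
  ultimately have "h constant_on img b"
    by (rule has_derivative_zero_connected_constant_on[OF conn im.L.chart_open(2)[OF b] finite.emptyI])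
  then obtain k where "\<forall>y\<in>img b. h y = k" unfolding constant_on_def by blast
  then show ?thesis using that unfolding h_def by blast
qed

end

theorem theorem4p5:
  fixes T :: "'a topology" and A :: "('a, 6) chart set"
    and \<omega> \<phi> :: "('a, 6) form"
    and TL :: "'a topology" and AL :: "('a, 3) chart set"
    and D N B :: "('a, 3) christoffel"
  assumes "smooth_manifold T A" and "connected_space T"
    and "symplectic_form A \<omega>"
    and "diff_form A 3 \<phi>" and "primitive A \<omega> \<phi>"
    and "\<forall>c\<in>A. \<forall>x\<in>img c. in_O0_plus (\<omega> c x) (\<phi> c x)"
    and "closed_form A 3 \<phi>" and "closed_form A 3 (F_form \<omega> \<phi>)"
    and "leaf T A \<omega> \<phi> TL AL"
    and "restricted_connection A (D_graph T A \<omega> \<phi>) TL AL D"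
    and "levi_civita TL AL (leaf_metric A \<omega> \<phi>) N"
    and "restricted_connection A (Bott_graph T A \<omega> \<phi>) TL AL B"
  shows "(\<forall>b\<in>AL. \<forall>y\<in>img b. \<forall>u v. B b y u v = dual_connection N D b y u v) \<and>
         hessian_metric AL B (leaf_metric A \<omega> \<phi>) \<and>
         (\<forall>b. affine_chart AL B b \<and> connected (img b) \<longrightarrow>
            (\<exists>k. \<forall>S f. local_potential (leaf_metric A \<omega> \<phi>) b S f \<longrightarrow>
               (\<forall>y\<in>S. det (hessian_matrix f y) = k)))"
proof -
  have leaf: "integral_submanifold T A \<omega> \<phi> TL AL" using assms(9) unfolding leaf_def by blast
  interpret leaf_manifold_connections T A \<omega> \<phi> TL AL D N B
  proof
    show "smooth_manifold TL AL" "continuous_map TL T id"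
      using leaf unfolding integral_submanifold_def by blast+
    fix b c assume bc: "b \<in> AL" "c \<in> A"
    then show "smooth_on (snd b ` (fst b \<inter> fst c)) (trans_map b c)"
      using leaf unfolding integral_submanifold_def by blast
    fix p assume "p \<in> fst b" "p \<in> fst c"
    then show "inj (fderiv (trans_map b c) (snd b p))"
      "range (fderiv (trans_map b c) (snd b p)) = {v. K_end \<omega> \<phi> c (snd c p) v = 0}"
      using leaf bc unfolding integral_submanifold_def by blast+
  qed (fact assms)+
  have "\<exists>k. \<forall>S f. local_potential (leaf_metric A \<omega> \<phi>) b S f \<longrightarrow> (\<forall>y\<in>S. det (hessian_matrix f y) = k)"
    if b: "affine_chart AL B b" "connected (img b)" for b
  proof -
    obtain k where k: "\<And>y. y \<in> img b \<Longrightarrow> det (\<chi> i j. leaf_metric A \<omega> \<phi> b y (axis i 1) (axis j 1)) = k"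
      by (rule det_leaf_metric_constant[OF b]) blast
    have "det (hessian_matrix f y) = k" if f: "local_potential (leaf_metric A \<omega> \<phi>) b S f" and y: "y \<in> S" for S f y
    proof -
      have "hessian_matrix f y = (\<chi> i j. leaf_metric A \<omega> \<phi> b y (axis i 1) (axis j 1))"
        using f y unfolding local_potential_def by (simp add: vec_eq_iff)
      moreover have "y \<in> img b" using f y unfolding local_potential_def by blast
      ultimately show ?thesis using k by simp
    qed
    then show ?thesis by blast
  qed
  moreover have "hessian_metric AL B (leaf_metric A \<omega> \<phi>)"
    unfolding hessian_metric_def using torsion_free_B flat_B local_potential_exists by blast
  ultimately show ?thesis using Bott_eq_dual by blast
qed

end
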